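(* Let $K$ be a functional differential field, let $n\ge 1$, and let $a_1,\dots,a_n\in K$. If the homogeneous linear differential equation $$y^{(n)}+a_1y^{(n-1)}+\dots+a_ny=0$$ has a nonzero solution representable by generalized quadratures over $K$, then it has a solution of the form $y_1=\exp z$ where $z'$ is algebraic over $K$.
   Context: Functional differential field: let $U$ be a connected Riemann surface and $x$ a non-constant meromorphic function on $U$. The field of all meromorphic functions on $U$ carries the derivation $f\mapsto f'=df/dx$. A functional differential field is a subfield $K$ of this field which contains all complex constants and is closed under this derivation. Extensions: if $V$ is a connected Riemann surface and $\pi:V\to U$ is a non-constant analytic map, the field of meromorphic functions on $V$ is equipped with the derivation $\varphi'=d\varphi/\pi^*dx$ and $K$ is identified with $\pi^*K$. All extensions of functional differential fields are realized this way. Solutions of differential equations over $K$ are possibly multivalued functions on $U$, viewed as meromorphic functions on suitable such $V$. In a differential field, $y$ is an integral over $F$ if $y'\in F$; a nonzero $y$ is an exponential of integral over $F$ if $y'=ay$ with $a\in F$. $F\langle y\rangle$ denotes the smallest differential field containing $F$ and $y$. A differential field $F\supset K$ is an extension of $K$ by generalized quadratures if there is a chain of differential fields $K=F_0\subseteq\dots\subseteq F_n$ with $F\subseteq F_n$ and $F_{i+1}=F_i\langle y_i\rangle$, where $y_i$ is an exponential of integral over $F_i$, an integral over $F_i$, or algebraic over $F_i$. A function is representable by generalized quadratures over $K$ if it belongs to some extension of $K$ by generalized quadratures. A function is of the form $\exp z$ with $z'$ algebraic over $K$ exactly when it is nonzero and its logarithmic derivative is algebraic over $K$. *)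

theory Defs
  imports "HOL-Complex_Analysis.Complex_Analysis" "HOL-Algebra.Algebra"
begin

section \<open>Riemann surfaces\<close>

text \<open>
  A surface is a topology together with a (not necessarily maximal) atlas; a chart is a pair
  of its domain and a map, of which only the values on the domain matter.  No countability
  condition is imposed; for connected surfaces it is automatic by Rado's theorem.
\<close>

record 'a surface =
  surf_top :: "'a topology"
  surf_charts :: "('a set \<times> ('a \<Rightarrow> complex)) set"

abbreviation points :: "'a surface \<Rightarrow> 'a set" where
  "points V \<equiv> topspace (surf_top V)"

definition riemann_surface :: "'a surface \<Rightarrow> bool" where
  "riemann_surface V \<longleftrightarrow>
     Hausdorff_space (surf_top V) \<and>
     (\<Union>(D, \<phi>) \<in> surf_charts V. D) = points V \<and>
     (\<forall>(D, \<phi>) \<in> surf_charts V.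
        openin (surf_top V) D \<and> open (\<phi> ` D) \<and>
        homeomorphic_map (subtopology (surf_top V) D) (top_of_set (\<phi> ` D)) \<phi>) \<and>
     (\<forall>(D, \<phi>) \<in> surf_charts V. \<forall>(E, \<psi>) \<in> surf_charts V.
        (\<lambda>z. \<psi> (inv_into D \<phi> z)) holomorphic_on \<phi> ` (D \<inter> E))"

definition connected_riemann_surface :: "'a surface \<Rightarrow> bool" where
  "connected_riemann_surface V \<longleftrightarrow>
     riemann_surface V \<and> connected_space (surf_top V) \<and> points V \<noteq> {}"

definition analytic_map :: "'b surface \<Rightarrow> 'a surface \<Rightarrow> ('b \<Rightarrow> 'a) \<Rightarrow> bool" where
  "analytic_map V U \<pi> \<longleftrightarrow>
     continuous_map (surf_top V) (surf_top U) \<pi> \<and>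
     (\<forall>(D, \<phi>) \<in> surf_charts V. \<forall>(E, \<psi>) \<in> surf_charts U.
        (\<lambda>z. \<psi> (\<pi> (inv_into D \<phi> z))) holomorphic_on \<phi> ` {p \<in> D. \<pi> p \<in> E})"

section \<open>The differential field of meromorphic functions\<close>

text \<open>
  A meromorphic function is represented by a total function with value 0 at its poles (as
  required by nicely_meromorphic_on) and outside the surface, so that equality of
  meromorphic functions is equality of representatives.
\<close>

definition meromorphic_functions :: "'a surface \<Rightarrow> ('a \<Rightarrow> complex) set" where
  "meromorphic_functions V =
     {f. (\<forall>(D, \<phi>) \<in> surf_charts V.
            (\<lambda>z. f (inv_into D \<phi> z)) nicely_meromorphic_on (\<phi> ` D)) \<and>
         (\<forall>p. p \<notin> points V \<longrightarrow> f p = 0)}"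

text \<open>
  Pointwise operations give wrong values at poles; as with remove_sings on the plane,
  the representative is recovered by taking punctured limits.
\<close>

definition mero_normal :: "'a surface \<Rightarrow> ('a \<Rightarrow> complex) \<Rightarrow> 'a \<Rightarrow> complex" where
  "mero_normal V f p =
     (if p \<in> points V \<and> (\<exists>c. (f \<longlongrightarrow> c) (atin (surf_top V) p))
      then Lim (atin (surf_top V) p) f else 0)"

definition mero_const :: "'a surface \<Rightarrow> complex \<Rightarrow> 'a \<Rightarrow> complex" where
  "mero_const V c p = (if p \<in> points V then c else 0)"

definition mero_field :: "'a surface \<Rightarrow> ('a \<Rightarrow> complex) ring" where
  "mero_field V =
     \<lparr>carrier = meromorphic_functions V,
      monoid.mult = (\<lambda>f g. mero_normal V (\<lambda>p. f p * g p)),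
      monoid.one = mero_const V 1,
      ring.zero = mero_const V 0,
      ring.add = (\<lambda>f g. mero_normal V (\<lambda>p. f p + g p))\<rparr>"

text \<open>
  The derivation "f \<mapsto> df/dx".  The quotient of the chart derivatives is independent
  of the chart away from the poles of f and x and the critical points of
  x; at these isolated points its value is irrelevant because of the normalization.
\<close>

definition chart_at :: "'a surface \<Rightarrow> 'a \<Rightarrow> 'a set \<times> ('a \<Rightarrow> complex)" where
  "chart_at V p = (SOME c. c \<in> surf_charts V \<and> p \<in> fst c)"

definition mero_deriv :: "'a surface \<Rightarrow> ('a \<Rightarrow> complex) \<Rightarrow> ('a \<Rightarrow> complex) \<Rightarrow> 'a \<Rightarrow> complex" where
  "mero_deriv V x f =
     mero_normal V
       (\<lambda>p. case chart_at V p of (D, \<phi>) \<Rightarrow>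
          deriv (\<lambda>z. f (inv_into D \<phi> z)) (\<phi> p) / deriv (\<lambda>z. x (inv_into D \<phi> z)) (\<phi> p))"

definition differential_subfield ::
    "'a surface \<Rightarrow> ('a \<Rightarrow> complex) \<Rightarrow> ('a \<Rightarrow> complex) set \<Rightarrow> bool" where
  "differential_subfield V x F \<longleftrightarrow>
     subfield F (mero_field V) \<and> (\<forall>f \<in> F. mero_deriv V x f \<in> F)"

definition functional_differential_field ::
    "'a surface \<Rightarrow> ('a \<Rightarrow> complex) \<Rightarrow> ('a \<Rightarrow> complex) set \<Rightarrow> bool" where
  "functional_differential_field U x K \<longleftrightarrow>
     connected_riemann_surface U \<and>
     x \<in> meromorphic_functions U \<and> (\<nexists>c. x = mero_const U c) \<and>
     range (mero_const U) \<subseteq> K \<and> differential_subfield U x K"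

section \<open>Extensions\<close>

definition surface_over :: "'b surface \<Rightarrow> ('b \<Rightarrow> 'a) \<Rightarrow> 'a surface \<Rightarrow> bool" where
  "surface_over V \<pi> U \<longleftrightarrow>
     connected_riemann_surface V \<and> analytic_map V U \<pi> \<and> (\<nexists>c. \<forall>p \<in> points V. \<pi> p = c)"

text \<open>
  For a non-constant analytic map, poles pull back to poles, so composition respects the
  convention on values at poles.
\<close>

definition pull :: "'b surface \<Rightarrow> ('b \<Rightarrow> 'a) \<Rightarrow> ('a \<Rightarrow> complex) \<Rightarrow> 'b \<Rightarrow> complex" where
  "pull V \<pi> f p = (if p \<in> points V then f (\<pi> p) else 0)"

definition diff_field_gen ::
    "'a surface \<Rightarrow> ('a \<Rightarrow> complex) \<Rightarrow> ('a \<Rightarrow> complex) set \<Rightarrow> ('a \<Rightarrow> complex) \<Rightarrow> ('a \<Rightarrow> complex) set" where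
  "diff_field_gen V x F y = \<Inter>{E. differential_subfield V x E \<and> F \<subseteq> E \<and> y \<in> E}"

definition integral_over ::
    "'a surface \<Rightarrow> ('a \<Rightarrow> complex) \<Rightarrow> ('a \<Rightarrow> complex) set \<Rightarrow> ('a \<Rightarrow> complex) \<Rightarrow> bool" where
  "integral_over V x F y \<longleftrightarrow> y \<in> meromorphic_functions V \<and> mero_deriv V x y \<in> F"

definition exp_integral_over ::
    "'a surface \<Rightarrow> ('a \<Rightarrow> complex) \<Rightarrow> ('a \<Rightarrow> complex) set \<Rightarrow> ('a \<Rightarrow> complex) \<Rightarrow> bool" where
  "exp_integral_over V x F y \<longleftrightarrow>
     y \<in> meromorphic_functions V \<and> y \<noteq> \<zero>\<^bsub>mero_field V\<^esub> \<and>
     (\<exists>a \<in> F. mero_deriv V x y = a \<otimes>\<^bsub>mero_field V\<^esub> y)"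

definition algebraic_over ::
    "'a surface \<Rightarrow> ('a \<Rightarrow> complex) set \<Rightarrow> ('a \<Rightarrow> complex) \<Rightarrow> bool" where
  "algebraic_over V F y \<longleftrightarrow>
     y \<in> meromorphic_functions V \<and> (ring.algebraic (mero_field V) over F) y"

text \<open>
  All fields of a chain live on one surface: a tower of surfaces can be pulled back to its top.
\<close>

definition generalized_quadratures_extension ::
    "'a surface \<Rightarrow> ('a \<Rightarrow> complex) \<Rightarrow> ('a \<Rightarrow> complex) set \<Rightarrow> ('a \<Rightarrow> complex) set \<Rightarrow> bool" where
  "generalized_quadratures_extension V x K F \<longleftrightarrow>
     differential_subfield V x F \<and> K \<subseteq> F \<and>
     (\<exists>m (C :: nat \<Rightarrow> ('a \<Rightarrow> complex) set).
        C 0 = K \<and> F \<subseteq> C m \<and>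
        (\<forall>i<m. \<exists>y. (exp_integral_over V x (C i) y \<or> integral_over V x (C i) y \<or>
                     algebraic_over V (C i) y) \<and>
                   C (Suc i) = diff_field_gen V x (C i) y))"

definition representable_by_generalized_quadratures ::
    "'a surface \<Rightarrow> ('a \<Rightarrow> complex) \<Rightarrow> ('a \<Rightarrow> complex) set \<Rightarrow> ('a \<Rightarrow> complex) \<Rightarrow> bool" where
  "representable_by_generalized_quadratures V x K y \<longleftrightarrow>
     (\<exists>F. generalized_quadratures_extension V x K F \<and> y \<in> F)"

section \<open>Linear differential equations\<close>

definition linear_ode_solution ::
    "'a surface \<Rightarrow> ('a \<Rightarrow> complex) \<Rightarrow> nat \<Rightarrow> (nat \<Rightarrow> 'a \<Rightarrow> complex) \<Rightarrow> ('a \<Rightarrow> complex) \<Rightarrow> bool" where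
  "linear_ode_solution V x n a y \<longleftrightarrow>
     y \<in> meromorphic_functions V \<and>
     (mero_deriv V x ^^ n) y \<oplus>\<^bsub>mero_field V\<^esub>
       (\<Oplus>\<^bsub>mero_field V\<^esub> i \<in> {1..n}. a i \<otimes>\<^bsub>mero_field V\<^esub> (mero_deriv V x ^^ (n - i)) y)
     = \<zero>\<^bsub>mero_field V\<^esub>"

text \<open>
  That y is meromorphic forces z to have no poles, since "exp z"
  would have an essential singularity there.
\<close>

definition exp_of_algebraic_integral ::
    "'a surface \<Rightarrow> ('a \<Rightarrow> complex) \<Rightarrow> ('a \<Rightarrow> complex) set \<Rightarrow> ('a \<Rightarrow> complex) \<Rightarrow> bool" where
  "exp_of_algebraic_integral V x K y \<longleftrightarrow>
     y \<in> meromorphic_functions V \<and>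
     (\<exists>z \<in> meromorphic_functions V.
        (\<forall>p \<in> points V. y p = exp (z p)) \<and> algebraic_over V K (mero_deriv V x z))"

end

theory Submission
  imports Defs "HOL-Computational_Algebra.Fundamental_Theorem_Algebra"
begin

text \<open>
  If y is a nonzero solution, then its logarithmic derivative u = y'/y satisfies the generalized
  Riccati equation R(u) = 0 of order n - 1, obtained by dividing the linear equation by y and
  writing y'/y, y''/y, ... as differential polynomials in u.  Conversely every solution u of the
  Riccati equation gives the solution "exp (\<integral>u dx)" of the linear equation.  Hence it
  suffices to find a solution of the Riccati equation that is algebraic over K, knowing one that
  lies in an extension of K by generalized quadratures.

  All fields are embedded into the field of complex Laurent series: at a point where x and the map
  from V to U are regular, x minus its value serves as a coordinate w on both surfaces at once, and
  Laurent expansion in w is an injective homomorphism that turns d/dx into d/dw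
  (exists_local_coordinate, expand_hom, inj_expand, expand_deriv).

  The extension is a tower of steps from F to F(t), where t is algebraic over F or t' lies in F or
  t' = bt with b in F.  Suppose that the Riccati equation, with coefficients in F, has a solution u
  algebraic over F(t) (riccati_specialization).  If t is transcendental, F(t) embeds into the
  Laurent series field F((s)) with s = 1/t, and by Puiseux's theorem the embedding extends to u
  after enlarging F and replacing s by a root of it.  Since t' is in F or in Ft, the derivation
  becomes one that does not lower the order in s.  So if u had a pole of order d > 0 at s = 0, the
  term that corresponds to u^n would be the only one with a pole of order nd in R(u), which is
  impossible.  Hence u has a value at s = 0; this value satisfies the same Riccati equation, and
  it is algebraic over F.  Repeating this from the top of the tower to the bottom
  (riccati_tower) gives a solution algebraic over K.

  Algebraic closures are avoided.  A field is called root closed under a monoid S of its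
  endomorphisms if every non-constant polynomial has a root after one of them is applied to its
  coefficients.  The complex numbers have this property with S = {id}, and if a field has it, so
  do the Laurent series over it, with the endomorphisms that send s to a power of s
  (puiseux_root_closed).  Consequently the result of the descent is a solution algebraic over K
  only after a substitution of a power of w for w, which changes d/dw into a multiple of d/dw.

  It remains to return to functions.  Only the minimal polynomial P of the solution is retained,
  and its coefficients come from K.  Near a point q where these coefficients are holomorphic and P
  stays separable, P has a holomorphic root v (implicit_holomorphic_root).  Sending the
  Laurent series solution to v is a differential homomorphism, since a derivation extends to an
  algebraic extension in only one way, so v satisfies the Riccati equation
  (algebraic_riccati_solution_on_disc).  On a disc about q the exponential of a primitive of v is
  the required solution (exponential_solution_on_disc).
\<close>

section \<open>Subfields, polynomials over them, and algebraic elements\<close>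

text \<open>
  All towers of fields live inside one field type, so that a field is a subset of it and a
  homomorphism a function whose values matter on that subset only.
\<close>

definition subfld :: "'a::field set \<Rightarrow> bool" where
  "subfld F \<longleftrightarrow> 0 \<in> F \<and> 1 \<in> F \<and> (\<forall>x\<in>F. \<forall>y\<in>F. x + y \<in> F \<and> x * y \<in> F) \<and>
     (\<forall>x\<in>F. - x \<in> F \<and> inverse x \<in> F)"

lemma subfldD:
  assumes "subfld F"
  shows "0 \<in> F" "1 \<in> F" "x \<in> F \<Longrightarrow> y \<in> F \<Longrightarrow> x + y \<in> F" "x \<in> F \<Longrightarrow> y \<in> F \<Longrightarrow> x * y \<in> F"
    "x \<in> F \<Longrightarrow> - x \<in> F" "x \<in> F \<Longrightarrow> inverse x \<in> F"
    "x \<in> F \<Longrightarrow> y \<in> F \<Longrightarrow> x - y \<in> F" "x \<in> F \<Longrightarrow> y \<in> F \<Longrightarrow> x / y \<in> F"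
proof -
  show *: "0 \<in> F" "1 \<in> F" "x \<in> F \<Longrightarrow> y \<in> F \<Longrightarrow> x + y \<in> F" "x \<in> F \<Longrightarrow> y \<in> F \<Longrightarrow> x * y \<in> F"
    "x \<in> F \<Longrightarrow> - x \<in> F" "x \<in> F \<Longrightarrow> inverse x \<in> F" for x y
    using assms unfolding subfld_def by auto
  show "x \<in> F \<Longrightarrow> y \<in> F \<Longrightarrow> x - y \<in> F"
    using *(3)[of x "- y"] *(5)[of y] by simp
  show "x \<in> F \<Longrightarrow> y \<in> F \<Longrightarrow> x / y \<in> F"
    using *(4)[of x "inverse y"] *(6)[of y] by (simp add: divide_inverse)
qed

lemma subfld_sum: "subfld F \<Longrightarrow> (\<And>i. i \<in> I \<Longrightarrow> f i \<in> F) \<Longrightarrow> sum f I \<in> F"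
  by (induction I rule: infinite_finite_induct) (auto intro: subfldD)

lemma subfld_of_nat: "subfld F \<Longrightarrow> of_nat n \<in> F"
  by (induction n) (auto intro: subfldD)

definition polys_over :: "'a::zero set \<Rightarrow> 'a poly set" where
  "polys_over F = {p. \<forall>i. Polynomial.coeff p i \<in> F}"

lemma polys_over_closed:
  assumes "subfld F"
  shows "0 \<in> polys_over F" "1 \<in> polys_over F" "c \<in> F \<Longrightarrow> [:c:] \<in> polys_over F"
    "p \<in> polys_over F \<Longrightarrow> q \<in> polys_over F \<Longrightarrow> p + q \<in> polys_over F"
    "p \<in> polys_over F \<Longrightarrow> q \<in> polys_over F \<Longrightarrow> p - q \<in> polys_over F"
    "p \<in> polys_over F \<Longrightarrow> q \<in> polys_over F \<Longrightarrow> p * q \<in> polys_over F"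
    "p \<in> polys_over F \<Longrightarrow> - p \<in> polys_over F"
    "c \<in> F \<Longrightarrow> p \<in> polys_over F \<Longrightarrow> Polynomial.smult c p \<in> polys_over F"
    "c \<in> F \<Longrightarrow> Polynomial.monom c n \<in> polys_over F"
    "p \<in> polys_over F \<Longrightarrow> pderiv p \<in> polys_over F"
  using subfldD[OF assms] subfld_of_nat[OF assms]
  by (auto simp: polys_over_def coeff_mult coeff_pderiv coeff_pCons coeff_1
      intro!: subfld_sum[OF assms] split: nat.splits simp del: of_nat_Suc)

lemma polys_over_pCons:
  "pCons c p \<in> polys_over F \<longleftrightarrow> c \<in> F \<and> p \<in> polys_over F"
  by (force simp: polys_over_def coeff_pCons split: nat.splits)

lemma poly_in_subfld:
  assumes "subfld F"
  shows "p \<in> polys_over F \<Longrightarrow> x \<in> F \<Longrightarrow> poly p x \<in> F"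
  by (induction p) (auto simp: polys_over_pCons intro: subfldD[OF assms])

lemma polys_over_division:
  assumes F: "subfld F" and P: "P \<in> polys_over F" "P \<noteq> 0" and p: "p \<in> polys_over F"
  obtains q r where "q \<in> polys_over F" "r \<in> polys_over F" "p = q * P + r"
    "r = 0 \<or> Polynomial.degree r < Polynomial.degree P"
proof -
  have "\<exists>q r. q \<in> polys_over F \<and> r \<in> polys_over F \<and> p = q * P + r \<and>
    (r = 0 \<or> Polynomial.degree r < Polynomial.degree P)"
    using p
  proof (induction "Polynomial.degree p" arbitrary: p rule: less_induct)
    case less
    show ?case
    proof (cases "p = 0 \<or> Polynomial.degree p < Polynomial.degree P")
      case True
      then show ?thesis
        using less.prems polys_over_closed(1)[OF F] by (intro exI[of _ 0] exI[of _ p]) auto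
    next
      case False
      define c where "c = Polynomial.lead_coeff p / Polynomial.lead_coeff P"
      define m where "m = Polynomial.monom c (Polynomial.degree p - Polynomial.degree P)"
      have c: "c \<in> F"
        using less.prems P subfldD[OF F] by (auto simp: c_def polys_over_def)
      have c0: "c \<noteq> 0" using False P by (auto simp: c_def)
      have m: "m \<in> polys_over F" using c polys_over_closed(9)[OF F] by (simp add: m_def)
      have dm: "Polynomial.degree (m * P) = Polynomial.degree p"
        using c0 P False by (simp add: degree_mult_eq m_def degree_monom_eq)
      have "Polynomial.lead_coeff (m * P) = Polynomial.lead_coeff p"
        using P c0 unfolding lead_coeff_mult by (simp add: m_def degree_monom_eq c_def)
      then have lc: "Polynomial.coeff (p - m * P) (Polynomial.degree p) = 0"
        using dm by simp
      have d: "Polynomial.degree (p - m * P) \<le> Polynomial.degree p"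
        using degree_diff_le_max[of p "m * P"] dm by simp
      have mp: "p - m * P \<in> polys_over F"
        using m P less.prems polys_over_closed[OF F] by blast
      show ?thesis
      proof (cases "p - m * P = 0 \<or> Polynomial.degree P = 0")
        case True
        then show ?thesis
        proof
          assume "p - m * P = 0"
          then show ?thesis
            using m polys_over_closed(1)[OF F] by (intro exI[of _ m] exI[of _ 0]) auto
        next
          assume "Polynomial.degree P = 0"
          then obtain a where a: "P = [:a:]" by (rule degree_eq_zeroE)
          have "a \<in> F" using P a by (simp add: polys_over_pCons)
          then have "Polynomial.smult (inverse a) p \<in> polys_over F"
            using less.prems polys_over_closed(8)[OF F subfldD(6)[OF F]] by simp
          then show ?thesis
            using P a polys_over_closed(1)[OF F] less.prems
            by (intro exI[of _ "Polynomial.smult (inverse a) p"] exI[of _ 0]) auto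
        qed
      next
        case False
        then have "Polynomial.degree (p - m * P) \<noteq> Polynomial.degree p"
          using lc by (metis leading_coeff_0_iff)
        then have "Polynomial.degree (p - m * P) < Polynomial.degree p" using d by simp
        from less.hyps[OF this mp] obtain q r where qr: "q \<in> polys_over F" "r \<in> polys_over F"
          "p - m * P = q * P + r" "r = 0 \<or> Polynomial.degree r < Polynomial.degree P" by blast
        then have "p = (q + m) * P + r" by (simp add: algebra_simps)
        then show ?thesis
          using qr m polys_over_closed(4)[OF F] by (intro exI[of _ "q + m"] exI[of _ r]) auto
      qed
    qed
  qed
  then show thesis using that by blast
qed

definition alg_over :: "'a::field set \<Rightarrow> 'a \<Rightarrow> bool" where
  "alg_over F x \<longleftrightarrow> (\<exists>p \<in> polys_over F. p \<noteq> 0 \<and> poly p x = 0)"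

lemma alg_over_minimal_polynomial:
  assumes "alg_over F x"
  obtains P where "P \<in> polys_over F" "P \<noteq> 0" "poly P x = 0"
    "\<And>p. p \<in> polys_over F \<Longrightarrow> poly p x = 0 \<Longrightarrow> p \<noteq> 0 \<Longrightarrow> Polynomial.degree P \<le> Polynomial.degree p"
proof -
  obtain p where "p \<in> polys_over F" "p \<noteq> 0" "poly p x = 0"
    using assms by (auto simp: alg_over_def)
  then have "\<exists>P. (P \<in> polys_over F \<and> P \<noteq> 0 \<and> poly P x = 0) \<and>
      (\<forall>p. p \<in> polys_over F \<and> p \<noteq> 0 \<and> poly p x = 0 \<longrightarrow> Polynomial.degree P \<le> Polynomial.degree p)"
    by (intro ex_has_least_nat[of _ p]) auto
  then show thesis using that by blast
qed

text \<open>
  Division with remainder does not leave the polynomials over F, so the usual argument about the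
  degree of the remainder applies.
\<close>

lemma minimal_polynomial_dvd:
  assumes F: "subfld F" and P: "P \<in> polys_over F" "P \<noteq> 0"
    and min: "\<And>p. p \<in> polys_over F \<Longrightarrow> poly p x = 0 \<Longrightarrow> p \<noteq> 0 \<Longrightarrow> Polynomial.degree P \<le> Polynomial.degree p"
    and Px: "poly P x = 0" and p: "p \<in> polys_over F" "poly p x = 0"
  obtains q where "q \<in> polys_over F" "p = q * P"
proof -
  obtain q r where qr: "q \<in> polys_over F" "r \<in> polys_over F" "p = q * P + r"
    "r = 0 \<or> Polynomial.degree r < Polynomial.degree P"
    using polys_over_division[OF F P p(1)] .
  have "poly r x = 0" using qr(3) p(2) Px by simp
  then have "r = 0" using min[OF qr(2)] qr(4) by fastforce
  then show thesis using that qr by auto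
qed

section \<open>Homomorphisms\<close>

definition hom_on :: "'a::field set \<Rightarrow> ('a \<Rightarrow> 'b::field) \<Rightarrow> bool" where
  "hom_on F h \<longleftrightarrow> h 0 = 0 \<and> h 1 = 1 \<and> (\<forall>x\<in>F. \<forall>y\<in>F. h (x + y) = h x + h y \<and> h (x * y) = h x * h y)"

lemma hom_onD:
  assumes h: "hom_on F h" and F: "subfld F"
  shows "h 0 = 0" "h 1 = 1" "x \<in> F \<Longrightarrow> y \<in> F \<Longrightarrow> h (x + y) = h x + h y"
    "x \<in> F \<Longrightarrow> y \<in> F \<Longrightarrow> h (x * y) = h x * h y" "x \<in> F \<Longrightarrow> h (- x) = - h x"
    "x \<in> F \<Longrightarrow> h (inverse x) = inverse (h x)" "x \<in> F \<Longrightarrow> h x = 0 \<longleftrightarrow> x = 0"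
    "x \<in> F \<Longrightarrow> y \<in> F \<Longrightarrow> h (x - y) = h x - h y"
    "x \<in> F \<Longrightarrow> y \<in> F \<Longrightarrow> h (x / y) = h x / h y"
proof -
  show *: "h 0 = 0" "h 1 = 1" "x \<in> F \<Longrightarrow> y \<in> F \<Longrightarrow> h (x + y) = h x + h y"
    "x \<in> F \<Longrightarrow> y \<in> F \<Longrightarrow> h (x * y) = h x * h y" for x y
    using h by (auto simp: hom_on_def)
  show m: "x \<in> F \<Longrightarrow> h (- x) = - h x" for x
    using *(3)[of x "- x"] *(1) subfldD(5)[OF F, of x] by (simp add: eq_neg_iff_add_eq_0 add.commute)
  show i: "x \<in> F \<Longrightarrow> h (inverse x) = inverse (h x)" for x
    using *(4)[of x "inverse x"] *(1,2) subfldD(6)[OF F, of x]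
    by (cases "x = 0") (auto simp: inverse_unique)
  show "x \<in> F \<Longrightarrow> h x = 0 \<longleftrightarrow> x = 0"
    using *(4)[of x "inverse x"] *(1,2) subfldD(6)[OF F, of x] by (cases "x = 0") auto
  show "x \<in> F \<Longrightarrow> y \<in> F \<Longrightarrow> h (x - y) = h x - h y"
    using *(3)[of x "- y"] m[of y] subfldD(5)[OF F, of y] by simp
  show "x \<in> F \<Longrightarrow> y \<in> F \<Longrightarrow> h (x / y) = h x / h y"
    using *(4)[of x "inverse y"] i[of y] subfldD(6)[OF F, of y] by (simp add: divide_inverse)
qed

lemma hom_on_sum:
  assumes "hom_on F h" "subfld F" "\<And>i. i \<in> I \<Longrightarrow> f i \<in> F"
  shows "h (sum f I) = (\<Sum>i\<in>I. h (f i))"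
  using assms(3)
  by (induction I rule: infinite_finite_induct)
    (auto simp: hom_onD[OF assms(1,2)] subfld_sum[OF assms(2)])

lemma hom_on_mono: "hom_on L h \<Longrightarrow> F \<subseteq> L \<Longrightarrow> hom_on F h"
  by (auto simp: hom_on_def)

lemma subfld_image:
  assumes "hom_on F h" "subfld F" shows "subfld (h ` F)"
  unfolding subfld_def
proof (intro conjI ballI)
  note hs = hom_onD[OF assms] and F = subfldD[OF assms(2)]
  show "0 \<in> h ` F" "1 \<in> h ` F" using hs(1,2) F(1,2) by (metis image_eqI)+
  fix x assume "x \<in> h ` F"
  then obtain u where u: "u \<in> F" "x = h u" by auto
  show "- x \<in> h ` F" "inverse x \<in> h ` F"
    using u hs(5,6)[of u] F(5,6)[of u] by (metis image_eqI)+
  fix y assume "y \<in> h ` F"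
  then obtain v where v: "v \<in> F" "y = h v" by auto
  show "x + y \<in> h ` F" "x * y \<in> h ` F"
    using u v hs(3,4)[of u v] F(3,4)[of u v] by (metis image_eqI)+
qed

lemma map_poly_hom:
  assumes h: "hom_on F h" and F: "subfld F" and p: "p \<in> polys_over F" and q: "q \<in> polys_over F"
  shows "map_poly h (p + q) = map_poly h p + map_poly h q"
    "map_poly h (p * q) = map_poly h p * map_poly h q"
    "Polynomial.degree (map_poly h p) = Polynomial.degree p"
    "map_poly h p = 0 \<longleftrightarrow> p = 0"
proof -
  note hs = hom_onD[OF h F]
  have c: "Polynomial.coeff p i \<in> F" "Polynomial.coeff q i \<in> F" for i
    using p q by (auto simp: polys_over_def)
  show "map_poly h (p + q) = map_poly h p + map_poly h q"
    using c by (intro poly_eqI) (simp add: coeff_map_poly hs)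
  show "map_poly h (p * q) = map_poly h p * map_poly h q"
    using c by (intro poly_eqI)
      (simp add: coeff_map_poly hs coeff_mult hom_on_sum[OF h F] subfldD[OF F])
  show *: "map_poly h p = 0 \<longleftrightarrow> p = 0"
    using c hs(1,7) by (auto simp: poly_eq_iff coeff_map_poly)
  show "Polynomial.degree (map_poly h p) = Polynomial.degree p"
  proof (rule antisym)
    show "Polynomial.degree (map_poly h p) \<le> Polynomial.degree p"
      using hs(1) by (intro degree_le) (auto simp: coeff_map_poly coeff_eq_0)
    show "Polynomial.degree p \<le> Polynomial.degree (map_poly h p)"
      using c(1) hs(1,7) by (cases "p = 0") (auto intro!: le_degree simp: coeff_map_poly)
  qed
qed

lemma map_poly_pderiv:
  assumes h: "hom_on F h" and F: "subfld F" and P: "P \<in> polys_over F"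
  shows "map_poly h (pderiv P) = pderiv (map_poly h P)"
proof (intro poly_eqI)
  fix i
  have "h (of_nat k) = of_nat k" for k
    by (induction k) (simp_all add: hom_onD[OF h F] subfld_of_nat[OF F] subfldD[OF F])
  then show "Polynomial.coeff (map_poly h (pderiv P)) i = Polynomial.coeff (pderiv (map_poly h P)) i"
    using P by (simp add: polys_over_def coeff_map_poly hom_onD[OF h F] coeff_pderiv subfld_of_nat[OF F] del: of_nat_Suc)
qed

lemma poly_map_poly_hom:
  assumes h: "hom_on F h" and F: "subfld F" and p: "p \<in> polys_over F" and "x \<in> F"
  shows "h (poly p x) = poly (map_poly h p) (h x)"
  using p
proof (induction p)
  case (pCons a p)
  then show ?case
    using hom_onD[OF h F] poly_in_subfld[OF F, of p x] subfldD[OF F] \<open>x \<in> F\<close>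
    by (simp add: polys_over_pCons map_poly_pCons)
qed (simp add: hom_onD[OF h F])

lemma alg_over_image:
  assumes h: "hom_on L h" and L: "subfld L" and "F \<subseteq> L" "u \<in> L" "alg_over F u" "subfld F"
  shows "alg_over (h ` F) (h u)"
proof -
  obtain p where p: "p \<in> polys_over F" "p \<noteq> 0" "poly p u = 0"
    using assms by (auto simp: alg_over_def)
  then have pL: "p \<in> polys_over L" using assms by (auto simp: polys_over_def)
  have "poly (map_poly h p) (h u) = 0"
    using poly_map_poly_hom[OF h L pL \<open>u \<in> L\<close>] p hom_onD[OF h L] by simp
  moreover have "map_poly h p \<noteq> 0" using map_poly_hom(4)[OF h L pL pL] p by simp
  moreover have "map_poly h p \<in> polys_over (h ` F)"
    using p hom_onD(1)[OF h L] by (auto simp: polys_over_def coeff_map_poly)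
  ultimately show ?thesis by (auto simp: alg_over_def)
qed

section \<open>Simple extensions\<close>

definition adjoin :: "'a::field set \<Rightarrow> 'a \<Rightarrow> 'a set" where
  "adjoin F t = {poly p t / poly q t | p q. p \<in> polys_over F \<and> q \<in> polys_over F \<and> poly q t \<noteq> 0}"

lemma adjoinI:
  assumes "subfld F" "p \<in> polys_over F" "q \<in> polys_over F"
  shows "poly p t / poly q t \<in> adjoin F t"
proof (cases "poly q t = 0")
  case True
  then have "poly p t / poly q t = poly 0 t / poly 1 t" by simp
  then show ?thesis
    using polys_over_closed[OF assms(1)] unfolding adjoin_def by (intro CollectI exI[of _ 0] exI[of _ 1]) auto
next
  case False
  then show ?thesis using assms unfolding adjoin_def by blast
qed

lemma adjoin_poly: "subfld F \<Longrightarrow> p \<in> polys_over F \<Longrightarrow> poly p t \<in> adjoin F t"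
  using adjoinI[of F p 1 t] polys_over_closed(2)[of F] by simp

lemma subfld_adjoin:
  assumes F: "subfld F"
  shows "subfld (adjoin F t)" "F \<subseteq> adjoin F t" "t \<in> adjoin F t"
proof -
  note c = polys_over_closed[OF F]
  show "F \<subseteq> adjoin F t"
  proof
    fix x assume "x \<in> F"
    then show "x \<in> adjoin F t" using adjoin_poly[OF F c(3)[of x], of t] by simp
  qed
  show "t \<in> adjoin F t"
    using adjoin_poly[OF F c(9)[of 1 1], of t] subfldD(2)[OF F] by (simp add: poly_monom)
  show "subfld (adjoin F t)"
    unfolding subfld_def
  proof (intro conjI ballI)
    show "0 \<in> adjoin F t" "1 \<in> adjoin F t"
      using adjoin_poly[OF F c(1), of t] adjoin_poly[OF F c(2), of t] by simp_all
    fix x assume "x \<in> adjoin F t"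
    then obtain p q where x: "p \<in> polys_over F" "q \<in> polys_over F" "poly q t \<noteq> 0" "x = poly p t / poly q t"
      by (auto simp: adjoin_def)
    show "- x \<in> adjoin F t" using adjoinI[OF F c(7)[OF x(1)] x(2), of t] x by simp
    show "inverse x \<in> adjoin F t" using adjoinI[OF F x(2,1), of t] x by simp
    fix y assume "y \<in> adjoin F t"
    then obtain p' q' where y: "p' \<in> polys_over F" "q' \<in> polys_over F" "poly q' t \<noteq> 0" "y = poly p' t / poly q' t"
      by (auto simp: adjoin_def)
    have "p * q' + p' * q \<in> polys_over F" "q * q' \<in> polys_over F" "p * p' \<in> polys_over F"
      using x y by (auto intro!: c)
    from adjoinI[OF F this(1,2), of t] adjoinI[OF F this(3,2), of t]
    show "x + y \<in> adjoin F t" "x * y \<in> adjoin F t"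
      using x(3,4) y(3,4) by (simp_all add: add_divide_eq_iff divide_add_eq_iff add_frac_eq mult.commute)
  qed
qed

lemma adjoin_least:
  assumes "subfld L" "F \<subseteq> L" "t \<in> L" shows "adjoin F t \<subseteq> L"
proof
  fix x assume "x \<in> adjoin F t"
  then obtain p q where x: "p \<in> polys_over F" "q \<in> polys_over F" "x = poly p t / poly q t"
    by (auto simp: adjoin_def)
  then have "p \<in> polys_over L" "q \<in> polys_over L" using assms(2) by (auto simp: polys_over_def)
  then show "x \<in> L" using x assms poly_in_subfld subfldD(8) by metis
qed

text \<open>
  The image of p(t)/q(t) is forced to be p(T)/q(T).  That t and T satisfy the same polynomial
  relations is exactly what makes this independent of the chosen fraction.
\<close>

lemma extend_hom:
  fixes h :: "'a::field \<Rightarrow> 'b::field"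
  assumes F: "subfld F" and h: "hom_on F h"
    and same: "\<And>p. p \<in> polys_over F \<Longrightarrow> poly p t = 0 \<longleftrightarrow> poly (map_poly h p) T = 0"
  obtains h' where "hom_on (adjoin F t) h'" "\<And>x. x \<in> F \<Longrightarrow> h' x = h x" "h' t = T"
proof -
  define R where "R x y \<longleftrightarrow> (\<exists>p q. p \<in> polys_over F \<and> q \<in> polys_over F \<and> poly q t \<noteq> 0 \<and>
     x = poly p t / poly q t \<and> y = poly (map_poly h p) T / poly (map_poly h q) T)" for x y
  define h' where "h' x = (THE y. R x y)" for x
  note c = polys_over_closed[OF F]
  note m = map_poly_hom[OF h F]
  have sub: "map_poly h (p - q) = map_poly h p - map_poly h q"
    if "p \<in> polys_over F" "q \<in> polys_over F" for p q
    using m(1)[of "p - q" q] c(5)[OF that] that subfldD[OF F] by simp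
  have uniq: "y = y'" if "R x y" "R x y'" for x y y'
  proof -
    obtain p q where pq: "p \<in> polys_over F" "q \<in> polys_over F" "poly q t \<noteq> 0"
      "x = poly p t / poly q t" "y = poly (map_poly h p) T / poly (map_poly h q) T"
      using \<open>R x y\<close> by (auto simp: R_def)
    obtain p' q' where pq': "p' \<in> polys_over F" "q' \<in> polys_over F" "poly q' t \<noteq> 0"
      "x = poly p' t / poly q' t" "y' = poly (map_poly h p') T / poly (map_poly h q') T"
      using \<open>R x y'\<close> by (auto simp: R_def)
    have "poly (p * q' - p' * q) t = 0" using pq pq' by (simp add: field_simps)
    then have "poly (map_poly h (p * q' - p' * q)) T = 0"
      using same[of "p * q' - p' * q"] pq pq' by (auto intro!: c)
    also have "map_poly h (p * q' - p' * q) = map_poly h p * map_poly h q' - map_poly h p' * map_poly h q"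
      using pq pq' by (subst sub) (auto simp: m intro!: c)
    finally show ?thesis
      using same[of q] same[of q'] pq(1-3) pq'(1-3) unfolding pq(5) pq'(5)
      by (simp add: frac_eq_eq)
  qed
  have hR: "h' x = y" if "R x y" for x y
    unfolding h'_def using that uniq by blast
  have ex: "R x (h' x)" if "x \<in> adjoin F t" for x
  proof -
    from that have "\<exists>y. R x y" unfolding adjoin_def R_def by blast
    then show ?thesis using hR by blast
  qed
  show thesis
  proof (rule that[of h'])
    show hF: "h' x = h x" if "x \<in> F" for x
      by (rule hR, unfold R_def, rule exI[of _ "[:x:]"], rule exI[of _ 1])
        (use that c hom_onD[OF h F] in \<open>auto simp: map_poly_pCons\<close>)
    show "h' t = T"
      by (rule hR, unfold R_def, rule exI[of _ "[:0,1:]"], rule exI[of _ 1])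
        (use c subfldD[OF F] hom_onD[OF h F] in \<open>auto simp: map_poly_pCons polys_over_pCons\<close>)
    show "hom_on (adjoin F t) h'"
      unfolding hom_on_def
    proof (intro conjI ballI)
      show "h' 0 = 0" "h' 1 = 1" using hF[of 0] hF[of 1] subfldD(1,2)[OF F] hom_onD(1,2)[OF h F] by auto
      fix x y assume "x \<in> adjoin F t" "y \<in> adjoin F t"
      then have "R x (h' x)" "R y (h' y)" using ex by auto
      then obtain p q p' q' where pq: "p \<in> polys_over F" "q \<in> polys_over F" "poly q t \<noteq> 0"
        "x = poly p t / poly q t" "h' x = poly (map_poly h p) T / poly (map_poly h q) T"
        "p' \<in> polys_over F" "q' \<in> polys_over F" "poly q' t \<noteq> 0"
        "y = poly p' t / poly q' t" "h' y = poly (map_poly h p') T / poly (map_poly h q') T"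
        unfolding R_def by blast
      have nz: "poly (map_poly h q) T \<noteq> 0" "poly (map_poly h q') T \<noteq> 0"
        using same pq by auto
      show "h' (x + y) = h' x + h' y"
      proof (rule hR, unfold R_def, rule exI[of _ "p * q' + p' * q"], rule exI[of _ "q * q'"], intro conjI)
        show "p * q' + p' * q \<in> polys_over F" "q * q' \<in> polys_over F" using pq(1,2,6,7) by (auto intro!: c)
        show "h' x + h' y = poly (map_poly h (p * q' + p' * q)) T / poly (map_poly h (q * q')) T"
          using pq(1,2,6,7) nz unfolding pq(5,10) by (simp add: m c add_frac_eq)
        show "x + y = poly (p * q' + p' * q) t / poly (q * q') t"
          using pq(3,8) unfolding pq(4,9) by (simp add: add_frac_eq)
      qed (use pq(3,8) in auto)
      show "h' (x * y) = h' x * h' y"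
      proof (rule hR, unfold R_def, rule exI[of _ "p * p'"], rule exI[of _ "q * q'"], intro conjI)
        show "p * p' \<in> polys_over F" "q * q' \<in> polys_over F" using pq(1,2,6,7) by (auto intro!: c)
        show "h' x * h' y = poly (map_poly h (p * p')) T / poly (map_poly h (q * q')) T"
          using pq(1,2,6,7) nz unfolding pq(5,10) by (simp add: m c)
        show "x * y = poly (p * p') t / poly (q * q') t" unfolding pq(4,9) by simp
      qed (use pq(3,8) in auto)
    qed
  qed
qed

text \<open>
  The polynomials p with h(p)(w) = 0 form an ideal that contains P, generated by some r.  As r
  divides P and is not constant, minimality of P leaves only the possibility that r is P up to a
  constant.  Thus any root of h(P) may serve as the image of u.
\<close>

lemma minimal_polynomial_same_relations:
  fixes h :: "'a::field \<Rightarrow> 'b::field"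
  assumes F: "subfld F" and h: "hom_on F h" and P: "P \<in> polys_over F" "P \<noteq> 0" "poly P u = 0"
    and min: "\<And>p. p \<in> polys_over F \<Longrightarrow> poly p u = 0 \<Longrightarrow> p \<noteq> 0 \<Longrightarrow> Polynomial.degree P \<le> Polynomial.degree p"
    and w: "poly (map_poly h P) w = 0" and p: "p \<in> polys_over F"
  shows "poly p u = 0 \<longleftrightarrow> poly (map_poly h p) w = 0"
proof
  note m = map_poly_hom[OF h F]
  note z = subfldD(1)[OF F]
  {
    assume "poly p u = 0"
    from minimal_polynomial_dvd[OF F P(1,2) min P(3) p this]
    obtain q where "q \<in> polys_over F" "p = q * P" by blast
    then show "poly (map_poly h p) w = 0" using m(2)[of q P] P w by simp
  }
  assume pw: "poly (map_poly h p) w = 0"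
  obtain r where r: "r \<in> polys_over F" "r \<noteq> 0" "poly (map_poly h r) w = 0"
    and rmin: "\<And>p. p \<in> polys_over F \<Longrightarrow> poly (map_poly h p) w = 0 \<Longrightarrow> p \<noteq> 0 \<Longrightarrow>
      Polynomial.degree r \<le> Polynomial.degree p"
  proof -
    have "\<exists>r. (r \<in> polys_over F \<and> r \<noteq> 0 \<and> poly (map_poly h r) w = 0) \<and>
      (\<forall>p. p \<in> polys_over F \<and> p \<noteq> 0 \<and> poly (map_poly h p) w = 0 \<longrightarrow> Polynomial.degree r \<le> Polynomial.degree p)"
      using P w by (intro ex_has_least_nat[of _ P]) auto
    then show ?thesis using that by blast
  qed
  have dvd: "\<exists>q. q \<in> polys_over F \<and> g = q * r" if g: "g \<in> polys_over F" "poly (map_poly h g) w = 0" for g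
  proof -
    obtain q s where qs: "q \<in> polys_over F" "s \<in> polys_over F" "g = q * r + s"
      "s = 0 \<or> Polynomial.degree s < Polynomial.degree r"
      using polys_over_division[OF F r(1,2) g(1)] .
    have qr: "q * r \<in> polys_over F" using qs r polys_over_closed(6)[OF F] by blast
    have "poly (map_poly h s) w = 0"
      using g(2) qs r m(1)[OF qr qs(2)] m(2)[OF qs(1) r(1)] by simp
    then have "s = 0" using rmin[OF qs(2)] qs(4) by fastforce
    then show ?thesis using qs by auto
  qed
  obtain q where q: "q \<in> polys_over F" "P = q * r" using dvd[OF P(1) w] by blast
  have "poly r u = 0"
  proof (rule ccontr)
    assume "poly r u \<noteq> 0"
    then have "poly q u = 0" using P q by auto
    moreover have q0: "q \<noteq> 0" using P q by auto
    ultimately have "Polynomial.degree P \<le> Polynomial.degree q" using min[OF q(1)] by blast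
    then have "Polynomial.degree r = 0" using q q0 r(2) by (simp add: degree_mult_eq)
    then obtain a where a: "r = [:a:]" by (rule degree_eq_zeroE)
    have "h a = 0" using r(3) a hom_onD(1)[OF h F] by (simp add: map_poly_pCons)
    moreover have "a \<in> F" using r(1) a by (simp add: polys_over_pCons)
    ultimately show False using hom_onD(7)[OF h F, of a] r(2) a by simp
  qed
  then show "poly p u = 0" using dvd[OF p pw] by auto
qed

section \<open>Derivations\<close>

definition derivation :: "('a::field \<Rightarrow> 'a) \<Rightarrow> bool" where
  "derivation D \<longleftrightarrow> (\<forall>x y. D (x + y) = D x + D y \<and> D (x * y) = D x * y + x * D y)"

lemma derivationD:
  assumes "derivation D"
  shows "D (x + y) = D x + D y" "D (x * y) = D x * y + x * D y" "D 0 = 0" "D 1 = 0" "D (- x) = - D x"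
    "x \<noteq> 0 \<Longrightarrow> D (inverse x) = - D x * inverse x * inverse x"
proof -
  show *: "D (x + y) = D x + D y" "D (x * y) = D x * y + x * D y" for x y
    using assms by (auto simp: derivation_def)
  have "D 0 + D 0 = D 0" using *(1)[of 0 0] by simp
  then show 0: "D 0 = 0" by (metis add_cancel_right_right)
  have "D 1 + D 1 = D 1" using *(2)[of 1 1] by simp
  then show 1: "D 1 = 0" by (metis add_cancel_right_right)
  show "D (- x) = - D x" using *(1)[of x "- x"] 0 by (simp add: eq_neg_iff_add_eq_0 add.commute)
  assume "x \<noteq> 0"
  then have "D x * inverse x + x * D (inverse x) = 0" using *(2)[of x "inverse x"] 1 by simp
  then show "D (inverse x) = - D x * inverse x * inverse x"
    using \<open>x \<noteq> 0\<close> by (simp add: field_simps add_eq_0_iff2)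
qed

lemma derivation_poly:
  assumes "derivation D"
  shows "D (poly p x) = poly (map_poly D p) x + poly (pderiv p) x * D x"
proof (induction p)
  case (pCons a p)
  then show ?case
    by (simp add: derivationD[OF assms] map_poly_pCons pderiv_pCons algebra_simps)
qed (simp add: derivationD[OF assms])

text \<open>
  The elements at which g commutes with the derivations form a field, so it suffices to
  test generators.
\<close>

lemma hom_commutes_adjoin:
  fixes g :: "'a::field \<Rightarrow> 'b::field"
  assumes F: "subfld F" and g: "hom_on (adjoin F t) g" and D: "derivation D" "derivation D'"
    and DF: "\<And>x. x \<in> F \<Longrightarrow> D x \<in> adjoin F t \<and> g (D x) = D' (g x)"
    and Dt: "D t \<in> adjoin F t" "g (D t) = D' (g t)"
    and x: "x \<in> adjoin F t"
  shows "D x \<in> adjoin F t \<and> g (D x) = D' (g x)"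
proof -
  define A where "A = adjoin F t"
  have A: "subfld A" using subfld_adjoin[OF F] by (simp add: A_def)
  note hs = hom_onD[OF g[folded A_def] A] and d = derivationD[OF D(1)] and d' = derivationD[OF D(2)]
  note c = subfldD[OF A]
  define L where "L = {x \<in> A. D x \<in> A \<and> g (D x) = D' (g x)}"
  have "subfld L"
    unfolding subfld_def
  proof (intro conjI ballI)
    show "0 \<in> L" "1 \<in> L" by (auto simp: L_def c d d' hs)
    fix x assume x: "x \<in> L"
    then show "- x \<in> L" by (simp add: L_def c d d' hs)
    show "inverse x \<in> L"
    proof (cases "x = 0")
      case False
      then have "g x \<noteq> 0" using x hs(7)[of x] by (auto simp: L_def)
      then show ?thesis using False x by (simp add: L_def c d d' hs)
    qed (use \<open>0 \<in> L\<close> in simp)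
    fix y assume "y \<in> L"
    with x show "x + y \<in> L" "x * y \<in> L" by (auto simp: L_def c d d' hs)
  qed
  moreover have "F \<subseteq> L" "t \<in> L" using DF Dt subfld_adjoin[OF F, of t] by (auto simp: L_def A_def)
  ultimately have "adjoin F t \<subseteq> L" by (rule adjoin_least)
  then show ?thesis using x by (auto simp: L_def A_def)
qed

text \<open>
  Differentiating P(u) = 0 determines u'; the denominator does not vanish because the degree
  of the derivative of P is smaller than the minimal one.
\<close>

lemma derivation_algebraic:
  fixes u :: "'a::field_char_0"
  assumes F: "subfld F" and D: "derivation D" "\<And>x. x \<in> F \<Longrightarrow> D x \<in> F"
    and P: "P \<in> polys_over F" "P \<noteq> 0" "poly P u = 0"
    and min: "\<And>p. p \<in> polys_over F \<Longrightarrow> poly p u = 0 \<Longrightarrow> p \<noteq> 0 \<Longrightarrow> Polynomial.degree P \<le> Polynomial.degree p"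
  shows "poly (pderiv P) u \<noteq> 0" "D u = - poly (map_poly D P) u / poly (pderiv P) u"
    "map_poly D P \<in> polys_over F"
proof -
  have "P \<noteq> [:c:]" for c using P by auto
  then have deg: "Polynomial.degree P \<noteq> 0" by (metis degree_eq_zeroE)
  then have "pderiv P \<noteq> 0" by (simp add: pderiv_eq_0_iff)
  moreover have "Polynomial.degree (pderiv P) < Polynomial.degree P"
    using deg by (simp add: degree_pderiv)
  ultimately show nz: "poly (pderiv P) u \<noteq> 0"
    using min[of "pderiv P"] polys_over_closed(10)[OF F P(1)] by fastforce
  have "0 = poly (map_poly D P) u + poly (pderiv P) u * D u"
    using derivation_poly[OF D(1), of P u] P derivationD(3)[OF D(1)] by simp
  then show "D u = - poly (map_poly D P) u / poly (pderiv P) u"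
    using nz by (simp add: field_simps add_eq_0_iff2)
  show "map_poly D P \<in> polys_over F"
    using P D derivationD(3)[OF D(1)] by (auto simp: polys_over_def coeff_map_poly)
qed

text \<open>
  The derivative of an algebraic element is a fixed rational expression in that element and the
  coefficients of its minimal polynomial; a homomorphism that respects the derivation on the
  ground field therefore respects it on the extension.
\<close>

lemma extend_differential_hom_algebraic:
  fixes h :: "'a::field_char_0 \<Rightarrow> 'b::field_char_0"
  assumes F: "subfld F" and h: "hom_on F h" and D: "derivation D" "derivation D'"
    and DF: "\<And>x. x \<in> F \<Longrightarrow> D x \<in> F" "\<And>x. x \<in> F \<Longrightarrow> h (D x) = D' (h x)"
    and P: "P \<in> polys_over F" "P \<noteq> 0" "poly P u = 0"
    and min: "\<And>p. p \<in> polys_over F \<Longrightarrow> poly p u = 0 \<Longrightarrow> p \<noteq> 0 \<Longrightarrow> Polynomial.degree P \<le> Polynomial.degree p"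
    and w: "poly (map_poly h P) w = 0"
  obtains g where "hom_on (adjoin F u) g" "\<And>x. x \<in> F \<Longrightarrow> g x = h x" "g u = w"
    "\<And>x. x \<in> adjoin F u \<Longrightarrow> D x \<in> adjoin F u \<and> g (D x) = D' (g x)"
proof -
  have same: "poly p u = 0 \<longleftrightarrow> poly (map_poly h p) w = 0" if "p \<in> polys_over F" for p
    using minimal_polynomial_same_relations[OF F h P min w that] .
  obtain g where g: "hom_on (adjoin F u) g" "\<And>x. x \<in> F \<Longrightarrow> g x = h x" "g u = w"
    using extend_hom[OF F h same] by blast
  note A = subfld_adjoin[OF F, of u]
  have dP: "poly (pderiv P) u \<noteq> 0" "D u = - poly (map_poly D P) u / poly (pderiv P) u"
    "map_poly D P \<in> polys_over F"
    using derivation_algebraic[where D = D and F = F and P = P and u = u] F D(1) DF(1) P min by blast+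
  have Du: "D u \<in> adjoin F u"
    unfolding dP(2)
    using adjoinI[OF F polys_over_closed(7)[OF F dP(3)] polys_over_closed(10)[OF F P(1)], of u] by simp
  have gp: "g (poly p u) = poly (map_poly h p) w" if "p \<in> polys_over F" for p
  proof -
    have "p \<in> polys_over (adjoin F u)" using that A(2) by (auto simp: polys_over_def)
    then have "g (poly p u) = poly (map_poly g p) (g u)" using poly_map_poly_hom[OF g(1) A(1)] A(3) by blast
    also have "map_poly g p = map_poly h p"
      using that g(2) by (intro poly_eqI) (simp add: coeff_map_poly polys_over_def hom_onD(1)[OF g(1) A(1)] hom_onD(1)[OF h F])
    finally show ?thesis using g(3) by simp
  qed
  note z = subfldD(1)[OF F]
  have nz: "poly (map_poly h (pderiv P)) w \<noteq> 0"
    using same[of "pderiv P"] dP(1) polys_over_closed(10)[OF F P(1)] by simp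
  have c: "Polynomial.coeff P i \<in> F" for i using P by (auto simp: polys_over_def)
  have pd: "map_poly h (pderiv P) = pderiv (map_poly h P)" by (rule map_poly_pderiv[OF h F P(1)])
  have md: "map_poly D' (map_poly h P) = map_poly h (map_poly D P)"
    using DF c by (intro poly_eqI) (simp add: coeff_map_poly hom_onD[OF h F] derivationD[OF D(1)] derivationD[OF D(2)])
  have "0 = poly (map_poly D' (map_poly h P)) w + poly (pderiv (map_poly h P)) w * D' w"
    using derivation_poly[OF D(2), of "map_poly h P" w] w derivationD(3)[OF D(2)] by simp
  then have "D' w = - poly (map_poly h (map_poly D P)) w / poly (map_poly h (pderiv P)) w"
    using nz by (simp add: pd md field_simps add_eq_0_iff2)
  also have "\<dots> = g (D u)"
    unfolding dP(2)
    using gp[OF dP(3)] gp[OF polys_over_closed(10)[OF F P(1)]] hom_onD[OF g(1) A(1)]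
      adjoin_poly[OF F dP(3)] adjoin_poly[OF F polys_over_closed(10)[OF F P(1)]] subfldD[OF A(1)]
    by simp
  finally have gDu: "g (D u) = D' (g u)" using g(3) by simp
  show thesis
  proof (rule that[OF g])
    fix x assume x: "x \<in> adjoin F u"
    have "D x \<in> adjoin F u \<and> g (D x) = D' (g x)" if "x \<in> F" for x
      using that DF g(2) A(2) by auto
    from hom_commutes_adjoin[OF F g(1) D this Du gDu x]
    show "D x \<in> adjoin F u \<and> g (D x) = D' (g x)" by blast
  qed
qed

section \<open>The Riccati equation of a linear differential equation\<close>

text \<open>
  The differential polynomial in u = y'/y that equals the k-th derivative of y divided by y.
\<close>

primrec ric :: "('a::field \<Rightarrow> 'a) \<Rightarrow> 'a \<Rightarrow> nat \<Rightarrow> 'a" where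
  "ric D u 0 = 1"
| "ric D u (Suc k) = D (ric D u k) + u * ric D u k"

definition riccati :: "('a::field \<Rightarrow> 'a) \<Rightarrow> nat \<Rightarrow> (nat \<Rightarrow> 'a) \<Rightarrow> 'a \<Rightarrow> 'a" where
  "riccati D n a u = ric D u n + (\<Sum>i=1..n. a i * ric D u (n - i))"

lemma iterated_derivation_exponential:
  assumes "derivation D" "D y = u * y"
  shows "(D ^^ k) y = ric D u k * y"
proof (induction k)
  case (Suc k)
  then show ?case using assms derivationD[OF assms(1)] by (simp add: algebra_simps)
qed simp

lemma riccati_exponential:
  assumes "derivation D" "D y = u * y"
  shows "(D ^^ n) y + (\<Sum>i=1..n. a i * (D ^^ (n - i)) y) = riccati D n a u * y"
  unfolding riccati_def iterated_derivation_exponential[OF assms]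
  by (simp add: ring_distribs sum_distrib_right mult.assoc)

lemma riccati_hom:
  assumes h: "hom_on L h" and L: "subfld L" and u: "u \<in> L" and a: "\<And>i. i \<in> {1..n} \<Longrightarrow> a i \<in> L"
    and D: "\<And>x. x \<in> L \<Longrightarrow> D x \<in> L \<and> h (D x) = D' (h x)"
  shows "h (riccati D n a u) = riccati D' n (\<lambda>i. h (a i)) (h u)"
proof -
  note hs = hom_onD[OF h L] and c = subfldD[OF L]
  have r: "ric D u k \<in> L \<and> h (ric D u k) = ric D' (h u) k" for k
    by (induction k) (use D u in \<open>auto simp: hs c\<close>)
  have "h (\<Sum>i=1..n. a i * ric D u (n - i)) = (\<Sum>i=1..n. h (a i * ric D u (n - i)))"
    using r a c by (intro hom_on_sum[OF h L]) blast
  also have "\<dots> = (\<Sum>i=1..n. h (a i) * ric D' (h u) (n - i))"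
    using r a hs by (intro sum.cong) auto
  finally show ?thesis
    using r a c unfolding riccati_def by (subst hs(3)) (auto intro!: subfld_sum[OF L])
qed

section \<open>Orders of Laurent series and Hensel's lemma\<close>

unbundle fps_syntax

text \<open>
  The series f has order at least n; in contrast to a condition on the subdegree this includes
  f = 0 for every n.
\<close>

definition vge :: "int \<Rightarrow> 'a::zero fls \<Rightarrow> bool" where
  "vge n f \<longleftrightarrow> (\<forall>k<n. f $$ k = 0)"

lemma vge_iff: "vge n f \<longleftrightarrow> f = 0 \<or> n \<le> fls_subdegree f"
  using fls_subdegree_geI[of f n] by (auto simp: vge_def)

lemma vge_simps [simp]: "vge n 0" "vge 0 (1::'a::{zero,one} fls)" "vge 0 (fls_const c)"
  by (auto simp: vge_def fls_const_def[symmetric])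

lemma vge_mono: "vge m f \<Longrightarrow> n \<le> m \<Longrightarrow> vge n f"
  by (auto simp: vge_def)

lemma vge_add: "vge n f \<Longrightarrow> vge n g \<Longrightarrow> vge n (f + g :: 'a::monoid_add fls)"
  by (auto simp: vge_def)

lemma vge_diff: "vge n f \<Longrightarrow> vge n g \<Longrightarrow> vge n (f - g :: 'a::group_add fls)"
  by (auto simp: vge_def)

lemma vge_uminus: "vge n f \<Longrightarrow> vge n (- f :: 'a::group_add fls)"
  by (auto simp: vge_def)

text \<open>
  The coefficient at the lowest possible order is multiplicative, also if it is zero.
\<close>

lemma vge_times_nth:
  fixes f g :: "'a::field fls"
  assumes "vge m f" "vge n g"
  shows "(f * g) $$ (m + n) = f $$ m * g $$ n"
proof (cases "f = 0 \<or> g = 0")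
  case False
  then have *: "m \<le> fls_subdegree f" "n \<le> fls_subdegree g" using assms by (auto simp: vge_iff)
  show ?thesis
  proof (cases "m = fls_subdegree f \<and> n = fls_subdegree g")
    case True
    then show ?thesis by (simp add: fls_times_nth(1))
  next
    case False
    then have "m + n < fls_subdegree f + fls_subdegree g" "f $$ m = 0 \<or> g $$ n = 0" using * by auto
    then show ?thesis by (auto simp: fls_times_nth_eq0)
  qed
qed auto

lemma vge_mult:
  fixes f g :: "'a::field fls"
  assumes "vge m f" "vge n g"
  shows "vge (m + n) (f * g)"
  using assms by (auto simp: vge_iff)

lemma vge_0_mult: "vge 0 f \<Longrightarrow> vge 0 g \<Longrightarrow> vge 0 (f * g :: 'a::field fls)"
  using vge_mult[of 0 f 0 g] by simp

lemma vge_power: "vge m f \<Longrightarrow> vge (int k * m) (f ^ k :: 'a::field fls) \<and> (f ^ k) $$ (int k * m) = (f $$ m) ^ k"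
proof (induction k)
  case (Suc k)
  then show ?case
    using vge_mult[of m f "int k * m" "f ^ k"] vge_times_nth[of m f "int k * m" "f ^ k"]
    by (simp add: ring_distribs)
qed simp

lemma vge_inverse:
  fixes f :: "'a::field fls"
  assumes "vge 0 f" "f $$ 0 \<noteq> 0" shows "vge 0 (inverse f)"
proof -
  have "fls_subdegree f = 0" using assms by (auto simp: vge_iff intro!: fls_subdegree_eqI)
  then show ?thesis by (simp add: vge_iff)
qed

lemma vge_poly:
  fixes P :: "'a::field fls poly"
  assumes "\<And>i. vge 0 (Polynomial.coeff P i)" "vge 0 a"
  shows "vge 0 (poly P a)"
  using assms(1)
proof (induction P)
  case (pCons p P)
  have "vge 0 (Polynomial.coeff P i)" "vge 0 p" for i
    using pCons.prems[of "Suc i"] pCons.prems[of 0] by simp_all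
  then show ?case using pCons.IH assms(2) by (auto intro!: vge_add vge_0_mult)
qed simp

lemma vge_poly_diff:
  fixes P :: "'a::field fls poly"
  assumes "\<And>i. vge 0 (Polynomial.coeff P i)" "vge 0 a" "vge 0 b" "vge n (a - b)"
  shows "vge n (poly P a - poly P b)"
  using assms(1)
proof (induction P)
  case (pCons p P)
  have c: "vge 0 (Polynomial.coeff P i)" for i using pCons.prems[of "Suc i"] by simp
  have "poly (pCons p P) a - poly (pCons p P) b = a * (poly P a - poly P b) + (a - b) * poly P b"
    by (simp add: algebra_simps)
  then show ?case
    using vge_mult[OF assms(2) pCons.IH[OF c]] vge_mult[OF assms(4) vge_poly[OF c assms(3)]]
    by (auto intro!: vge_add)
qed simp

text \<open>
  The map T whose fixed points are the roots of P, namely the iteration that solves for the linear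
  term, increases the order of differences of series of positive order.  Hence its
  iterates agree up to ever higher orders, and the limit is taken coefficientwise.
\<close>

lemma hensel_root:
  fixes P :: "'a::field fls poly"
  assumes P: "\<And>i. vge 0 (Polynomial.coeff P i)"
    and p0: "Polynomial.coeff P 0 $$ 0 = 0" and p1: "Polynomial.coeff P 1 $$ 0 \<noteq> 0"
  obtains a where "vge 1 a" "poly P a = 0"
proof -
  obtain c0 c1 Q where PQ: "P = pCons c0 (pCons c1 Q)" by (metis pCons_cases)
  have c: "vge 0 c0" "vge 0 c1" "c0 $$ 0 = 0" "c1 $$ 0 \<noteq> 0" and Q: "vge 0 (Polynomial.coeff Q i)" for i
    using P[of 0] P[of 1] P[of "Suc (Suc i)"] p0 p1 by (simp_all add: PQ)
  have c1: "vge 1 c0" using c by (auto simp: vge_def) (metis zless_add1_eq add_0)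
  have nz: "c1 \<noteq> 0" using c by auto
  \<comment> \<open>With P = c0 + c1 a + a^2 Q(a), the fixed points of T are the roots of P.\<close>
  define T where "T a = - (c0 + a * a * poly Q a) * inverse c1" for a
  have ic: "vge 0 (inverse c1)" using c by (intro vge_inverse)
  have T1: "vge 1 (T a)" if "vge 1 a" for a
  proof -
    have a0: "vge 0 a" using that by (rule vge_mono) simp
    have "vge 1 (a * a)" using vge_mult[OF that a0] by simp
    then have "vge 1 (a * a * poly Q a)" using vge_mult[OF _ vge_poly[OF Q a0], of 1 "a * a"] by simp
    then have "vge 1 (- (c0 + a * a * poly Q a))" using c1 by (intro vge_uminus vge_add)
    then show ?thesis using vge_mult[OF _ ic, of 1] by (simp add: T_def)
  qed
  have Tc: "vge (n + 1) (T a - T b)" if "vge 1 a" "vge 1 b" "vge n (a - b)" for a b n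
  proof -
    have a0: "vge 0 a" "vge 0 b" using that vge_mono[of 1 _ 0] by auto
    have "a * a * poly Q a - b * b * poly Q b = (a * a) * (poly Q a - poly Q b) + (a - b) * ((a + b) * poly Q b)"
      by (simp add: algebra_simps)
    moreover have "vge (n + 1) ((a * a) * (poly Q a - poly Q b))"
      using vge_mult[OF vge_mult[OF that(1) a0(1)] vge_poly_diff[OF Q a0 that(3)]] by (simp add: add.commute)
    moreover have "vge (n + 1) ((a - b) * ((a + b) * poly Q b))"
      using vge_mult[OF that(3) vge_mult[OF vge_add[OF that(1,2)] vge_poly[OF Q a0(2)]]] by simp
    ultimately have "vge (n + 1) (a * a * poly Q a - b * b * poly Q b)" by (simp add: vge_add)
    moreover have "T a - T b = - (a * a * poly Q a - b * b * poly Q b) * inverse c1"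
      by (simp add: T_def algebra_simps)
    ultimately show ?thesis using vge_mult[OF vge_uminus ic, of "n + 1"] by (simp only: add_0_right)
  qed
  define A where "A n = (T ^^ n) 0" for n
  have A1: "vge 1 (A n)" for n by (induction n) (simp_all add: A_def T1)
  have step: "vge (int n + 1) (A (Suc n) - A n)" for n
  proof (induction n)
    case 0
    then show ?case using A1[of 1] A1[of 0] by (simp add: vge_diff)
  next
    case (Suc n)
    then show ?case using Tc[OF A1 A1, of "int n + 1" "Suc n" n] by (simp add: A_def add.commute)
  qed
  have stab: "vge (int n + 1) (A (n + k) - A n)" for n k
  proof (induction k)
    case (Suc k)
    have e: "A (n + Suc k) - A n = (A (Suc (n + k)) - A (n + k)) + (A (n + k) - A n)" by simp
    show ?case unfolding e using vge_mono[OF step[of "n + k"], of "int n + 1"] Suc by (intro vge_add) auto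
  qed simp
  \<comment> \<open>The i-th coefficient is constant from the i-th iterate on.\<close>
  define a where "a = Abs_fls (\<lambda>i. A (nat i) $$ i)"
  have a_nth: "a $$ i = A (nat i) $$ i" for i
    unfolding a_def using A1[unfolded vge_def]
    by (intro nth_Abs_fls_ex_lower_bound exI[of _ 0]) simp
  have a1: "vge 1 a" using A1 unfolding vge_def a_nth by blast
  have aA: "vge (int n + 1) (a - A n)" for n
    unfolding vge_def
  proof (intro allI impI)
    fix i assume "i < int n + 1"
    show "(a - A n) $$ i = 0"
    proof (cases "i < 1")
      case True
      then show ?thesis using A1 by (simp add: a_nth vge_def)
    next
      case False
      then have "n = nat i + (n - nat i)" using \<open>i < int n + 1\<close> by linarith
      then obtain k where "n = nat i + k" by blast
      then show ?thesis using stab[of "nat i" k] False by (simp add: a_nth vge_def)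
    qed
  qed
  have "vge (int n + 1) (T a - a)" for n
  proof -
    have "T a - a = (T a - T (A n)) + (A (Suc n) - A n) - (a - A n)" by (simp add: A_def)
    moreover have "vge (int n + 1) (T a - T (A n))"
      using Tc[OF a1 A1 aA[of n]] by (rule vge_mono) simp
    ultimately show ?thesis using step aA by (metis vge_add vge_diff)
  qed
  then have "(T a - a) $$ i = 0" if "i < int n + 1" for i n
    using that unfolding vge_def by blast
  then have "(T a - a) $$ i = 0" for i
    using \<open>\<And>n i. i < int n + 1 \<Longrightarrow> (T a - a) $$ i = 0\<close>[of i "nat i"] by simp
  then have "T a = a" by (metis eq_iff_diff_eq_0 fls_eqI fls_zero_nth)
  then have "- (c0 + a * a * poly Q a) = c1 * a" using nz by (simp add: T_def field_simps)
  moreover have "poly P a = (c0 + a * a * poly Q a) + c1 * a" by (simp add: PQ algebra_simps)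
  ultimately have "poly P a = 0" by (metis add.right_inverse)
  then show thesis using a1 that by blast
qed

section \<open>Ramification endomorphisms\<close>

definition fls_map :: "('a::zero \<Rightarrow> 'b::zero) \<Rightarrow> 'a fls \<Rightarrow> 'b fls" where
  "fls_map \<sigma> f = Abs_fls (\<lambda>n. \<sigma> (f $$ n))"

lemma fls_map_nth: "\<sigma> 0 = 0 \<Longrightarrow> fls_map \<sigma> f $$ n = \<sigma> (f $$ n)"
  unfolding fls_map_def
  by (rule nth_Abs_fls_ex_lower_bound, rule exI[of _ "fls_subdegree f"]) auto

lemma subfld_UNIV: "subfld UNIV"
  by (auto simp: subfld_def)

lemma polys_over_UNIV [simp]: "polys_over UNIV = UNIV"
  by (auto simp: polys_over_def)

lemma hom_on_fls_map:
  assumes "hom_on UNIV \<sigma>" shows "hom_on UNIV (fls_map \<sigma>)"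
proof -
  note hs = hom_onD[OF assms subfld_UNIV, simplified]
  have sd: "fls_subdegree (fls_map \<sigma> f) = fls_subdegree f" for f
  proof (cases "f = 0")
    case True
    then have "fls_map \<sigma> f = 0" by (intro fls_eqI) (simp add: fls_map_nth hs)
    then show ?thesis using True by simp
  next
    case False
    then show ?thesis by (intro fls_subdegree_eqI) (simp_all add: fls_map_nth hs)
  qed
  have "fls_map \<sigma> (f * g) = fls_map \<sigma> f * fls_map \<sigma> g" for f g
    by (intro fls_eqI)
      (simp add: fls_map_nth hs fls_times_nth(2) sd hom_on_sum[OF assms subfld_UNIV])
  then show ?thesis
    unfolding hom_on_def by (auto intro!: fls_eqI simp: fls_map_nth hs)
qed

text \<open>
  This applies \<sigma> to the coefficients and substitutes the N-th power of the variable for the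
  variable.  Working with this endomorphism amounts to adjoining an N-th root of the variable.
\<close>

definition puiseux_map :: "nat \<Rightarrow> ('a::zero \<Rightarrow> 'a) \<Rightarrow> 'a fls \<Rightarrow> 'a fls" where
  "puiseux_map N \<sigma> f = fls_compose_power (fls_map \<sigma> f) N"

lemma puiseux_map_nth:
  "N > 0 \<Longrightarrow> \<sigma> 0 = 0 \<Longrightarrow> puiseux_map N \<sigma> f $$ n = (if int N dvd n then \<sigma> (f $$ (n div int N)) else 0)"
  by (simp add: puiseux_map_def fls_nth_compose_power fls_map_nth)

lemma hom_on_puiseux_map:
  assumes "N > 0" "hom_on UNIV \<sigma>" shows "hom_on UNIV (puiseux_map N \<sigma>)"
proof -
  note hs = hom_onD[OF hom_on_fls_map[OF assms(2)] subfld_UNIV]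
  show ?thesis using hs(2-4) assms(1) by (simp add: hom_on_def puiseux_map_def hs(1))
qed

lemma puiseux_map_comp:
  assumes "N > 0" "M > 0" "\<sigma> 0 = 0" "\<tau> 0 = 0"
  shows "puiseux_map N \<sigma> \<circ> puiseux_map M \<tau> = puiseux_map (N * M) (\<sigma> \<circ> \<tau>)"
proof (intro ext fls_eqI)
  fix f n
  have "int N * int M dvd n \<longleftrightarrow> int N dvd n \<and> int M dvd n div int N"
    using assms(1) by (cases "int N dvd n") (auto elim!: dvdE dest: dvd_mult_left)
  then show "(puiseux_map N \<sigma> \<circ> puiseux_map M \<tau>) f $$ n = puiseux_map (N * M) (\<sigma> \<circ> \<tau>) f $$ n"
    using assms by (simp add: puiseux_map_nth zdiv_zmult2_eq)
qed

lemma puiseux_map_id [simp]: "puiseux_map (Suc 0) id = id"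
  by (intro ext fls_eqI) (simp add: puiseux_map_nth)

text \<open>
  This substitutes for algebraic closedness: instead of extending the field, one extends along an
  embedding of the field into itself.  The embeddings have to form a monoid, in order that finitely
  many such extensions can be composed.
\<close>

definition root_closed :: "('a::field \<Rightarrow> 'a) set \<Rightarrow> bool" where
  "root_closed S \<longleftrightarrow> id \<in> S \<and> (\<forall>\<sigma>\<in>S. hom_on UNIV \<sigma>) \<and> (\<forall>\<sigma>\<in>S. \<forall>\<tau>\<in>S. \<sigma> \<circ> \<tau> \<in> S) \<and>
     (\<forall>p. Polynomial.degree p > 0 \<longrightarrow> (\<exists>\<sigma>\<in>S. \<exists>x. poly (map_poly \<sigma> p) x = 0))"

definition puiseux_maps :: "('a::zero \<Rightarrow> 'a) set \<Rightarrow> ('a fls \<Rightarrow> 'a fls) set" where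
  "puiseux_maps S = {puiseux_map N \<sigma> | N \<sigma>. N > 0 \<and> \<sigma> \<in> S}"

definition has_root :: "('a::field \<Rightarrow> 'a) set \<Rightarrow> 'a poly \<Rightarrow> bool" where
  "has_root S p \<longleftrightarrow> (\<exists>\<sigma>\<in>S. \<exists>x. poly (map_poly \<sigma> p) x = 0)"

locale endo_monoid =
  fixes S :: "('a::field \<Rightarrow> 'a) set"
  assumes id: "id \<in> S" and hom: "\<sigma> \<in> S \<Longrightarrow> hom_on UNIV \<sigma>"
    and comp: "\<sigma> \<in> S \<Longrightarrow> \<tau> \<in> S \<Longrightarrow> \<sigma> \<circ> \<tau> \<in> S"
begin

lemmas homs = hom_onD[OF hom subfld_UNIV, simplified]
lemmas map_homs = map_poly_hom[OF hom subfld_UNIV, simplified]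

lemma has_root_map: "\<tau> \<in> S \<Longrightarrow> has_root S (map_poly \<tau> p) \<Longrightarrow> has_root S p"
  unfolding has_root_def using comp homs(1)
  by (metis (no_types, lifting) map_poly_map_poly)

lemma map_poly_pcompose_linear:
  assumes "\<sigma> \<in> S"
  shows "map_poly \<sigma> (pcompose p [:a, b:]) = pcompose (map_poly \<sigma> p) [:\<sigma> a, \<sigma> b:]"
  by (induction p)
    (simp_all add: pcompose_pCons map_poly_pCons homs[OF assms] map_homs[OF assms] del: mult_pCons_left)

lemma has_root_pcompose:
  assumes "has_root S (pcompose p [:a, b:])" shows "has_root S p"
proof -
  obtain \<sigma> x where "\<sigma> \<in> S" "poly (map_poly \<sigma> (pcompose p [:a, b:])) x = 0"
    using assms by (auto simp: has_root_def)
  then have "poly (map_poly \<sigma> p) (\<sigma> a + x * \<sigma> b) = 0"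
    by (simp add: map_poly_pcompose_linear poly_pcompose)
  then show ?thesis using \<open>\<sigma> \<in> S\<close> by (auto simp: has_root_def)
qed

lemma has_root_smult:
  assumes "has_root S (Polynomial.smult c p)" "c \<noteq> 0" shows "has_root S p"
proof -
  obtain \<sigma> x where "\<sigma> \<in> S" "poly (map_poly \<sigma> (Polynomial.smult c p)) x = 0"
    using assms by (auto simp: has_root_def)
  moreover have "map_poly \<sigma> (Polynomial.smult c p) = Polynomial.smult (\<sigma> c) (map_poly \<sigma> p)"
    using homs[OF \<open>\<sigma> \<in> S\<close>] by (intro poly_eqI) (simp add: coeff_map_poly)
  ultimately show ?thesis using assms(2) homs(7)[OF \<open>\<sigma> \<in> S\<close>] by (auto simp: has_root_def)
qed

lemma has_root_0: "poly p x = 0 \<Longrightarrow> has_root S p"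
  unfolding has_root_def using id by (intro bexI[of _ id] exI[of _ x]) (simp_all add: map_poly_idI)

end

lemma endo_monoid_puiseux:
  assumes "endo_monoid S" shows "endo_monoid (puiseux_maps S)"
proof -
  interpret endo_monoid S by fact
  show ?thesis
  proof
    show "id \<in> puiseux_maps S" unfolding puiseux_maps_def using id puiseux_map_id by (metis (mono_tags, lifting) mem_Collect_eq zero_less_Suc)
    show "hom_on UNIV \<sigma>" if "\<sigma> \<in> puiseux_maps S" for \<sigma>
      using that hom hom_on_puiseux_map by (auto simp: puiseux_maps_def)
    show "\<sigma> \<circ> \<tau> \<in> puiseux_maps S" if st: "\<sigma> \<in> puiseux_maps S" "\<tau> \<in> puiseux_maps S" for \<sigma> \<tau>
    proof -
      obtain N s M t where "\<sigma> = puiseux_map N s" "\<tau> = puiseux_map M t" "N > 0" "M > 0" "s \<in> S" "t \<in> S"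
        using st by (auto simp: puiseux_maps_def)
      then show ?thesis
        using puiseux_map_comp[of N M s t] homs(1) comp[of s t] unfolding puiseux_maps_def
        by (intro CollectI exI[of _ "N * M"] exI[of _ "s \<circ> t"]) simp
    qed
  qed
qed

section \<open>Puiseux's theorem\<close>

abbreviation red :: "'a::zero fls \<Rightarrow> 'a" where "red f \<equiv> f $$ 0"

definition integral_poly :: "'a::zero fls poly \<Rightarrow> bool" where
  "integral_poly P \<longleftrightarrow> (\<forall>i. vge 0 (Polynomial.coeff P i))"

definition red_poly :: "'a::zero fls poly \<Rightarrow> 'a poly" where
  "red_poly P = map_poly red P"

lemma coeff_red_poly [simp]: "Polynomial.coeff (red_poly P) i = Polynomial.coeff P i $$ 0"
  by (simp add: red_poly_def coeff_map_poly)

lemma integral_poly_shift: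
  fixes P :: "'a::field fls poly"
  assumes "integral_poly P" "vge 0 a"
  shows "integral_poly (pcompose P [:a, 1:])"
    "red_poly (pcompose P [:a, 1:]) = pcompose (red_poly P) [:a $$ 0, 1:]"
proof -
  have "integral_poly (pcompose P [:a, 1:]) \<and>
    red_poly (pcompose P [:a, 1:]) = pcompose (red_poly P) [:a $$ 0, 1:]"
    using assms(1)
  proof (induction P)
    case 0
    then show ?case by (simp add: integral_poly_def red_poly_def)
  next
    case (pCons p P)
    have p: "vge 0 p" "integral_poly P"
      using pCons.prems unfolding integral_poly_def by (force dest: spec[of _ 0] spec[of _ "Suc _"])+
    define R where "R = pcompose P [:a, 1:]"
    have R: "integral_poly R" "red_poly R = pcompose (red_poly P) [:a $$ 0, 1:]"
      using pCons.IH p by (auto simp: R_def)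
    have e: "pcompose (pCons p P) [:a, 1:] = [:p:] + Polynomial.smult a R + pCons 0 R"
      by (simp add: pcompose_pCons R_def)
    have rp: "red_poly (pCons p P) = pCons (p $$ 0) (red_poly P)"
      by (simp add: red_poly_def map_poly_pCons)
    have "vge 0 (Polynomial.coeff R i)" for i using R by (simp add: integral_poly_def)
    then have "red_poly ([:p:] + Polynomial.smult a R + pCons 0 R)
        = [:p $$ 0:] + Polynomial.smult (a $$ 0) (red_poly R) + pCons 0 (red_poly R)"
      using vge_times_nth[OF assms(2), where n = 0]
      by (intro poly_eqI) (auto simp: coeff_pCons split: nat.splits)
    moreover have "integral_poly ([:p:] + Polynomial.smult a R + pCons 0 R)"
      using R p assms(2) unfolding integral_poly_def
      by (auto simp: coeff_pCons intro!: vge_add vge_0_mult split: nat.splits)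
    moreover have "pcompose (red_poly (pCons p P)) [:a $$ 0, 1:]
        = [:p $$ 0:] + Polynomial.smult (a $$ 0) (red_poly R) + pCons 0 (red_poly R)"
      unfolding rp R(2) by (simp add: pcompose_pCons)
    ultimately show ?case unfolding e by simp
  qed
  then show "integral_poly (pcompose P [:a, 1:])"
    "red_poly (pcompose P [:a, 1:]) = pcompose (red_poly P) [:a $$ 0, 1:]" by auto
qed

text \<open>
  Taylor's formula, with the factorial on the other side.
\<close>

lemma coeff_pcompose_shift:
  fixes P :: "'a::field_char_0 poly"
  shows "fact k * Polynomial.coeff (pcompose P [:a, 1:]) k = poly ((pderiv ^^ k) P) a"
proof -
  have "(pderiv ^^ k) (pcompose P [:a, 1:]) = pcompose ((pderiv ^^ k) P) [:a, 1:]"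
    by (induction k) (simp_all add: pderiv_pcompose pderiv_pCons)
  then have "Polynomial.coeff ((pderiv ^^ k) (pcompose P [:a, 1:])) 0 = poly ((pderiv ^^ k) P) a"
    by (simp add: poly_0_coeff_0[symmetric] poly_pcompose)
  then show ?thesis by (simp add: coeff_higher_pderiv pochhammer_fact)
qed

lemma root_closedD:
  assumes "root_closed S"
  shows "endo_monoid S" "Polynomial.degree p > 0 \<Longrightarrow> has_root S p"
  using assms by (auto simp: root_closed_def endo_monoid_def has_root_def)

text \<open>
  After the reduction of R has acquired a root c, moving c to 0 turns the search for a root of R
  into the search for a root with vanishing constant coefficient.
\<close>

lemma shift_to_root:
  fixes R :: "'a::field fls poly"
  assumes S: "root_closed S" and R: "integral_poly R" and deg: "Polynomial.degree (red_poly R) > 0"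
  obtains \<sigma> c Q where "\<sigma> \<in> S" "integral_poly Q" "has_root (puiseux_maps S) Q \<Longrightarrow> has_root (puiseux_maps S) R"
    "red_poly Q = pcompose (map_poly \<sigma> (red_poly R)) [:c, 1:]" "Polynomial.coeff (red_poly Q) 0 = 0"
proof -
  interpret endo_monoid S using root_closedD(1)[OF S] .
  interpret S': endo_monoid "puiseux_maps S" using endo_monoid_puiseux root_closedD(1)[OF S] by blast
  obtain \<sigma> c where s: "\<sigma> \<in> S" and c: "poly (map_poly \<sigma> (red_poly R)) c = 0"
    using root_closedD(2)[OF S deg] by (auto simp: has_root_def)
  have s0: "\<sigma> 0 = 0" using homs(1)[OF s] .
  have m: "puiseux_map 1 \<sigma> \<in> puiseux_maps S" using s by (auto simp: puiseux_maps_def)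
  define R' where "R' = map_poly (puiseux_map 1 \<sigma>) R"
  have pm: "puiseux_map 1 \<sigma> f $$ k = \<sigma> (f $$ k)" for f k using puiseux_map_nth[of 1 \<sigma> f k] s0 by simp
  have p0: "puiseux_map 1 \<sigma> 0 = 0" using S'.homs(1)[OF m] .
  have R': "integral_poly R'" using R by (auto simp: integral_poly_def R'_def coeff_map_poly p0 pm vge_def s0 simp del: One_nat_def)
  have red: "red_poly R' = map_poly \<sigma> (red_poly R)"
    by (intro poly_eqI) (simp add: R'_def coeff_map_poly s0 p0 pm del: One_nat_def)
  define Q where "Q = pcompose R' [:fls_const c, 1:]"
  have Q: "integral_poly Q" "red_poly Q = pcompose (red_poly R') [:c, 1:]"
    using integral_poly_shift[OF R', of "fls_const c"] by (simp_all add: Q_def)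
  show thesis
  proof (rule that[OF s Q(1)])
    show "has_root (puiseux_maps S) R" if "has_root (puiseux_maps S) Q"
      by (rule S'.has_root_map[OF m], fold R'_def, rule S'.has_root_pcompose[OF that[unfolded Q_def]])
    show "red_poly Q = pcompose (map_poly \<sigma> (red_poly R)) [:c, 1:]" by (simp add: Q red)
    then show "Polynomial.coeff (red_poly Q) 0 = 0"
      using c by (simp add: poly_0_coeff_0[symmetric] poly_pcompose del: coeff_red_poly)
  qed
qed

lemma first_nonzero_coeff:
  assumes "Polynomial.coeff r 0 = 0" "Polynomial.coeff r n \<noteq> 0"
  obtains m where "0 < m" "m \<le> n" "\<And>j. j < m \<Longrightarrow> Polynomial.coeff r j = 0" "Polynomial.coeff r m \<noteq> 0"
proof -
  define m where "m = (LEAST j. Polynomial.coeff r j \<noteq> 0)"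
  have m: "Polynomial.coeff r m \<noteq> 0" unfolding m_def using assms(2) by (rule LeastI)
  show thesis
    by (rule that[of m]) (use m assms in \<open>auto simp: m_def intro: gr0I Least_le dest: not_less_Least\<close>)
qed

text \<open>
  Induction on the multiplicity m of the root 0 of the reduction.  By Hensel's lemma the
  derivative of order m - 1 has a root of positive order, and moving it to 0 removes the coefficient
  of degree m - 1.  If the constant coefficient is not zero by then, the substitution given by the
  first slope of the Newton polygon yields a polynomial R whose reduction has degree m, has no
  term of degree m - 1 and is not a monomial.  Such a polynomial is not the m-th power of a linear
  polynomial, so all its roots have multiplicity less than m.
\<close>

lemma puiseux_root_of_multiplicity:
  fixes P :: "'a::field_char_0 fls poly"
  assumes S: "root_closed S" and "integral_poly P" "0 < m"
    "\<And>j. j < m \<Longrightarrow> Polynomial.coeff P j $$ 0 = 0" "Polynomial.coeff P m $$ 0 \<noteq> 0"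
  shows "has_root (puiseux_maps S) P"
  using assms(2-)
proof (induction m arbitrary: P rule: less_induct)
  case (less m)
  interpret endo_monoid S using root_closedD(1)[OF S] .
  interpret S': endo_monoid "puiseux_maps S" using endo_monoid_puiseux root_closedD(1)[OF S] by blast
  have Pi: "vge 0 (Polynomial.coeff P i)" for i using less.prems by (simp add: integral_poly_def)
  \<comment> \<open>Its constant coefficient reduces to 0, and its linear one does not.\<close>
  define G where "G = (pderiv ^^ (m - 1)) P"
  have G: "Polynomial.coeff G n = fls_const (of_nat (pochhammer (Suc n) (m - 1))) * Polynomial.coeff P (n + (m - 1))" for n
    unfolding G_def coeff_higher_pderiv by (metis fls_of_nat pochhammer_of_nat)
  have "vge 0 (Polynomial.coeff G i)" for i unfolding G using Pi by (intro vge_0_mult) auto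
  moreover have "Polynomial.coeff G 0 $$ 0 = 0" using less.prems(2,3) unfolding G by simp
  moreover have "pochhammer (Suc (Suc 0)) (m - 1) \<noteq> 0" using pochhammer_pos[of "Suc (Suc 0)" "m - 1"] by simp
  then have "Polynomial.coeff G 1 $$ 0 \<noteq> 0" using less.prems(2,4) unfolding G by simp
  ultimately obtain a where a: "vge 1 a" "poly G a = 0" by (rule hensel_root)
  have a0: "vge 0 a" "a $$ 0 = 0" using a(1) by (auto simp: vge_def)
  define Q where "Q = pcompose P [:a, 1:]"
  have Q: "integral_poly Q" "red_poly Q = red_poly P"
    using integral_poly_shift[OF less.prems(1) a0(1)] a0(2) by (simp_all add: Q_def)
  have rQ: "Polynomial.coeff Q j $$ 0 = Polynomial.coeff P j $$ 0" for j
    using Q(2) by (metis coeff_red_poly)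
  have Qi: "vge 0 (Polynomial.coeff Q i)" for i using Q by (simp add: integral_poly_def)
  have Qm: "Polynomial.coeff Q (m - 1) = 0"
    using coeff_pcompose_shift[of "m - 1" P a] a(2) by (simp add: Q_def G_def)
  have "has_root (puiseux_maps S) Q"
  proof (cases "Polynomial.coeff Q 0 = 0")
    case True
    then show ?thesis by (intro S'.has_root_0[of _ 0]) (simp add: poly_0_coeff_0)
  next
    case False
    define J where "J = {j. j < m \<and> Polynomial.coeff Q j \<noteq> 0}"
    define v where "v j = fls_subdegree (Polynomial.coeff Q j)" for j
    have J: "finite J" "0 \<in> J" using False less.prems(2) by (auto simp: J_def)
    have v1: "v j \<ge> 1" if "j \<in> J" for j
    proof -
      have "Polynomial.coeff Q j $$ k = 0" if "k < 1" for k
        using Qi[of j] rQ[of j] less.prems(3)[of j] \<open>j \<in> J\<close> that by (cases "k = 0") (auto simp: vge_def J_def)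
      then show ?thesis using \<open>j \<in> J\<close> unfolding v_def J_def by (intro fls_subdegree_geI) auto
    qed
    \<comment> \<open>The slopes of the segments of the Newton polygon that end at the point (m, 0).\<close>
    define f where "f j = real_of_int (v j) / real (m - j)" for j
    have "Min (f ` J) \<in> f ` J" using J by (intro Min_in) auto
    then obtain j0 where j0: "j0 \<in> J" "f j0 = Min (f ` J)" by auto
    define N where "N = m - j0"
    define e where "e = v j0"
    have N: "N > 0" using j0 by (auto simp: N_def J_def)
    have e: "e \<ge> 1" using v1 j0 by (simp add: e_def)
    have slope: "e * int (m - j) \<le> int N * v j" if "j \<in> J" for j
    proof -
      have "f j0 \<le> f j" using J that by (simp add: j0(2))
      moreover have "real (m - j) > 0" "real N > 0" using that N by (auto simp: J_def)
      ultimately have "of_int e * real (m - j) \<le> real N * of_int (v j)"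
        by (simp add: f_def e_def N_def field_simps)
      then have "real_of_int (e * int (m - j)) \<le> real_of_int (int N * v j)" by simp
      then show ?thesis by linarith
    qed
    define \<tau> where "\<tau> = puiseux_map N (id :: 'a \<Rightarrow> 'a)"
    have \<tau>: "\<tau> \<in> puiseux_maps S" using N id by (auto simp: \<tau>_def puiseux_maps_def)
    \<comment> \<open>After the N-th root s of the variable is adjoined, this is s^(-em) Q(s^e Y).\<close>
    define R where "R = Polynomial.smult (fls_X_intpow (- (e * int m)))
      (pcompose (map_poly \<tau> Q) (Polynomial.monom (fls_X_intpow e) (Suc 0)))"
    have "Polynomial.coeff R j = fls_X_intpow (- (e * int m)) * (fls_X_intpow e ^ j * \<tau> (Polynomial.coeff Q j))" for j
      using S'.homs(1)[OF \<tau>] by (simp add: R_def coeff_map_poly)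
    then have Rc: "Polynomial.coeff R j = fls_shift (e * (int m - int j)) (\<tau> (Polynomial.coeff Q j))" for j
      unfolding fls_X_intpow_power fls_X_intpow_times_conv_shift by (simp add: algebra_simps)
    have Rn: "Polynomial.coeff R j $$ k = (if int N dvd k + e * (int m - int j)
        then Polynomial.coeff Q j $$ ((k + e * (int m - int j)) div int N) else 0)" for j k
      unfolding Rc \<tau>_def using N by (simp add: puiseux_map_nth)
    have Rz: "Polynomial.coeff R j $$ k = 0" if "k < 0 \<or> k = 0 \<and> j > m" for j k
    proof (cases "j < m")
      case True
      show ?thesis
      proof (cases "int N dvd k + e * (int m - int j) \<and> Polynomial.coeff Q j \<noteq> 0")
        case T: True
        then obtain l where l: "k + e * (int m - int j) = int N * l" by auto
        have "j \<in> J" using T True by (simp add: J_def)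
        then have "int N * l < int N * v j" using slope[of j] l that True by (simp add: of_nat_diff)
        then have "l < v j" using N by simp
        then show ?thesis using N unfolding Rn l by (simp add: v_def)
      qed (auto simp: Rn)
    next
      case False
      then have "e * (int m - int j) \<le> 0" "j > m \<Longrightarrow> e * (int m - int j) < 0"
        using e by (auto simp: mult_le_0_iff mult_less_0_iff)
      then have "k + e * (int m - int j) < 0" using that by auto
      then have "(k + e * (int m - int j)) div int N < 0" using N by (simp add: div_neg_pos_less0)
      then show ?thesis using Qi[of j] by (simp add: Rn vge_def)
    qed
    have Ri: "integral_poly R" using Rz by (auto simp: integral_poly_def vge_def)
    have Rm: "Polynomial.coeff R m $$ 0 \<noteq> 0" using rQ[of m] less.prems(4) by (simp add: Rn)
    have Rm1: "Polynomial.coeff R (m - 1) $$ 0 = 0" unfolding Rn Qm by simp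
    have Rj0: "Polynomial.coeff R j0 $$ 0 \<noteq> 0"
    proof -
      have eN: "e * (int m - int j0) = e * int N" using j0 by (simp add: N_def J_def of_nat_diff)
      have "Polynomial.coeff R j0 $$ 0 = Polynomial.coeff Q j0 $$ e" using N unfolding Rn eN by simp
      then show ?thesis using j0(1) by (simp add: e_def v_def J_def)
    qed
    have deg: "Polynomial.degree (red_poly R) = m"
      using Rm Rz by (intro antisym degree_le le_degree) auto
    then have "Polynomial.degree (red_poly R) > 0" using less.prems(2) by simp
    from shift_to_root[OF S Ri this]
    obtain \<sigma> c Q3 where s: "\<sigma> \<in> S" and Q3: "integral_poly Q3" "has_root (puiseux_maps S) Q3 \<Longrightarrow> has_root (puiseux_maps S) R"
      "red_poly Q3 = pcompose (map_poly \<sigma> (red_poly R)) [:c, 1:]" "Polynomial.coeff (red_poly Q3) 0 = 0" by blast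
    define r where "r = map_poly \<sigma> (red_poly R)"
    note hs = homs[OF s]
    have rc: "Polynomial.coeff r i = \<sigma> (Polynomial.coeff R i $$ 0)" for i by (simp add: r_def coeff_map_poly hs)
    have degr: "Polynomial.degree r = m" using map_homs(3)[OF s, of "red_poly R"] deg by (simp add: r_def)
    have "Polynomial.degree (red_poly Q3) = m" using degr by (simp add: Q3(3) degree_pcompose flip: r_def)
    then have "Polynomial.coeff (red_poly Q3) m \<noteq> 0" using less.prems(2) by (metis degree_0 leading_coeff_0_iff less_irrefl)
    from first_nonzero_coeff[OF Q3(4) this]
    obtain m' where m': "0 < m'" "m' \<le> m" "\<And>j. j < m' \<Longrightarrow> Polynomial.coeff (red_poly Q3) j = 0"
      "Polynomial.coeff (red_poly Q3) m' \<noteq> 0" by blast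
    \<comment> \<open>Otherwise the reduction r would be a constant multiple of (Y - c)^m.  As its term of degree
      m - 1 is missing, c would be 0, contradicting the nonzero coefficient at j0 < m.\<close>
    have "m' \<noteq> m"
    proof
      assume mm: "m' = m"
      have "poly ((pderiv ^^ (m - 1)) r) c = fact (m - 1) * Polynomial.coeff (red_poly Q3) (m - 1)"
        unfolding Q3(3) r_def[symmetric] coeff_pcompose_shift ..
      also have "\<dots> = 0" using m'(3)[of "m - 1"] mm less.prems(2) by simp
      finally have z: "poly ((pderiv ^^ (m - 1)) r) c = 0" .
      have "(pderiv ^^ (m - 1)) r = [:0, pochhammer 2 (m - 1) * Polynomial.coeff r m:]"
      proof (rule poly_eqI)
        fix n :: nat
        consider "n = 0" | "n = 1" | "n > 1" using nat_neq_iff[of n 1] by auto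
        then show "Polynomial.coeff ((pderiv ^^ (m - 1)) r) n =
            Polynomial.coeff [:0, pochhammer 2 (m - 1) * Polynomial.coeff r m:] n"
        proof cases
          case 1
          then show ?thesis using Rm1 by (simp add: coeff_higher_pderiv rc hs)
        next
          case 2
          then show ?thesis using less.prems(2) by (simp add: coeff_higher_pderiv)
        next
          case 3
          then have "n + (m - 1) > Polynomial.degree r" using degr by simp
          then show ?thesis using 3 by (simp add: coeff_higher_pderiv coeff_eq_0 coeff_pCons split: nat.splits)
        qed
      qed
      then have "pochhammer 2 (m - 1) * Polynomial.coeff r m * c = 0" using z by auto
      moreover have "(0::nat) < pochhammer 2 (m - 1)" by (rule pochhammer_pos) simp
      then have "of_nat (pochhammer 2 (m - 1)) \<noteq> (0::'a)"
        by (simp only: of_nat_eq_0_iff neq0_conv not_False_eq_True)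
      then have "pochhammer (2::'a) (m - 1) \<noteq> 0"
        using pochhammer_of_nat[of 2 "m - 1", where 'a = 'a] by simp
      moreover have "Polynomial.coeff r m \<noteq> 0" using Rm hs(7) by (simp add: rc)
      ultimately have "c = 0" by simp
      then have "red_poly Q3 = r" using Q3(3) by (simp add: r_def)
      then have "Polynomial.coeff (red_poly Q3) j0 \<noteq> 0" using Rj0 hs(7) by (metis rc)
      then show False using m'(3)[of j0] mm j0 by (simp add: J_def)
    qed
    then have "has_root (puiseux_maps S) Q3"
      using m' by (intro less.IH[OF _ Q3(1) m'(1)]) auto
    then have "has_root (puiseux_maps S) R" by (rule Q3(2))
    then have "has_root (puiseux_maps S) (pcompose (map_poly \<tau> Q) [:0, fls_X_intpow e:])"
      unfolding R_def monom_Suc monom_0 by (rule S'.has_root_smult) (rule fls_X_intpow_nonzero)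
    then show ?thesis using S'.has_root_pcompose S'.has_root_map[OF \<tau>] by blast
  qed
  then show ?case unfolding Q_def by (rule S'.has_root_pcompose)
qed

text \<open>
  Dividing by the leading coefficient and rescaling the unknown by a power of the variable makes
  the coefficients integral while the polynomial stays monic, so its reduction has the same degree.
  A root of the reduction has some finite multiplicity.
\<close>

theorem puiseux_root_closed:
  fixes S :: "('a::field_char_0 \<Rightarrow> 'a) set"
  assumes S: "root_closed S" shows "root_closed (puiseux_maps S)"
proof -
  interpret endo_monoid S using root_closedD(1)[OF S] .
  interpret S': endo_monoid "puiseux_maps S" using endo_monoid_puiseux root_closedD(1)[OF S] by blast
  have "has_root (puiseux_maps S) P" if deg: "Polynomial.degree P > 0" for P :: "'a fls poly"
  proof -
    define n where "n = Polynomial.degree P"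
    define l where "l = Polynomial.lead_coeff P"
    have l: "l \<noteq> 0" using deg by (auto simp: l_def)
    define p where "p i = Polynomial.coeff P i / l" for i
    \<comment> \<open>A crude common bound for the orders of the poles of the coefficients.\<close>
    define L where "L = (\<Sum>i\<le>n. nat (- fls_subdegree (p i)))"
    have L: "- int L \<le> fls_subdegree (p i)" if "i \<le> n" for i
    proof -
      have "nat (- fls_subdegree (p i)) \<le> L" unfolding L_def using that by (intro member_le_sum) auto
      then show ?thesis by linarith
    qed
    define R where "R = Polynomial.smult (fls_X_intpow (int n * int L))
      (pcompose (Polynomial.smult (inverse l) P) (Polynomial.monom (fls_X_intpow (- int L)) (Suc 0)))"
    have "Polynomial.coeff R i = fls_X_intpow (int n * int L) * (fls_X_intpow (- int L) ^ i * p i)" for i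
      by (simp add: R_def p_def divide_inverse mult_ac)
    then have Rc: "Polynomial.coeff R i = fls_shift (int L * (int i - int n)) (p i)" for i
      unfolding fls_X_intpow_power fls_X_intpow_times_conv_shift by (simp add: algebra_simps)
    have pn: "p n = 1" "i > n \<Longrightarrow> p i = 0" for i using l by (auto simp: p_def l_def n_def coeff_eq_0)
    have "Polynomial.coeff R i $$ k = 0" if "k < 0" for i k
    proof (cases "i < n")
      case True
      then have "int L * (int i - int n) \<le> int L * (- 1)" by (intro mult_left_mono) auto
      then have "k + int L * (int i - int n) < fls_subdegree (p i)" using L[of i] True that by simp
      then show ?thesis by (simp add: Rc)
    next
      case False
      then show ?thesis using pn that by (cases "i = n") (auto simp: Rc)
    qed
    then have Ri: "integral_poly R" by (auto simp: integral_poly_def vge_def)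
    have Rn: "Polynomial.coeff (red_poly R) n = 1" by (simp add: Rc pn)
    then have "Polynomial.degree (red_poly R) > 0" using deg le_degree[of "red_poly R" n] by (simp add: n_def)
    from shift_to_root[OF S Ri this]
    obtain \<sigma> c Q3 where s: "\<sigma> \<in> S" and Q3: "integral_poly Q3" "has_root (puiseux_maps S) Q3 \<Longrightarrow> has_root (puiseux_maps S) R"
      "red_poly Q3 = pcompose (map_poly \<sigma> (red_poly R)) [:c, 1:]" "Polynomial.coeff (red_poly Q3) 0 = 0" by blast
    have "red_poly R \<noteq> 0" using Rn by (metis coeff_0 zero_neq_one)
    then have "map_poly \<sigma> (red_poly R) \<noteq> 0" using map_homs(4)[OF s] by simp
    then have "red_poly Q3 \<noteq> 0" using pcompose_eq_0[of "map_poly \<sigma> (red_poly R)" "[:c, 1:]"] by (auto simp: Q3(3))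
    then obtain k where "Polynomial.coeff (red_poly Q3) k \<noteq> 0" by (auto simp: poly_eq_iff)
    from first_nonzero_coeff[OF Q3(4) this]
    obtain m where "0 < m" "\<And>j. j < m \<Longrightarrow> Polynomial.coeff (red_poly Q3) j = 0"
      "Polynomial.coeff (red_poly Q3) m \<noteq> 0" by blast
    then have "has_root (puiseux_maps S) Q3"
      using puiseux_root_of_multiplicity[OF S Q3(1), of m] by auto
    then have "has_root (puiseux_maps S) R" by (rule Q3(2))
    then have "has_root (puiseux_maps S) (pcompose (Polynomial.smult (inverse l) P) [:0, fls_X_intpow (- int L):])"
      unfolding R_def monom_Suc monom_0 by (rule S'.has_root_smult) (rule fls_X_intpow_nonzero)
    then have "has_root (puiseux_maps S) (Polynomial.smult (inverse l) P)" by (rule S'.has_root_pcompose)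
    then show ?thesis by (rule S'.has_root_smult) (use l in simp)
  qed
  then show ?thesis
    using S'.id S'.hom S'.comp by (auto simp: root_closed_def has_root_def)
qed

lemma root_closed_complex: "root_closed {id :: complex \<Rightarrow> complex}"
proof -
  have "\<exists>x. poly p x = 0" if "Polynomial.degree p > 0" for p :: "complex poly"
    using alg_closed_imp_poly_has_root[of p] that by auto
  then show ?thesis by (auto simp: root_closed_def hom_on_def)
qed

section \<open>Specialization of a Riccati solution at infinity\<close>

text \<open>
  The Cauchy product with bounds that need not be the exact orders, so that the same bounds can be
  used for a series and its derivatives.
\<close>

lemma fls_times_nth_wide:
  fixes f g :: "'a::field fls"
  assumes "vge m f" "vge n g"
  shows "(f * g) $$ k = (\<Sum>i=m..k - n. f $$ i * g $$ (k - i))"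
proof (cases "f = 0 \<or> g = 0")
  case False
  then have "m \<le> fls_subdegree f" "n \<le> fls_subdegree g" using assms by (auto simp: vge_iff)
  then show ?thesis
    unfolding fls_times_nth(2) by (intro sum.mono_neutral_left) auto
qed auto

lemma derivation_fls_map:
  assumes "derivation D" shows "derivation (fls_map D)"
  unfolding derivation_def
proof (intro allI conjI)
  fix f g :: "'a fls"
  note d = derivationD[OF assms]
  show "fls_map D (f + g) = fls_map D f + fls_map D g"
    by (intro fls_eqI) (simp add: fls_map_nth d)
  define m n where "m = fls_subdegree f" and "n = fls_subdegree g"
  have v: "vge m f" "vge n g" by (auto simp: m_def n_def vge_iff)
  then have v': "vge m (fls_map D f)" "vge n (fls_map D g)" by (auto simp: vge_def fls_map_nth d)
  have ds: "D (sum h I) = (\<Sum>i\<in>I. D (h i))" for h :: "int \<Rightarrow> 'a" and I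
    by (induction I rule: infinite_finite_induct) (simp_all add: d)
  show "fls_map D (f * g) = fls_map D f * g + f * fls_map D g"
    by (intro fls_eqI)
      (simp add: fls_times_nth_wide[OF v] fls_times_nth_wide[OF v'(1) v(2)] fls_times_nth_wide[OF v(1) v'(2)]
        fls_map_nth d ds sum.distrib)
qed

text \<open>
  With s for the variable, this is D on the coefficients together with s' = b s^(j+1).
  Since j is not negative, it does not lower orders.
\<close>

definition laurent_derivation :: "('a::field \<Rightarrow> 'a) \<Rightarrow> 'a \<Rightarrow> nat \<Rightarrow> 'a fls \<Rightarrow> 'a fls" where
  "laurent_derivation D b j f = fls_map D f + fls_const b * fls_X_intpow (int j) * (fls_X * fls_deriv f)"

lemma derivation_laurent_derivation:
  assumes "derivation D" shows "derivation (laurent_derivation D b j)"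
  using derivation_fls_map[OF assms]
  by (auto simp: derivation_def laurent_derivation_def algebra_simps)

lemma laurent_derivation_nth:
  assumes "D 0 = 0"
  shows "laurent_derivation D b j f $$ k = D (f $$ k) + b * (of_int (k - int j) * f $$ (k - int j))"
proof -
  have e: "fls_const b * fls_X_intpow (int j) * (fls_X * fls_deriv f)
      = fls_X_intpow (int j) * (fls_const b * (fls_X * fls_deriv f))"
    by (simp only: mult_ac)
  show ?thesis
    unfolding laurent_derivation_def e fls_X_intpow_times_conv_shift(1)
    using assms by (simp add: fls_map_nth fls_X_times_conv_shift)
qed

lemma vge_laurent_derivation:
  "D 0 = 0 \<Longrightarrow> vge l f \<Longrightarrow> vge l (laurent_derivation D b j f)"
  by (simp add: vge_def laurent_derivation_nth)

lemma laurent_derivation_const: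
  "D 0 = 0 \<Longrightarrow> laurent_derivation D b j (fls_const c) = fls_const (D c)"
  by (intro fls_eqI) (auto simp: laurent_derivation_nth)

lemma red_laurent_derivation:
  assumes "D 0 = 0" "vge 0 f"
  shows "red (laurent_derivation D b j f) = D (red f)"
  using assms by (cases "j = 0") (auto simp: laurent_derivation_nth vge_def)

lemma fls_sum_nth: "(\<Sum>i\<in>I. f i) $$ k = (\<Sum>i\<in>I. f i $$ k)"
  by (induction I rule: infinite_finite_induct) auto

lemma poly_eq_sum_upto:
  fixes x :: "'a::comm_ring_1"
  assumes "Polynomial.degree p \<le> d"
  shows "poly p x = (\<Sum>i\<le>d. Polynomial.coeff p i * x ^ i)"
  unfolding poly_altdef using assms by (intro sum.mono_neutral_left) (auto simp: coeff_eq_0)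

text \<open>
  Substituting the power with exponent -N for t gives a pole of order N times the degree, with the
  leading coefficient of p in front.
\<close>

lemma poly_at_infinity:
  fixes p :: "'a::field poly"
  assumes s: "\<sigma> 0 = 0" and d: "Polynomial.degree p \<le> d" and N: "N > 0"
  defines "f \<equiv> poly (map_poly (\<lambda>x. fls_const (\<sigma> x)) p) (fls_X_intpow (- int N))"
  shows "vge (- int (N * d)) f" "f $$ (- int (N * d)) = (\<sigma> (Polynomial.coeff p d) :: 'b::field)"
proof -
  have "f = (\<Sum>i\<le>d. Polynomial.coeff (map_poly (\<lambda>x. fls_const (\<sigma> x)) p) i * fls_X_intpow (- int N) ^ i)"
    unfolding f_def
    by (intro poly_eq_sum_upto degree_le) (use d in \<open>auto simp: coeff_map_poly s coeff_eq_0\<close>)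
  then have "f = (\<Sum>i\<le>d. fls_const (\<sigma> (Polynomial.coeff p i)) * fls_X_intpow (- int (N * i)))"
    unfolding fls_X_intpow_power by (simp add: coeff_map_poly s mult.commute)
  moreover have cst: "(fls_const c * fls_X_intpow (- int m)) $$ k = (if k = - int m then c else 0)" for c :: 'b and k m
    unfolding fls_X_intpow_times_conv_shift(2) by (auto simp: eq_neg_iff_add_eq_0)
  ultimately have *: "f $$ k = (\<Sum>i\<le>d. if k = - int (N * i) then \<sigma> (Polynomial.coeff p i) else 0)" for k
    by (simp only: fls_sum_nth cst)
  show "f $$ (- int (N * d)) = \<sigma> (Polynomial.coeff p d)"
  proof -
    have "- int (N * d) = - int (N * i) \<longleftrightarrow> i = d" for i using N by auto
    then show ?thesis unfolding * by (simp only: sum.delta finite_atMost atMost_iff order_refl if_True)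
  qed
  show "vge (- int (N * d)) f"
    unfolding vge_def *
  proof (intro allI impI sum.neutral ballI)
    fix k i assume "k < - int (N * d)" "i \<in> {..d}"
    then have "int (N * i) \<le> int (N * d)" by (simp add: mult_left_mono)
    then show "(if k = - int (N * i) then \<sigma> (Polynomial.coeff p i) else 0) = 0"
      using \<open>k < - int (N * d)\<close> by auto
  qed
qed

lemma clear_denominators:
  assumes F: "subfld F" and P: "P \<in> polys_over (adjoin F t)"
  shows "\<exists>q\<in>polys_over F. poly q t \<noteq> 0 \<and> (\<forall>i. \<exists>B\<in>polys_over F. Polynomial.coeff P i * poly q t = poly B t)"
  using P
proof (induction P)
  case 0
  show ?case using polys_over_closed(1,2)[OF F] by (intro bexI[of _ 1]) (auto intro: bexI[of _ 0])
next
  case (pCons c P)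
  then obtain q where q: "q \<in> polys_over F" "poly q t \<noteq> 0"
    "\<And>i. \<exists>B\<in>polys_over F. Polynomial.coeff P i * poly q t = poly B t"
    by (auto simp: polys_over_pCons)
  from pCons.prems have "c \<in> adjoin F t" by (simp add: polys_over_pCons)
  then obtain a b where ab: "a \<in> polys_over F" "b \<in> polys_over F" "poly b t \<noteq> 0" "c = poly a t / poly b t"
    by (auto simp: adjoin_def)
  have "\<exists>B\<in>polys_over F. Polynomial.coeff (pCons c P) i * poly (q * b) t = poly B t" for i
  proof (cases i)
    case 0
    then show ?thesis using ab q polys_over_closed(6)[OF F] by (intro bexI[of _ "a * q"]) auto
  next
    case (Suc k)
    then obtain B where "B \<in> polys_over F" "Polynomial.coeff P k * poly q t = poly B t" using q(3) by blast
    then show ?thesis using Suc ab polys_over_closed(6)[OF F] by (intro bexI[of _ "B * b"]) (auto simp flip: mult.assoc)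
  qed
  then show ?case using ab q polys_over_closed(6)[OF F] by (intro bexI[of _ "q * b"]) auto
qed

text \<open>
  As the derivation does not lower orders, a pole of order d in w would dominate: the expression for
  the k-th derivative has order exactly -kd with leading coefficient the k-th power of that of w,
  so nothing in the equation can cancel the term with k = n.  Once w is integral, reduction
  commutes with all operations that occur.
\<close>

lemma riccati_solution_no_pole:
  fixes w :: "'a::field fls"
  assumes D: "D 0 = 0" and \<DD>: "\<DD> = laurent_derivation D b j" and n: "n \<ge> 1"
    and sol: "riccati \<DD> n (\<lambda>i. fls_const (a i)) w = 0"
  shows "vge 0 w" "riccati D n a (red w) = 0"
proof -
  have V: "vge l f \<Longrightarrow> vge l (\<DD> f)" for l f using vge_laurent_derivation[of D, OF D] by (simp add: \<DD>)
  show w0: "vge 0 w"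
  proof (rule ccontr)
    assume "\<not> vge 0 w"
    define d where "d = - fls_subdegree w"
    have d: "d > 0" "w \<noteq> 0" using \<open>\<not> vge 0 w\<close> by (auto simp: d_def vge_iff)
    have w: "vge (- d) w" "w $$ (- d) \<noteq> 0" using d by (auto simp: d_def vge_iff)
    have r: "vge (int k * (- d)) (ric \<DD> w k) \<and> ric \<DD> w k $$ (int k * (- d)) = (w $$ (- d)) ^ k" for k
    proof (induction k)
      case (Suc k)
      have e: "int (Suc k) * - d = - d + int k * - d" by (simp add: algebra_simps)
      have lt: "int (Suc k) * - d < int k * - d" using d by (simp add: algebra_simps)
      have v: "vge (int k * - d) (\<DD> (ric \<DD> w k))" using Suc V by blast
      then have "\<DD> (ric \<DD> w k) $$ (int (Suc k) * - d) = 0" using lt unfolding vge_def by blast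
      moreover have "vge (int (Suc k) * - d) (\<DD> (ric \<DD> w k))" using vge_mono[OF v] lt by simp
      moreover have "vge (int (Suc k) * - d) (w * ric \<DD> w k)"
        unfolding e using Suc w by (intro vge_mult) auto
      moreover have "(w * ric \<DD> w k) $$ (int (Suc k) * - d) = w $$ (- d) * (w $$ (- d)) ^ k"
        unfolding e using vge_times_nth[OF w(1) conjunct1[OF Suc]] conjunct2[OF Suc] by simp
      ultimately show ?case by (auto intro: vge_add)
    qed simp
    have z: "(fls_const (a i) * ric \<DD> w (n - i)) $$ (int n * (- d)) = 0" if "i \<in> {1..n}" for i
    proof -
      have "vge (0 + int (n - i) * - d) (fls_const (a i) * ric \<DD> w (n - i))"
        using r by (intro vge_mult) auto
      moreover have "int n * - d < 0 + int (n - i) * - d" using that d by (simp add: of_nat_diff algebra_simps)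
      ultimately show ?thesis unfolding vge_def by blast
    qed
    have "0 = riccati \<DD> n (\<lambda>i. fls_const (a i)) w $$ (int n * (- d))" using sol by simp
    also have "\<dots> = (w $$ (- d)) ^ n + (\<Sum>i=1..n. (fls_const (a i) * ric \<DD> w (n - i)) $$ (int n * (- d)))"
      using r[of n] by (simp add: riccati_def fls_sum_nth)
    also have "\<dots> = (w $$ (- d)) ^ n" using z by (simp add: sum.neutral)
    finally show False using w(2) by simp
  qed
  have r: "vge 0 (ric \<DD> w k) \<and> red (ric \<DD> w k) = ric D (red w) k" for k
  proof (induction k)
    case (Suc k)
    then show ?case
      using V vge_0_mult[OF w0] vge_times_nth[OF w0, of 0] red_laurent_derivation[of D, OF D]
      by (auto simp: \<DD> intro: vge_add)
  qed simp
  have "0 = red (riccati \<DD> n (\<lambda>i. fls_const (a i)) w)" using sol by simp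
  also have "\<dots> = riccati D n a (red w)"
    using r by (simp add: riccati_def fls_sum_nth)
  finally show "riccati D n a (red w) = 0" by simp
qed

text \<open>
  Clear denominators in P to make its coefficients polynomials in t.  If d is the largest
  degree among them, then comparing the coefficients at the order -Nd in P(w) = 0 gives a
  polynomial equation for the reduction of w; its coefficients are the images of those of t^d,
  not all of which vanish.
\<close>

lemma algebraic_residue:
  fixes F :: "'a::field_char_0 set" and w :: "'a fls"
  assumes F: "subfld F" and t: "\<not> alg_over F t" and s: "hom_on UNIV \<sigma>" and N: "N > 0"
    and h: "hom_on (adjoin F t) h" "\<And>x. x \<in> F \<Longrightarrow> h x = fls_const (\<sigma> x)" "h t = fls_X_intpow (- int N)"
    and P: "P \<in> polys_over (adjoin F t)" "P \<noteq> 0" "poly (map_poly h P) w = 0" and w: "vge 0 w"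
  shows "alg_over (\<sigma> ` F) (red w)"
proof -
  note A = subfld_adjoin[OF F, of t]
  note hs = hom_onD[OF h(1) A(1)]
  note ss = hom_onD[OF s subfld_UNIV, simplified]
  obtain q where q: "q \<in> polys_over F" "poly q t \<noteq> 0"
    "\<forall>i. \<exists>B\<in>polys_over F. Polynomial.coeff P i * poly q t = poly B t"
    using clear_denominators[OF F P(1)] by blast
  then obtain B where B: "\<And>i. B i \<in> polys_over F" "\<And>i. Polynomial.coeff P i * poly q t = poly (B i) t"
    by metis
  define n where "n = Polynomial.degree P"
  \<comment> \<open>If P is multiplied by the common denominator, the largest pole has order Nd.\<close>
  define d where "d = Max ((\<lambda>i. Polynomial.degree (B i)) ` {..n})"
  have d: "Polynomial.degree (B i) \<le> d" if "i \<le> n" for i unfolding d_def using that by (intro Max_ge) auto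
  have Bz: "B i = 0 \<longleftrightarrow> Polynomial.coeff P i = 0" for i
    using B[of i] t q(2) unfolding alg_over_def by auto
  obtain i0 where i0: "i0 \<le> n" "Polynomial.coeff (B i0) d \<noteq> 0"
  proof -
    have "d \<in> (\<lambda>i. Polynomial.degree (B i)) ` {..n}" unfolding d_def by (intro Max_in) auto
    then obtain i where i: "i \<le> n" "d = Polynomial.degree (B i)" by auto
    show thesis
    proof (cases "B i = 0")
      case False
      then show thesis using that i by auto
    next
      case True
      have "B n \<noteq> 0" using Bz P(2) by (simp add: n_def)
      moreover have "Polynomial.degree (B n) = 0" using d[of n] i True by simp
      ultimately show thesis using that[of n] i True by (metis degree_0 leading_coeff_0_iff order_refl)
    qed
  qed
  have hB: "h (poly p t) = poly (map_poly (\<lambda>x. fls_const (\<sigma> x)) p) (fls_X_intpow (- int N))" if "p \<in> polys_over F" for p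
  proof -
    have "p \<in> polys_over (adjoin F t)" using that A(2) by (auto simp: polys_over_def)
    then have "h (poly p t) = poly (map_poly h p) (h t)" using poly_map_poly_hom[OF h(1) A(1)] A(3) by blast
    also have "map_poly h p = map_poly (\<lambda>x. fls_const (\<sigma> x)) p"
      using that h(2) by (intro poly_eqI) (simp add: coeff_map_poly polys_over_def hs(1) ss(1))
    finally show ?thesis using h(3) by simp
  qed
  define g where "g i = poly (map_poly (\<lambda>x. fls_const (\<sigma> x)) (B i)) (fls_X_intpow (- int N))" for i
  have g: "vge (- int (N * d)) (g i)" "g i $$ (- int (N * d)) = \<sigma> (Polynomial.coeff (B i) d)" if "i \<le> n" for i
    unfolding g_def using poly_at_infinity[of \<sigma> "B i" d N] d[OF that] ss N by auto
  have gP: "g i = Polynomial.coeff (map_poly h P) i * h (poly q t)" for i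
  proof -
    have "g i = h (poly (B i) t)" unfolding g_def using hB[OF B(1)] by simp
    also have "\<dots> = h (Polynomial.coeff P i) * h (poly q t)"
      unfolding B(2)[symmetric] using P(1) adjoin_poly[OF F q(1)] by (intro hs(4)) (auto simp: polys_over_def)
    finally show ?thesis by (simp add: coeff_map_poly hs(1))
  qed
  have "(\<Sum>i\<le>n. g i * w ^ i) = (\<Sum>i\<le>n. Polynomial.coeff (map_poly h P) i * w ^ i) * h (poly q t)"
    unfolding gP sum_distrib_right by (simp add: mult_ac)
  also have "(\<Sum>i\<le>n. Polynomial.coeff (map_poly h P) i * w ^ i) = poly (map_poly h P) w"
    by (rule poly_eq_sum_upto[symmetric]) (use map_poly_hom(3)[OF h(1) A(1) P(1) P(1)] in \<open>simp add: n_def\<close>)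
  finally have "(\<Sum>i\<le>n. g i * w ^ i) = 0" using P(3) by simp
  then have "0 = (\<Sum>i\<le>n. (g i * w ^ i) $$ (- int (N * d)))" by (metis fls_sum_nth fls_zero_nth)
  also have "\<dots> = (\<Sum>i\<le>n. \<sigma> (Polynomial.coeff (B i) d) * red w ^ i)"
  proof (intro sum.cong refl)
    fix i assume "i \<in> {..n}"
    moreover have "vge 0 (w ^ i) \<and> (w ^ i) $$ 0 = red w ^ i" using vge_power[OF w, of i] by simp
    ultimately show "(g i * w ^ i) $$ (- int (N * d)) = \<sigma> (Polynomial.coeff (B i) d) * red w ^ i"
      using vge_times_nth[OF g(1), of i 0 "w ^ i"] g(2) by simp
  qed
  finally have zero: "(\<Sum>i\<le>n. \<sigma> (Polynomial.coeff (B i) d) * red w ^ i) = 0" by simp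
  define p where "p = (\<Sum>i\<le>n. Polynomial.monom (\<sigma> (Polynomial.coeff (B i) d)) i)"
  have cp: "Polynomial.coeff p i = (if i \<le> n then \<sigma> (Polynomial.coeff (B i) d) else 0)" for i
    by (simp add: p_def coeff_sum sum.delta' eq_commute)
  have "poly p (red w) = 0" using zero by (simp add: p_def poly_sum poly_monom)
  moreover have "Polynomial.coeff p i0 \<noteq> 0" using i0 unfolding cp by (simp add: ss(7))
  then have "p \<noteq> 0" by (metis coeff_0)
  moreover have "p \<in> polys_over (\<sigma> ` F)"
    using B(1) subfldD(1)[OF F] ss(1) by (auto simp: polys_over_def cp image_iff intro: bexI[of _ 0])
  ultimately show ?thesis by (auto simp: alg_over_def)
qed

text \<open>
  The set \<D> of derivations is closed under transport along S, which allows the result to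
  be applied again to the new field, derivation and solution.
\<close>

theorem riccati_specialization:
  fixes S :: "('a::field_char_0 \<Rightarrow> 'a) set" and \<D> :: "('a \<Rightarrow> 'a) set"
  assumes S: "root_closed S"
    and ders: "\<And>D. D \<in> \<D> \<Longrightarrow> derivation D"
    and lift: "\<And>\<sigma> D. \<sigma> \<in> S \<Longrightarrow> D \<in> \<D> \<Longrightarrow> \<exists>D'\<in>\<D>. \<forall>x. \<sigma> (D x) = D' (\<sigma> x)"
    and D: "D \<in> \<D>" and F: "subfld F" and DF: "\<And>x. x \<in> F \<Longrightarrow> D x \<in> F"
    and t: "\<not> alg_over F t" and Dt: "D t \<in> F \<or> (\<exists>b\<in>F. D t = b * t)"
    and u: "alg_over (adjoin F t) u" and n: "n \<ge> 1" and a: "\<And>i. i \<in> {1..n} \<Longrightarrow> a i \<in> F"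
    and sol: "riccati D n a u = 0"
  obtains \<sigma> D' c where "\<sigma> \<in> S" "D' \<in> \<D>" "\<And>x. \<sigma> (D x) = D' (\<sigma> x)"
    "alg_over (\<sigma> ` F) c" "riccati D' n (\<lambda>i. \<sigma> (a i)) c = 0"
proof -
  note A = subfld_adjoin[OF F, of t]
  have c: "hom_on F fls_const" by (auto simp: hom_on_def simp flip: fls_plus_const fls_const_mult_const)
  \<comment> \<open>Both t and the inverse of the variable s are transcendental over F.\<close>
  have "poly p t = 0 \<longleftrightarrow> poly (map_poly fls_const p) fls_X_inv = 0" if p: "p \<in> polys_over F" for p
  proof (cases "p = 0")
    case False
    have "poly (map_poly fls_const p) (fls_X_intpow (- int 1)) $$ (- int (1 * Polynomial.degree p)) = Polynomial.lead_coeff p"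
      using poly_at_infinity(2)[of "\<lambda>x. x" p "Polynomial.degree p" 1] by simp
    then have "poly (map_poly fls_const p) (fls_X_intpow (- int 1)) \<noteq> 0" using False by auto
    moreover have "poly p t \<noteq> 0" using t p False by (auto simp: alg_over_def)
    ultimately show ?thesis by (simp add: fls_X_inv_conv_shift_1)
  qed simp
  from extend_hom[OF F c this]
  obtain h1 where h1: "hom_on (adjoin F t) h1" "\<And>x. x \<in> F \<Longrightarrow> h1 x = fls_const x" "h1 t = fls_X_inv" by blast
  obtain P where P: "P \<in> polys_over (adjoin F t)" "P \<noteq> 0" "poly P u = 0"
    and Pmin: "\<And>p. p \<in> polys_over (adjoin F t) \<Longrightarrow> poly p u = 0 \<Longrightarrow> p \<noteq> 0 \<Longrightarrow> Polynomial.degree P \<le> Polynomial.degree p"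
    using alg_over_minimal_polynomial[OF u] by blast
  have "Polynomial.degree P \<noteq> 0" using P by (metis degree_eq_zeroE poly_const_conv pCons_0_0)
  then have "Polynomial.degree (map_poly h1 P) > 0" using map_poly_hom(3)[OF h1(1) A(1) P(1) P(1)] by simp
  then have "has_root (puiseux_maps S) (map_poly h1 P)"
    using root_closedD(2)[OF puiseux_root_closed[OF S]] by blast
  then obtain N \<sigma> w where N: "N > 0" "\<sigma> \<in> S" and w: "poly (map_poly (puiseux_map N \<sigma>) (map_poly h1 P)) w = 0"
    by (auto simp: has_root_def puiseux_maps_def)
  interpret endo_monoid S using root_closedD(1)[OF S] .
  note s = hom[OF N(2)] and ss = homs[OF N(2)]
  define h where "h = puiseux_map N \<sigma> \<circ> h1"
  note ps = hom_onD[OF hom_on_puiseux_map[OF N(1) s] subfld_UNIV, simplified]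
  have h: "hom_on (adjoin F t) h"
    unfolding hom_on_def h_def using hom_onD[OF h1(1) A(1)] ps by simp
  have hF: "h x = fls_const (\<sigma> x)" if "x \<in> F" for x
    unfolding h_def using h1(2)[OF that] N(1) by (intro fls_eqI) (auto simp: puiseux_map_nth ss)
  have ht: "h t = fls_X_intpow (- int N)"
  proof (rule fls_eqI)
    fix k
    show "h t $$ k = fls_X_intpow (- int N) $$ k"
    proof (cases "int N dvd k")
      case True
      then obtain l where "k = int N * l" by auto
      moreover from this have "k = - int N \<longleftrightarrow> l = - 1"
        using N(1) by (metis mult_cancel_left mult_minus1_right of_nat_0_less_iff order_less_irrefl)
      ultimately show ?thesis
        using h1(3) N(1) by (simp add: h_def puiseux_map_nth ss flip: eq_neg_iff_add_eq_0)
    qed (use h1(3) N(1) in \<open>auto simp: h_def puiseux_map_nth ss simp flip: eq_neg_iff_add_eq_0\<close>)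
  qed
  have w: "poly (map_poly h P) w = 0"
    using w map_poly_map_poly[of "puiseux_map N \<sigma>" h1 P] ps(1) hom_onD(1)[OF h1(1) A(1)] by (simp add: h_def)
  obtain D' where D': "D' \<in> \<D>" "\<And>x. \<sigma> (D x) = D' (\<sigma> x)" using lift[OF N(2) D] by blast
  note d = derivationD[OF ders[OF D'(1)]]
  \<comment> \<open>As t = s^(-N), a derivation with s' = b s^(j+1) has t' = -N b s^(j-N).  So t' = e requires
    j = N, and t' = et requires j = 0.\<close>
  obtain b j where bj: "h (D t) = laurent_derivation D' b j (h t)" and DtA: "D t \<in> adjoin F t"
  proof (cases "D t \<in> F")
    case True
    have "h (D t) = laurent_derivation D' (- \<sigma> (D t) / of_nat N) N (h t)"
      unfolding hF[OF True] ht using N(1) by (intro fls_eqI) (auto simp: laurent_derivation_nth d)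
    then show thesis using that True A by blast
  next
    case False
    then obtain e where e: "e \<in> F" "D t = e * t" using Dt by blast
    have "h (D t) = fls_const (\<sigma> e) * fls_X_intpow (- int N)"
      unfolding e(2) using hom_onD(4)[OF h A(1), of e t] e(1) A(2,3) hF ht by auto
    also have "\<dots> = laurent_derivation D' (- \<sigma> e / of_nat N) 0 (h t)"
      unfolding ht using N(1)
      by (intro fls_eqI) (auto simp: laurent_derivation_nth d simp flip: eq_neg_iff_add_eq_0)
    finally show thesis using that e A subfldD(4)[OF A(1), of e t] by auto
  qed
  define \<DD> where "\<DD> = laurent_derivation D' b j"
  have \<DD>: "derivation \<DD>" unfolding \<DD>_def by (rule derivation_laurent_derivation[OF ders[OF D'(1)]])
  have comF: "D x \<in> adjoin F t \<and> h (D x) = \<DD> (h x)" if "x \<in> F" for x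
    using DF[OF that] A(2) that hF[of x] hF[of "D x"] D'(2) by (auto simp: \<DD>_def laurent_derivation_const d)
  have com: "D x \<in> adjoin F t \<and> h (D x) = \<DD> (h x)" if "x \<in> adjoin F t" for x
    by (rule hom_commutes_adjoin[OF F h ders[OF D] \<DD> comF DtA _ that]) (auto simp: bj \<DD>_def)
  obtain g where g: "hom_on (adjoin (adjoin F t) u) g" "\<And>x. x \<in> adjoin F t \<Longrightarrow> g x = h x" "g u = w"
    "\<And>x. x \<in> adjoin (adjoin F t) u \<Longrightarrow> D x \<in> adjoin (adjoin F t) u \<and> g (D x) = \<DD> (g x)"
    using extend_differential_hom_algebraic[where F = "adjoin F t" and h = h and D = D and D' = \<DD> and P = P and u = u and w = w,
        OF A(1) h ders[OF D] \<DD>] com P Pmin w by blast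
  note AA = subfld_adjoin[OF A(1), of u]
  have aAA: "a i \<in> adjoin (adjoin F t) u" "g (a i) = fls_const (\<sigma> (a i))" if "i \<in> {1..n}" for i
    using a[OF that] A(2) AA(2) g(2) hF by auto
  have "g 0 = riccati \<DD> n (\<lambda>i. g (a i)) (g u)"
    using riccati_hom[where D = D and D' = \<DD> and a = a and n = n, OF g(1) AA(1,3) aAA(1) g(4)] sol by simp
  then have "riccati \<DD> n (\<lambda>i. g (a i)) w = 0" using hom_onD(1)[OF g(1) AA(1)] g(3) by simp
  also have "riccati \<DD> n (\<lambda>i. g (a i)) w = riccati \<DD> n (\<lambda>i. fls_const (\<sigma> (a i))) w"
    using aAA(2) by (simp add: riccati_def)
  finally have solw: "riccati \<DD> n (\<lambda>i. fls_const (\<sigma> (a i))) w = 0" .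
  note w0 = riccati_solution_no_pole[OF d(3) \<DD>_def n solw]
  show thesis
    by (rule that[OF N(2) D'(1,2) algebraic_residue[OF F t s N(1) h hF ht P(1,2) w w0(1)] w0(2)])
qed

section \<open>Algebraic elements of abstract and concrete fields\<close>

text \<open>
  HOL-Algebra represents a polynomial by the list of its coefficients with the leading one first.
\<close>

lemma (in ring) eval_hom:
  fixes h :: "'a \<Rightarrow> 'k::field"
  assumes h: "\<And>x y. x \<in> carrier R \<Longrightarrow> y \<in> carrier R \<Longrightarrow> h (x \<oplus> y) = h x + h y"
    "\<And>x y. x \<in> carrier R \<Longrightarrow> y \<in> carrier R \<Longrightarrow> h (x \<otimes> y) = h x * h y" "h \<zero> = 0" "h \<one> = 1"
    and y: "y \<in> carrier R" and p: "set p \<subseteq> carrier R"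
  shows "h (eval p y) = poly (Poly (rev (map h p))) (h y)"
  using p
proof (induction p)
  case (Cons c p)
  have pow: "h (y [^] (k::nat)) = h y ^ k" for k
    by (induction k) (simp_all add: h y)
  from Cons show ?case
    using y eval_in_carrier[of p y] by (simp add: h Poly_snoc poly_monom pow del: Poly.simps)
qed (simp add: h)

lemma (in domain) algebraic_imp_alg_over:
  fixes h :: "'a \<Rightarrow> 'k::field"
  assumes h: "\<And>x y. x \<in> carrier R \<Longrightarrow> y \<in> carrier R \<Longrightarrow> h (x \<oplus> y) = h x + h y"
    "\<And>x y. x \<in> carrier R \<Longrightarrow> y \<in> carrier R \<Longrightarrow> h (x \<otimes> y) = h x * h y" "h \<zero> = 0" "h \<one> = 1"
    and inj: "inj_on h (carrier R)" and y: "y \<in> carrier R"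
    and K: "subring K R" and a: "(algebraic over K) y"
  shows "alg_over (h ` K) (h y)"
proof -
  have KR: "K \<subseteq> carrier R" using subringE(1)[OF K] .
  from algebraicE[OF K y a] obtain p where p: "p \<in> carrier (K[X])" "p \<noteq> []" "eval p y = \<zero>" by blast
  then have pK: "set p \<subseteq> K" "lead_coeff p \<noteq> \<zero>" by (auto simp: univ_poly_def polynomial_def)
  define P where "P = Poly (rev (map h p))"
  have "poly P (h y) = 0" unfolding P_def using eval_hom[OF h y] p pK(1) KR h(3) by (metis subset_trans)
  moreover have "P \<noteq> 0"
  proof -
    have "h (lead_coeff p) \<noteq> h \<zero>" using inj pK KR p(2) by (metis hd_in_set inj_on_eq_iff subsetD zero_closed)
    then have "Polynomial.coeff P (length p - 1) \<noteq> 0"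
      using p(2) by (simp add: P_def coeff_Poly_eq nth_default_def rev_nth h(3) hd_conv_nth rev_map)
    then show ?thesis by auto
  qed
  moreover have "P \<in> polys_over (h ` K)"
    using pK(1) subringE(2)[OF K] h(3) unfolding P_def polys_over_def
    by (force simp: coeff_Poly_eq nth_default_def rev_nth image_iff)
  ultimately show ?thesis by (auto simp: alg_over_def)
qed

lemma (in ring) alg_over_imp_algebraic:
  fixes h :: "'a \<Rightarrow> 'k::field"
  assumes h: "\<And>x y. x \<in> carrier R \<Longrightarrow> y \<in> carrier R \<Longrightarrow> h (x \<oplus> y) = h x + h y"
    "\<And>x y. x \<in> carrier R \<Longrightarrow> y \<in> carrier R \<Longrightarrow> h (x \<otimes> y) = h x * h y" "h \<zero> = 0" "h \<one> = 1"
    and inj: "inj_on h (carrier R)" and y: "y \<in> carrier R"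
    and KR: "K \<subseteq> carrier R" and a: "alg_over (h ` K) (h y)"
  shows "(algebraic over K) y"
proof -
  obtain P where P: "P \<in> polys_over (h ` K)" "P \<noteq> 0" "poly P (h y) = 0"
    using a by (auto simp: alg_over_def)
  define p where "p = rev (map (inv_into K h) (coeffs P))"
  have cP: "set (coeffs P) \<subseteq> h ` K" using P(1) by (auto simp: polys_over_def coeffs_def)
  then have pK: "set p \<subseteq> K" by (auto simp: p_def intro: inv_into_into)
  have hp: "rev (map h p) = coeffs P"
  proof -
    have "map (\<lambda>c. h (inv_into K h c)) (coeffs P) = coeffs P"
      by (rule map_idI) (use cP in \<open>auto intro: f_inv_into_f\<close>)
    then show ?thesis by (simp add: p_def rev_map o_def)
  qed
  then have "h (eval p y) = 0" using eval_hom[OF h y] pK KR P(3) by (metis Poly_coeffs subset_trans)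
  then have e: "eval p y = \<zero>"
    using inj h(3) eval_in_carrier[of p y] pK KR y by (metis inj_on_eq_iff subset_trans zero_closed)
  have p0: "p \<noteq> []" using P(2) by (simp add: p_def)
  have "lead_coeff p \<noteq> \<zero>"
  proof
    assume z: "lead_coeff p = \<zero>"
    have "last (coeffs P) = h (lead_coeff p)" using hp p0 by (metis hd_map last_rev list.map_disc_iff)
    then show False using z h(3) P(2) by (simp add: last_coeffs_eq_coeff_degree)
  qed
  then have "p \<in> carrier (K[X])" using pK by (auto simp: univ_poly_def polynomial_def)
  from algebraicI[OF this p0 e] show "(algebraic over K) y" .
qed

text \<open>
  The field type is turned into a ring record in order to use that an iterated finite extension is
  finite.
\<close>

lemma alg_over_trans:
  fixes t :: "'a::field"
  assumes F: "subfld F" and t: "alg_over F t" and u: "alg_over (adjoin F t) u"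
  shows "alg_over F u"
proof -
  define R :: "'a ring" where "R = \<lparr>carrier = UNIV, monoid.mult = (*), monoid.one = 1, ring.zero = 0, ring.add = (+)\<rparr>"
  have R: "carrier R = UNIV" "x \<oplus>\<^bsub>R\<^esub> y = x + y" "x \<otimes>\<^bsub>R\<^esub> y = x * y" "\<zero>\<^bsub>R\<^esub> = 0" "\<one>\<^bsub>R\<^esub> = 1" for x y
    by (auto simp: R_def)
  have "\<exists>y. x + y = 0" "x \<noteq> 0 \<Longrightarrow> \<exists>y. x * y = 1" for x :: 'a
    by (rule exI[of _ "- x"], simp, rule exI[of _ "inverse x"], simp)
  then interpret field R
    by unfold_locales (auto simp: R Units_def algebra_simps add_eq_0_iff)
  have mi: "\<ominus>\<^bsub>R\<^esub> x = - x" for x using minus_equality[of "- x" x] by (simp add: R)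
  have iv: "inv\<^bsub>R\<^esub> x = inverse x" if "x \<noteq> 0" for x
    using inv_unique'[of x "inverse x"] that by (simp add: R)
  have sf: "subfield K R \<longleftrightarrow> subfld K" for K
  proof
    assume K: "subfld K"
    show "subfield K R"
      by (rule subfieldI', rule subringI) (use subfldD[OF K] in \<open>auto simp: R mi iv\<close>)
  next
    assume K: "subfield K R"
    note s = subringE[OF subfieldE(1)[OF K]]
    have "inverse x \<in> K" if "x \<in> K" for x
      using subfield_m_inv(1)[OF K, of x] that s(2) iv[of x] by (cases "x = 0") (auto simp: R)
    then show "subfld K" using s by (auto simp: subfld_def R mi)
  qed
  have alg: "(algebraic over K) x \<longleftrightarrow> alg_over K x" if "subfld K" for K x
  proof -
    have "subring K R" using that sf subfieldE(1) by blast
    then have "(algebraic over K) x \<Longrightarrow> alg_over ((\<lambda>x. x) ` K) x"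
      by (intro algebraic_imp_alg_over) (simp_all add: R)
    moreover have "alg_over ((\<lambda>x. x) ` K) x \<Longrightarrow> (algebraic over K) x"
      by (intro alg_over_imp_algebraic[of "\<lambda>x. x"]) (simp_all add: R)
    ultimately show ?thesis by auto
  qed
  define L where "L = simple_extension F t"
  have FR: "subfield F R" and tR: "t \<in> carrier R" "u \<in> carrier R" using F sf by (auto simp: R)
  have ta: "(algebraic over F) t" using t F alg by blast
  have L: "subfield L R" unfolding L_def using simple_extension_is_subfield[OF FR tR(1)] ta by blast
  have "adjoin F t \<subseteq> L"
    using L sf simple_extension_incl[of F t] simple_extension_mem[OF subfieldE(1)[OF FR] tR(1)] tR(1)
    unfolding L_def by (intro adjoin_least) (auto simp: R)
  then have "alg_over L u" using u by (auto simp: alg_over_def polys_over_def)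
  then have ua: "(algebraic over L) u" using L sf alg by blast
  have fd1: "finite_dimension F L"
    unfolding L_def using finite_dimension_simple_extension[OF FR tR(1)] ta by blast
  have fd2: "finite_dimension L (simple_extension L u)"
    using finite_dimension_simple_extension[OF L tR(2)] ua by blast
  have "(algebraic over F) u"
    by (rule finite_dimension_imp_algebraic[OF FR simple_extension_is_subring[OF subfieldE(1)[OF L] tR(2)]
          telescopic_base_dim(1)[OF FR L fd1 fd2] simple_extension_mem[OF subfieldE(1)[OF L] tR(2)]])
  then show ?thesis using alg F by blast
qed

section \<open>Descent along a tower of quadratures\<close>

text \<open>
  Substituting w^N for w changes d/dw into a multiple of d/dw, and the multiples of d/dw into one
  another.
\<close>

definition scaled_derivations :: "('a::field fls \<Rightarrow> 'a fls) set" where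
  "scaled_derivations = {\<lambda>f. g * fls_deriv f | g. True}"

lemma derivation_scaled: "D \<in> scaled_derivations \<Longrightarrow> derivation D"
  by (auto simp: scaled_derivations_def derivation_def algebra_simps)

lemma fls_deriv_scaled: "fls_deriv \<in> scaled_derivations"
  unfolding scaled_derivations_def by (intro CollectI exI[of _ 1]) auto

definition ramifications :: "('a::field fls \<Rightarrow> 'a fls) set" where
  "ramifications = puiseux_maps {id}"

lemma ramification_lifts_derivation:
  fixes D :: "'a::field_char_0 fls \<Rightarrow> 'a fls"
  assumes "\<sigma> \<in> ramifications" "D \<in> scaled_derivations"
  shows "\<exists>D'\<in>scaled_derivations. \<forall>x. \<sigma> (D x) = D' (\<sigma> x)"
proof -
  obtain N where N: "N > 0" "\<sigma> = puiseux_map N id" using assms(1) by (auto simp: ramifications_def puiseux_maps_def)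
  obtain g where g: "D = (\<lambda>f. g * fls_deriv f)" using assms(2) by (auto simp: scaled_derivations_def)
  define e :: "'a fls" where "e = fls_X_intpow (1 - int N) * fls_const (inverse (of_nat N))"
  have h: "hom_on UNIV \<sigma>" unfolding N(2) by (rule hom_on_puiseux_map) (use N in \<open>auto simp: hom_on_def\<close>)
  have "\<sigma> (fls_deriv f) = e * fls_deriv (\<sigma> f)" for f
  proof (rule fls_eqI)
    fix k
    have "(k + int N) div int N = k div int N + 1" using N by simp
    moreover have "int N dvd k + int N \<longleftrightarrow> int N dvd k" by simp
    ultimately show "\<sigma> (fls_deriv f) $$ k = (e * fls_deriv (\<sigma> f)) $$ k"
      using N(1) unfolding e_def N(2) mult.assoc unfolding fls_X_intpow_times_conv_shift(1)
      by (auto simp: puiseux_map_nth field_simps elim!: dvdE)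
  qed
  then have "\<sigma> (D x) = (\<sigma> g * e) * fls_deriv (\<sigma> x)" for x
    unfolding g using hom_onD(4)[OF h subfld_UNIV] by (simp add: mult.assoc)
  then show ?thesis
    by (intro bexI[of _ "\<lambda>f. (\<sigma> g * e) * fls_deriv f"]) (auto simp: scaled_derivations_def)
qed

lemma root_closed_ramifications: "root_closed (ramifications :: (complex fls \<Rightarrow> complex fls) set)"
  unfolding ramifications_def by (rule puiseux_root_closed[OF root_closed_complex])

lemma image_adjoin:
  assumes h: "hom_on UNIV h" and F: "subfld F"
  shows "h ` adjoin F t \<subseteq> adjoin (h ` F) (h t)"
proof -
  have hF: "subfld (h ` F)" using subfld_image[OF hom_on_mono[OF h] F] by simp
  note A = subfld_adjoin[OF hF, of "h t"]
  note hs = hom_onD[OF h subfld_UNIV, simplified]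
  have "adjoin F t \<subseteq> h -` adjoin (h ` F) (h t)"
    by (rule adjoin_least) (use A subfldD[OF A(1)] in \<open>auto simp: subfld_def hs\<close>)
  then show ?thesis by blast
qed

text \<open>
  Descending induction on the height in the tower.  The endomorphism accumulates the
  ramifications that were needed so far.  An algebraic step needs no specialization, by
  transitivity; in all other steps the image of the generator under the ramification satisfies one
  of the two differential conditions with respect to the transported derivation.
\<close>

theorem riccati_tower:
  fixes F :: "nat \<Rightarrow> complex fls set"
  assumes F: "\<And>i. i \<le> m \<Longrightarrow> subfld (F i)" and DF: "\<And>i x. i \<le> m \<Longrightarrow> x \<in> F i \<Longrightarrow> fls_deriv x \<in> F i"
    and step: "\<And>i. i < m \<Longrightarrow> \<exists>t. F (Suc i) \<subseteq> adjoin (F i) t \<and>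
      (alg_over (F i) t \<or> fls_deriv t \<in> F i \<or> (\<exists>b\<in>F i. fls_deriv t = b * t))"
    and n: "n \<ge> 1" and a: "\<And>i j. i \<le> m \<Longrightarrow> j \<in> {1..n} \<Longrightarrow> a j \<in> F i"
    and u: "u \<in> F m" and sol: "riccati fls_deriv n a u = 0"
  obtains \<sigma> D c where "\<sigma> \<in> ramifications" "D \<in> scaled_derivations" "\<And>x. \<sigma> (fls_deriv x) = D (\<sigma> x)"
    "alg_over (\<sigma> ` F 0) c" "riccati D n (\<lambda>i. \<sigma> (a i)) c = 0"
proof -
  \<comment> \<open>After a ramification there is a solution algebraic over the i-th field.\<close>
  define Q where "Q i \<longleftrightarrow> (\<exists>\<sigma>\<in>ramifications. \<exists>D\<in>scaled_derivations. \<exists>c. (\<forall>x. \<sigma> (fls_deriv x) = D (\<sigma> x)) \<and>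
    alg_over (\<sigma> ` F i) c \<and> riccati D n (\<lambda>i. \<sigma> (a i)) c = 0)" for i
  interpret endo_monoid "ramifications :: (complex fls \<Rightarrow> complex fls) set"
    using root_closedD(1)[OF root_closed_ramifications] .
  have "Q 0"
  proof (rule inc_induct[of 0 m Q])
    have "alg_over (F m) u"
      unfolding alg_over_def
      using u polys_over_pCons[of "- u" "[:1:]" "F m"] polys_over_closed(3)[OF F[of m]] subfldD[OF F[of m]]
      by (intro bexI[of _ "[:- u, 1:]"]) auto
    then show "Q m"
      unfolding Q_def using id sol fls_deriv_scaled
      by (intro bexI[of _ id] bexI[of _ fls_deriv] exI[of _ u]) auto
  next
    fix k assume k: "0 \<le> k" "k < m" "Q (Suc k)"
    then obtain \<sigma> D c where s: "\<sigma> \<in> ramifications" "D \<in> scaled_derivations" "\<forall>x. \<sigma> (fls_deriv x) = D (\<sigma> x)"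
      "alg_over (\<sigma> ` F (Suc k)) c" "riccati D n (\<lambda>i. \<sigma> (a i)) c = 0" unfolding Q_def by blast
    obtain t where t: "F (Suc k) \<subseteq> adjoin (F k) t"
      "alg_over (F k) t \<or> fls_deriv t \<in> F k \<or> (\<exists>b\<in>F k. fls_deriv t = b * t)" using step[OF k(2)] by blast
    have Fk: "subfld (F k)" using F k by simp
    define E where "E = \<sigma> ` F k"
    have E: "subfld E" unfolding E_def using subfld_image[OF hom_on_mono[OF hom[OF s(1)]] Fk] by simp
    have "\<sigma> ` F (Suc k) \<subseteq> adjoin E (\<sigma> t)"
      unfolding E_def using image_adjoin[OF hom[OF s(1)] Fk] t(1) by blast
    then have c: "alg_over (adjoin E (\<sigma> t)) c"
      using s(4) unfolding alg_over_def polys_over_def by blast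
    show "Q k"
    proof (cases "alg_over E (\<sigma> t)")
      case True
      from alg_over_trans[OF E this c] have "alg_over E c" .
      then show ?thesis unfolding Q_def E_def using s by blast
    next
      case False
      then have "\<not> alg_over (F k) t"
        unfolding E_def using alg_over_image[OF hom[OF s(1)] subfld_UNIV _ _ _ Fk, of t] by auto
      then have Dt: "D (\<sigma> t) \<in> E \<or> (\<exists>b\<in>E. D (\<sigma> t) = b * \<sigma> t)"
        using t(2) s(3) homs(4)[OF s(1)] unfolding E_def by (metis image_eqI)
      have DE: "D x \<in> E" if "x \<in> E" for x
        using that DF[of k] k s(3) unfolding E_def by (metis (no_types, lifting) imageE image_eqI less_imp_le)
      have aE: "\<sigma> (a i) \<in> E" if "i \<in> {1..n}" for i using a[of k i] that k by (simp add: E_def)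
      obtain \<tau> D' c' where \<tau>: "\<tau> \<in> ramifications" "D' \<in> scaled_derivations" "\<And>x. \<tau> (D x) = D' (\<tau> x)"
        "alg_over (\<tau> ` E) c'" "riccati D' n (\<lambda>i. \<tau> (\<sigma> (a i))) c' = 0"
        by (rule riccati_specialization[OF root_closed_ramifications derivation_scaled ramification_lifts_derivation
            s(2) E DE False Dt c n aE s(5)]) blast+
      have "\<tau> ` E = (\<tau> \<circ> \<sigma>) ` F k" by (simp add: E_def image_comp)
      then show ?thesis
        unfolding Q_def using comp[OF \<tau>(1) s(1)] \<tau> s(3)
        by (intro bexI[of _ "\<tau> \<circ> \<sigma>"] bexI[of _ D'] exI[of _ c']) auto
    qed
  qed simp
  then show thesis unfolding Q_def using that by blast
qed

section \<open>Meromorphic functions on a Riemann surface\<close>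

lemma nicely_meromorphic_cong:
  assumes "f nicely_meromorphic_on A" "open A" "\<And>z. z \<in> A \<Longrightarrow> f z = g z"
  shows "g nicely_meromorphic_on A"
proof -
  have ev: "eventually (\<lambda>w. f w = g w) (at z)" if "z \<in> A" for z
    using eventually_at_in_open'[OF assms(2) that] by eventually_elim (simp add: assms(3))
  have "g meromorphic_on A"
    using assms(1) meromorphic_on_cong[OF ev refl] by (simp add: nicely_meromorphic_on_def)
  moreover have "is_pole g z \<and> g z = 0 \<or> g \<midarrow>z\<rightarrow> g z" if "z \<in> A" for z
  proof -
    have "is_pole f z \<longleftrightarrow> is_pole g z" by (rule is_pole_cong[OF ev[OF that] refl])
    moreover have "f \<midarrow>z\<rightarrow> g z \<longleftrightarrow> g \<midarrow>z\<rightarrow> g z" by (rule filterlim_cong[OF refl refl ev[OF that]])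
    ultimately show ?thesis using assms(1) assms(3)[OF that] that by (auto simp: nicely_meromorphic_on_def)
  qed
  ultimately show ?thesis by (auto simp: nicely_meromorphic_on_def)
qed

text \<open>
  Meromorphic in all charts, with arbitrary values at poles and removable singularities.  This
  is stable under the pointwise operations, and the normalization turns such functions
  into elements of the field.
\<close>

definition pre_mero :: "'a surface \<Rightarrow> ('a \<Rightarrow> complex) \<Rightarrow> bool" where
  "pre_mero V h \<longleftrightarrow> (\<forall>(D, \<phi>) \<in> surf_charts V. (\<lambda>z. h (inv_into D \<phi> z)) meromorphic_on \<phi> ` D)"

lemma pre_mero_ops:
  assumes "pre_mero V f" "pre_mero V g"
  shows "pre_mero V (\<lambda>p. f p + g p)" "pre_mero V (\<lambda>p. f p * g p)" "pre_mero V (\<lambda>p. - f p)"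
    "pre_mero V (\<lambda>p. inverse (f p))"
  using assms unfolding pre_mero_def by (auto intro!: meromorphic_intros)

lemma pre_mero_const: "pre_mero V (\<lambda>p. c)"
  unfolding pre_mero_def by auto

locale surf =
  fixes V :: "'a surface"
  assumes surf: "riemann_surface V"
begin

lemma chart_homeo:
  assumes "(D, \<phi>) \<in> surf_charts V"
  shows "openin (surf_top V) D" "D \<subseteq> points V" "open (\<phi> ` D)"
    "homeomorphic_map (subtopology (surf_top V) D) (top_of_set (\<phi> ` D)) \<phi>"
proof -
  have "\<forall>(D, \<phi>) \<in> surf_charts V. openin (surf_top V) D \<and> open (\<phi> ` D) \<and>
        homeomorphic_map (subtopology (surf_top V) D) (top_of_set (\<phi> ` D)) \<phi>"
    using surf unfolding riemann_surface_def by blast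
  from bspec[OF this assms] show "openin (surf_top V) D" "open (\<phi> ` D)"
    "homeomorphic_map (subtopology (surf_top V) D) (top_of_set (\<phi> ` D)) \<phi>" by auto
  then show "D \<subseteq> points V" by (simp add: openin_subset)
qed

lemma chart_transition:
  assumes "(D, \<phi>) \<in> surf_charts V" "(E, \<psi>) \<in> surf_charts V"
  shows "(\<lambda>z. \<psi> (inv_into D \<phi> z)) holomorphic_on \<phi> ` (D \<inter> E)"
proof -
  have "\<forall>(D, \<phi>) \<in> surf_charts V. \<forall>(E, \<psi>) \<in> surf_charts V.
        (\<lambda>z. \<psi> (inv_into D \<phi> z)) holomorphic_on \<phi> ` (D \<inter> E)"
    using surf unfolding riemann_surface_def by blast
  from bspec[OF this assms(1)] assms(2) show ?thesis by auto
qed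

lemma chart_inj:
  assumes "(D, \<phi>) \<in> surf_charts V" shows "inj_on \<phi> D"
  using homeomorphic_imp_injective_map[OF chart_homeo(4)[OF assms]] chart_homeo(2)[OF assms]
  by (simp add: inf.absorb2)

lemma chart_inv:
  assumes "(D, \<phi>) \<in> surf_charts V"
  shows "p \<in> D \<Longrightarrow> inv_into D \<phi> (\<phi> p) = p" "z \<in> \<phi> ` D \<Longrightarrow> inv_into D \<phi> z \<in> D"
    "z \<in> \<phi> ` D \<Longrightarrow> \<phi> (inv_into D \<phi> z) = z"
  using chart_inj[OF assms] by (auto intro: inv_into_into f_inv_into_f)

lemma chart_open_image:
  assumes "(D, \<phi>) \<in> surf_charts V" "openin (surf_top V) A"
  shows "open (\<phi> ` (A \<inter> D))"
proof -
  have "openin (subtopology (surf_top V) D) (A \<inter> D)" using assms(2) by (auto simp: openin_subtopology)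
  then have "openin (top_of_set (\<phi> ` D)) (\<phi> ` (A \<inter> D))"
    using homeomorphic_imp_open_map[OF chart_homeo(4)[OF assms(1)]] unfolding open_map_def by blast
  then show ?thesis using chart_homeo(3)[OF assms(1)] by (rule openin_open_trans)
qed

lemma chart_open_preimage:
  assumes "(D, \<phi>) \<in> surf_charts V" "open T"
  shows "openin (surf_top V) {p \<in> D. \<phi> p \<in> T}"
proof -
  have "continuous_map (subtopology (surf_top V) D) (top_of_set (\<phi> ` D)) \<phi>"
    using homeomorphic_imp_continuous_map[OF chart_homeo(4)[OF assms(1)]] .
  moreover have "openin (top_of_set (\<phi> ` D)) (\<phi> ` D \<inter> T)" using assms(2) by (rule openin_open_Int)
  ultimately have "openin (subtopology (surf_top V) D) {p \<in> topspace (subtopology (surf_top V) D). \<phi> p \<in> \<phi> ` D \<inter> T}"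
    unfolding continuous_map_def by blast
  moreover have "{p \<in> topspace (subtopology (surf_top V) D). \<phi> p \<in> \<phi> ` D \<inter> T} = {p \<in> D. \<phi> p \<in> T}"
    using chart_homeo(2)[OF assms(1)] by auto
  ultimately show ?thesis using chart_homeo(1)[OF assms(1)] by (simp add: openin_open_subtopology)
qed

lemma chart_cover:
  assumes "p \<in> points V" obtains D \<phi> where "(D, \<phi>) \<in> surf_charts V" "p \<in> D"
proof -
  have "(\<Union>(D, \<phi>) \<in> surf_charts V. D) = points V" using surf unfolding riemann_surface_def by blast
  then show thesis using assms that by blast
qed

lemma chart_at_props:
  assumes "p \<in> points V"
  shows "chart_at V p \<in> surf_charts V" "p \<in> fst (chart_at V p)"
proof -
  obtain D \<phi> where "(D, \<phi>) \<in> surf_charts V" "p \<in> D" using chart_cover[OF assms] .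
  then have "chart_at V p \<in> surf_charts V \<and> p \<in> fst (chart_at V p)"
    unfolding chart_at_def by (intro someI[of "\<lambda>c. c \<in> surf_charts V \<and> p \<in> fst c" "(D, \<phi>)"]) auto
  then show "chart_at V p \<in> surf_charts V" "p \<in> fst (chart_at V p)" by auto
qed

text \<open>
  This reduces all statements about punctured neighbourhoods on the surface to the complex plane.
\<close>

lemma eventually_atin_chart:
  assumes c: "(D, \<phi>) \<in> surf_charts V" and p: "p \<in> D"
  shows "eventually P (atin (surf_top V) p) \<longleftrightarrow> eventually (\<lambda>z. P (inv_into D \<phi> z)) (at (\<phi> p))"
proof
  assume "eventually P (atin (surf_top V) p)"
  then obtain A where A: "openin (surf_top V) A" "p \<in> A" "\<forall>q\<in>A - {p}. P q"
    using p chart_homeo(2)[OF c] by (auto simp: eventually_atin)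
  have "open (\<phi> ` (A \<inter> D))" "\<phi> p \<in> \<phi> ` (A \<inter> D)" using chart_open_image[OF c A(1)] A p by auto
  then have "eventually (\<lambda>z. z \<in> \<phi> ` (A \<inter> D) - {\<phi> p}) (at (\<phi> p))" by (rule eventually_at_in_open)
  then show "eventually (\<lambda>z. P (inv_into D \<phi> z)) (at (\<phi> p))"
    by eventually_elim (use A chart_inv[OF c] in auto)
next
  assume "eventually (\<lambda>z. P (inv_into D \<phi> z)) (at (\<phi> p))"
  then obtain T where T: "open T" "\<phi> p \<in> T" "\<And>z. z \<in> T \<Longrightarrow> z \<noteq> \<phi> p \<Longrightarrow> P (inv_into D \<phi> z)"
    unfolding eventually_at_topological by blast
  have "P q" if "q \<in> {q \<in> D. \<phi> q \<in> T} - {p}" for q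
  proof -
    have "\<phi> q \<noteq> \<phi> p" using that p inj_onD[OF chart_inj[OF c]] by auto
    then show ?thesis using T(3)[of "\<phi> q"] that chart_inv(1)[OF c, of q] by auto
  qed
  then show "eventually P (atin (surf_top V) p)"
    using chart_open_preimage[OF c T(1)] p T(2) unfolding eventually_atin by blast
qed

lemma atin_neq_bot: "p \<in> points V \<Longrightarrow> atin (surf_top V) p \<noteq> bot"
proof
  assume p: "p \<in> points V" "atin (surf_top V) p = bot"
  obtain D \<phi> where c: "(D, \<phi>) \<in> surf_charts V" "p \<in> D" using chart_cover[OF p(1)] .
  have "eventually (\<lambda>_. False) (atin (surf_top V) p)" using p(2) by simp
  then have "eventually (\<lambda>_. False) (at (\<phi> p))" using eventually_atin_chart[OF c, of "\<lambda>_. False"] by simp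
  then show False by simp
qed

lemma tendsto_atin_chart:
  assumes c: "(D, \<phi>) \<in> surf_charts V" and p: "p \<in> D"
  shows "(h \<longlongrightarrow> l) (atin (surf_top V) p) \<longleftrightarrow> ((\<lambda>z. h (inv_into D \<phi> z)) \<longlongrightarrow> l) (at (\<phi> p))"
  unfolding tendsto_def using eventually_atin_chart[OF c p] by simp

lemma mero_normal_chart:
  assumes c: "(D, \<phi>) \<in> surf_charts V" and z: "z \<in> \<phi> ` D"
  shows "mero_normal V h (inv_into D \<phi> z) = remove_sings (\<lambda>z. h (inv_into D \<phi> z)) z"
proof -
  have p: "inv_into D \<phi> z \<in> D" "\<phi> (inv_into D \<phi> z) = z" using chart_inv[OF c] z by auto
  then have "inv_into D \<phi> z \<in> points V" using chart_homeo(2)[OF c] by auto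
  then show ?thesis
    unfolding mero_normal_def remove_sings_def Lim_def t2_space_class.Lim_def
    by (simp add: tendsto_atin_chart[OF c p(1)] p(2))
qed

lemma mero_normal_outside: "p \<notin> points V \<Longrightarrow> mero_normal V h p = 0"
  by (simp add: mero_normal_def)

lemma mero_normal_mem:
  assumes "pre_mero V h" shows "mero_normal V h \<in> meromorphic_functions V"
  unfolding meromorphic_functions_def
proof (intro CollectI conjI ballI allI impI; (safe)?)
  fix D \<phi> assume c: "(D, \<phi>) \<in> surf_charts V"
  have "remove_sings (\<lambda>z. h (inv_into D \<phi> z)) nicely_meromorphic_on \<phi> ` D"
    using assms c by (intro remove_sings_nicely_meromorphic) (auto simp: pre_mero_def)
  then show "(\<lambda>z. mero_normal V h (inv_into D \<phi> z)) nicely_meromorphic_on \<phi> ` D"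
    by (rule nicely_meromorphic_cong) (use chart_homeo(3)[OF c] mero_normal_chart[OF c] in auto)
qed (rule mero_normal_outside)

lemma mero_pre: "f \<in> meromorphic_functions V \<Longrightarrow> pre_mero V f"
  by (force simp: meromorphic_functions_def pre_mero_def nicely_meromorphic_on_def)

lemma mero_normal_eventually:
  assumes h: "pre_mero V h" and p: "p \<in> points V"
  shows "eventually (\<lambda>q. mero_normal V h q = h q) (atin (surf_top V) p)"
proof -
  obtain D \<phi> where c: "(D, \<phi>) \<in> surf_charts V" "p \<in> D" using chart_cover[OF p] .
  have "(\<lambda>z. h (inv_into D \<phi> z)) meromorphic_on {\<phi> p}"
    using h c by (auto simp: pre_mero_def intro: meromorphic_on_subset)
  then have "eventually (\<lambda>z. remove_sings (\<lambda>z. h (inv_into D \<phi> z)) z = h (inv_into D \<phi> z)) (at (\<phi> p))"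
    by (intro eventually_remove_sings_eq_at) (auto simp: meromorphic_at_iff)
  moreover have "eventually (\<lambda>z. z \<in> \<phi> ` D) (at (\<phi> p))"
    using chart_homeo(3)[OF c(1)] c(2) by (intro eventually_at_in_open') auto
  ultimately show ?thesis
    unfolding eventually_atin_chart[OF c] by eventually_elim (simp add: mero_normal_chart[OF c(1)])
qed

lemma mero_value:
  assumes f: "f \<in> meromorphic_functions V"
  shows "mero_normal V f = f"
proof
  fix p
  show "mero_normal V f p = f p"
  proof (cases "p \<in> points V")
    case True
    obtain D \<phi> where c: "(D, \<phi>) \<in> surf_charts V" "p \<in> D" using chart_cover[OF True] .
    have n: "(\<lambda>z. f (inv_into D \<phi> z)) nicely_meromorphic_on \<phi> ` D"
      using f c by (auto simp: meromorphic_functions_def)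
    have "remove_sings (\<lambda>z. f (inv_into D \<phi> z)) (\<phi> p) = f (inv_into D \<phi> (\<phi> p))"
      using n c(2) unfolding nicely_meromorphic_on_def
      by (metis (no_types, lifting) image_eqI remove_sings_at_pole remove_sings_eqI)
    then show ?thesis
      using mero_normal_chart[OF c(1), of "\<phi> p" f] c chart_inv(1)[OF c] by auto
  qed (use f in \<open>auto simp: mero_normal_def meromorphic_functions_def\<close>)
qed

lemma mero_normal_cong:
  assumes "\<And>p. p \<in> points V \<Longrightarrow> eventually (\<lambda>q. g q = h q) (atin (surf_top V) p)"
  shows "mero_normal V g = mero_normal V h"
proof
  fix p
  show "mero_normal V g p = mero_normal V h p"
  proof (cases "p \<in> points V")
    case True
    have "(g \<longlongrightarrow> c) (atin (surf_top V) p) \<longleftrightarrow> (h \<longlongrightarrow> c) (atin (surf_top V) p)" for c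
      by (rule filterlim_cong[OF refl refl assms[OF True]])
    then show ?thesis by (auto simp: mero_normal_def t2_space_class.Lim_def)
  qed (simp add: mero_normal_def)
qed

lemma mero_eqI:
  assumes "f \<in> meromorphic_functions V" "g \<in> meromorphic_functions V"
    and "\<And>p. p \<in> points V \<Longrightarrow> eventually (\<lambda>q. f q = g q) (atin (surf_top V) p)"
  shows "f = g"
  using mero_normal_cong[OF assms(3)] mero_value[OF assms(1)] mero_value[OF assms(2)] by simp

lemma mero_const_mem: "mero_const V c \<in> meromorphic_functions V"
proof -
  have "mero_normal V (\<lambda>p. c) = mero_const V c"
  proof
    fix p
    show "mero_normal V (\<lambda>p. c) p = mero_const V c p"
    proof (cases "p \<in> points V")
      case True
      obtain D \<phi> where c: "(D, \<phi>) \<in> surf_charts V" "p \<in> D" using chart_cover[OF True] .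
      have "remove_sings (\<lambda>z. c) (\<phi> p) = c" by (intro remove_sings_eqI tendsto_const)
      then show ?thesis using mero_normal_chart[OF c(1), of "\<phi> p" "\<lambda>_. c"] c chart_inv(1)[OF c] True
        by (simp add: mero_const_def)
    qed (simp add: mero_normal_def mero_const_def)
  qed
  then show ?thesis using mero_normal_mem[OF pre_mero_const, of c] by simp
qed

text \<open>
  The chain rule for a transition map.  The factor by which a derivative changes does not
  depend on the function and does not vanish, so it cancels in a quotient of two derivatives.
\<close>

lemma deriv_quotient_chart:
  assumes c: "(D, \<phi>) \<in> surf_charts V" "(D', \<phi>') \<in> surf_charts V" and z: "z \<in> \<phi> ` D" "inv_into D \<phi> z \<in> D'"
    and f: "(\<lambda>z. f (inv_into D \<phi> z)) analytic_on {z}"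
  shows "deriv (\<lambda>z. f (inv_into D' \<phi>' z)) (\<phi>' (inv_into D \<phi> z)) =
     deriv (\<lambda>z. f (inv_into D \<phi> z)) z * deriv (\<lambda>z. \<phi> (inv_into D' \<phi>' z)) (\<phi>' (inv_into D \<phi> z))"
    "deriv (\<lambda>z. \<phi> (inv_into D' \<phi>' z)) (\<phi>' (inv_into D \<phi> z)) \<noteq> 0"
proof -
  define p where "p = inv_into D \<phi> z"
  define z' where "z' = \<phi>' p"
  have p: "p \<in> D" "p \<in> D'" "\<phi> p = z" using z chart_inv[OF c(1)] by (auto simp: p_def)
  define T where "T = (\<lambda>z. \<phi> (inv_into D' \<phi>' z))"
  define T' where "T' = (\<lambda>z. \<phi>' (inv_into D \<phi> z))"
  have o: "open (\<phi>' ` (D' \<inter> D))" "open (\<phi> ` (D \<inter> D'))"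
    using chart_open_image[OF c(2) chart_homeo(1)[OF c(1)]] chart_open_image[OF c(1) chart_homeo(1)[OF c(2)]]
    by (auto simp: Int_commute)
  have m: "z' \<in> \<phi>' ` (D' \<inter> D)" "z \<in> \<phi> ` (D \<inter> D')" using p by (auto simp: z'_def)
  have Tz: "T z' = z" "T' z = z'" using p chart_inv[OF c(1)] chart_inv[OF c(2)]
    by (auto simp: T_def T'_def z'_def p_def)
  have dT: "(T has_field_derivative deriv T z') (at z')"
    using holomorphic_derivI[OF chart_transition[OF c(2,1)] o(1) m(1)] by (simp add: T_def)
  have dT': "(T' has_field_derivative deriv T' z) (at z)"
    using holomorphic_derivI[OF chart_transition[OF c(1,2)] o(2) m(2)] by (simp add: T'_def)
  have "((\<lambda>u. T' (T u)) has_field_derivative deriv T' z * deriv T z') (at z')"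
    using DERIV_chain2[of T' "deriv T' z" T z'] dT dT' Tz by simp
  moreover have "((\<lambda>u. T' (T u)) has_field_derivative 1) (at z')"
  proof (rule has_field_derivative_transform_within_open[OF DERIV_ident o(1) m(1)])
    fix u assume "u \<in> \<phi>' ` (D' \<inter> D)"
    then show "u = T' (T u)" using chart_inv[OF c(1)] chart_inv[OF c(2)] by (auto simp: T_def T'_def)
  qed
  ultimately have "deriv T' z * deriv T z' = 1" by (rule DERIV_unique)
  then have nz: "deriv T z' \<noteq> 0" by auto
  then show "deriv (\<lambda>z. \<phi> (inv_into D' \<phi>' z)) (\<phi>' (inv_into D \<phi> z)) \<noteq> 0" by (simp add: T_def z'_def p_def)
  have df: "((\<lambda>z. f (inv_into D \<phi> z)) has_field_derivative deriv (\<lambda>z. f (inv_into D \<phi> z)) z) (at z)"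
    using f by (simp add: analytic_at_imp_isCont analytic_on_imp_differentiable_at DERIV_deriv_iff_field_differentiable)
  have "((\<lambda>u. f (inv_into D \<phi> (T u))) has_field_derivative deriv (\<lambda>z. f (inv_into D \<phi> z)) z * deriv T z') (at z')"
    using DERIV_chain2[of "\<lambda>z. f (inv_into D \<phi> z)" "deriv (\<lambda>z. f (inv_into D \<phi> z)) z" T z'] df dT Tz by simp
  then have "((\<lambda>u. f (inv_into D' \<phi>' u)) has_field_derivative deriv (\<lambda>z. f (inv_into D \<phi> z)) z * deriv T z') (at z')"
  proof (rule has_field_derivative_transform_within_open[OF _ o(1) m(1)])
    fix u assume "u \<in> \<phi>' ` (D' \<inter> D)"
    then show "f (inv_into D \<phi> (T u)) = f (inv_into D' \<phi>' u)"
      using chart_inv[OF c(1)] chart_inv[OF c(2)] by (auto simp: T_def)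
  qed
  then show "deriv (\<lambda>z. f (inv_into D' \<phi>' z)) (\<phi>' (inv_into D \<phi> z)) =
     deriv (\<lambda>z. f (inv_into D \<phi> z)) z * deriv (\<lambda>z. \<phi> (inv_into D' \<phi>' z)) (\<phi>' (inv_into D \<phi> z))"
    unfolding T_def z'_def p_def by (rule DERIV_imp_deriv)
qed

text \<open>
  The derivation before normalization.
\<close>

definition chart_quotient :: "('a \<Rightarrow> complex) \<Rightarrow> ('a \<Rightarrow> complex) \<Rightarrow> 'a \<Rightarrow> complex" where
  "chart_quotient x f = (\<lambda>p. case chart_at V p of (D, \<phi>) \<Rightarrow>
     deriv (\<lambda>z. f (inv_into D \<phi> z)) (\<phi> p) / deriv (\<lambda>z. x (inv_into D \<phi> z)) (\<phi> p))"

lemma chart_quotient_eq: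
  assumes c: "(D, \<phi>) \<in> surf_charts V" and z: "z \<in> \<phi> ` D"
    and f: "(\<lambda>z. f (inv_into D \<phi> z)) analytic_on {z}" and x: "(\<lambda>z. x (inv_into D \<phi> z)) analytic_on {z}"
  shows "chart_quotient x f (inv_into D \<phi> z) =
     deriv (\<lambda>z. f (inv_into D \<phi> z)) z / deriv (\<lambda>z. x (inv_into D \<phi> z)) z"
proof -
  obtain D' \<phi>' where c': "chart_at V (inv_into D \<phi> z) = (D', \<phi>')" by (cases "chart_at V (inv_into D \<phi> z)")
  have p: "inv_into D \<phi> z \<in> points V" using chart_inv[OF c] z chart_homeo(2)[OF c] by auto
  have cc: "(D', \<phi>') \<in> surf_charts V" "inv_into D \<phi> z \<in> D'" using chart_at_props[OF p] c' by auto
  show ?thesis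
    using deriv_quotient_chart[OF c cc(1) z cc(2) f] deriv_quotient_chart(1)[OF c cc(1) z cc(2) x]
    by (simp add: chart_quotient_def c')
qed

lemma mero_deriv_eq: "mero_deriv V x f = mero_normal V (chart_quotient x f)"
  by (simp add: mero_deriv_def chart_quotient_def)

lemma pre_mero_chart_quotient:
  assumes f: "pre_mero V f" and x: "pre_mero V x"
  shows "pre_mero V (chart_quotient x f)"
  unfolding pre_mero_def
proof safe
  fix D \<phi> assume c: "(D, \<phi>) \<in> surf_charts V"
  let ?f = "\<lambda>z. f (inv_into D \<phi> z)" and ?x = "\<lambda>z. x (inv_into D \<phi> z)"
  have m: "?f meromorphic_on \<phi> ` D" "?x meromorphic_on \<phi> ` D" using f x c by (auto simp: pre_mero_def)
  have "(\<lambda>z. deriv ?f z / deriv ?x z) meromorphic_on \<phi> ` D"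
    using m by (intro meromorphic_intros)
  also have "?this \<longleftrightarrow> (\<lambda>z. chart_quotient x f (inv_into D \<phi> z)) meromorphic_on \<phi> ` D"
  proof (rule meromorphic_on_cong[OF _ refl])
    fix z assume z: "z \<in> \<phi> ` D"
    have "eventually (\<lambda>w. ?f analytic_on {w}) (at z)" "eventually (\<lambda>w. ?x analytic_on {w}) (at z)"
      using m z by (auto simp: meromorphic_on_altdef intro: isolated_singularity_at_altdef[THEN iffD1])
    moreover have "eventually (\<lambda>w. w \<in> \<phi> ` D) (at z)"
      using chart_homeo(3)[OF c] z by (rule eventually_at_in_open')
    ultimately show "eventually (\<lambda>w. deriv ?f w / deriv ?x w = chart_quotient x f (inv_into D \<phi> w)) (at z)"
      by eventually_elim (simp add: chart_quotient_eq[OF c])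
  qed
  finally show "(\<lambda>z. chart_quotient x f (inv_into D \<phi> z)) meromorphic_on \<phi> ` D" .
qed

lemma mero_deriv_mem:
  assumes "f \<in> meromorphic_functions V" "pre_mero V x"
  shows "mero_deriv V x f \<in> meromorphic_functions V"
  unfolding mero_deriv_eq by (intro mero_normal_mem pre_mero_chart_quotient mero_pre assms)

lemma eventually_eq_or_neq:
  assumes f: "f \<in> meromorphic_functions V" and g: "g \<in> meromorphic_functions V" and p: "p \<in> points V"
  shows "eventually (\<lambda>q. f q = g q) (atin (surf_top V) p) \<or> eventually (\<lambda>q. f q \<noteq> g q) (atin (surf_top V) p)"
proof -
  obtain D \<phi> where c: "(D, \<phi>) \<in> surf_charts V" "p \<in> D" using chart_cover[OF p] .
  have "(\<lambda>z. f (inv_into D \<phi> z) - g (inv_into D \<phi> z)) meromorphic_on {\<phi> p}"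
    using mero_pre[OF f] mero_pre[OF g] c
    by (intro meromorphic_intros) (auto simp: pre_mero_def intro: meromorphic_on_subset)
  then have "eventually (\<lambda>z. f (inv_into D \<phi> z) - g (inv_into D \<phi> z) = 0) (at (\<phi> p)) \<or>
      eventually (\<lambda>z. f (inv_into D \<phi> z) - g (inv_into D \<phi> z) \<noteq> 0) (at (\<phi> p))"
    using not_essential_frequently_0_imp_eventually_0[of "\<lambda>z. f (inv_into D \<phi> z) - g (inv_into D \<phi> z)" "\<phi> p"]
    by (auto simp: meromorphic_at_iff frequently_def)
  then show ?thesis unfolding eventually_atin_chart[OF c] by simp
qed

text \<open>
  Near each point two meromorphic functions either agree or are different, apart from the point
  itself.  Both alternatives define open sets, so by connectedness one of these sets is empty.
\<close>

theorem identity_principle: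
  assumes conn: "connected_space (surf_top V)"
    and f: "f \<in> meromorphic_functions V" and g: "g \<in> meromorphic_functions V"
    and p0: "p0 \<in> points V" and ev: "frequently (\<lambda>q. f q = g q) (atin (surf_top V) p0)"
  shows "f = g"
proof -
  define Z where "Z = {p \<in> points V. eventually (\<lambda>q. f q = g q) (atin (surf_top V) p)}"
  define Y where "Y = {p \<in> points V. eventually (\<lambda>q. f q \<noteq> g q) (atin (surf_top V) p)}"
  have haus: "Hausdorff_space (surf_top V)" using surf by (simp add: riemann_surface_def)
  have op: "openin (surf_top V) {p \<in> points V. eventually P (atin (surf_top V) p)}" for P
  proof (subst openin_subopen, intro ballI)
    fix p assume "p \<in> {p \<in> points V. eventually P (atin (surf_top V) p)}"
    then obtain A where A: "openin (surf_top V) A" "p \<in> A" "\<forall>q\<in>A - {p}. P q" and p: "p \<in> points V"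
      "eventually P (atin (surf_top V) p)"
      by (auto simp: eventually_atin)
    have "A \<subseteq> {p \<in> points V. eventually P (atin (surf_top V) p)}"
    proof
      fix q assume q: "q \<in> A"
      have o: "openin (surf_top V) (A - {p})"
        using A(1) closedin_Hausdorff_sing_eq[OF haus, of p] p(1) by (intro openin_diff) auto
      show "q \<in> {p \<in> points V. eventually P (atin (surf_top V) p)}"
      proof (cases "q = p")
        case False
        have "eventually P (atin (surf_top V) q)"
          unfolding eventually_atin using o q False A(3) by (intro disjI2 exI[of _ "A - {p}"]) auto
        then show ?thesis using q openin_subset[OF A(1)] by auto
      qed (use p in auto)
    qed
    then show "\<exists>T. openin (surf_top V) T \<and> p \<in> T \<and> T \<subseteq> {p \<in> points V. eventually P (atin (surf_top V) p)}"
      using A by blast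
  qed
  have "Z \<union> Y = points V" using eventually_eq_or_neq[OF f g] by (auto simp: Z_def Y_def)
  moreover have "Z \<inter> Y = {}"
  proof -
    have False if "p \<in> Z" "p \<in> Y" for p
    proof -
      have "eventually (\<lambda>q. f q = g q \<and> f q \<noteq> g q) (atin (surf_top V) p)"
        using that unfolding Z_def Y_def by (intro eventually_conj) auto
      then have "eventually (\<lambda>q. False) (atin (surf_top V) p)" by simp
      then show False using atin_neq_bot[of p] that by (simp add: Z_def eventually_False)
    qed
    then show ?thesis by blast
  qed
  moreover have "openin (surf_top V) Z" "openin (surf_top V) Y" unfolding Z_def Y_def by (rule op)+
  moreover have "p0 \<in> Z"
    using eventually_eq_or_neq[OF f g p0] ev p0 by (auto simp: Z_def frequently_def)
  ultimately have "Y = {}"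
    using conn unfolding connected_space_def by (metis empty_iff order_refl)
  then have "Z = points V" using \<open>Z \<union> Y = points V\<close> by simp
  then show ?thesis using mero_eqI[OF f g] unfolding Z_def by blast
qed

end

section \<open>Laurent expansion at a point as an embedding\<close>

text \<open>
  An injective map to a field that respects the operations transfers all field axioms, once the
  carrier contains negatives and inverses.  Direct proofs of, say, associativity for the normalized
  pointwise operations are thus avoided.
\<close>

lemma field_by_embedding:
  fixes R :: "('a, 'm) ring_scheme" and h :: "'a \<Rightarrow> 'k::field"
  assumes closed: "\<And>x y. x \<in> carrier R \<Longrightarrow> y \<in> carrier R \<Longrightarrow> x \<oplus>\<^bsub>R\<^esub> y \<in> carrier R"
    "\<And>x y. x \<in> carrier R \<Longrightarrow> y \<in> carrier R \<Longrightarrow> x \<otimes>\<^bsub>R\<^esub> y \<in> carrier R"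
    "\<zero>\<^bsub>R\<^esub> \<in> carrier R" "\<one>\<^bsub>R\<^esub> \<in> carrier R"
    and h: "\<And>x y. x \<in> carrier R \<Longrightarrow> y \<in> carrier R \<Longrightarrow> h (x \<oplus>\<^bsub>R\<^esub> y) = h x + h y"
    "\<And>x y. x \<in> carrier R \<Longrightarrow> y \<in> carrier R \<Longrightarrow> h (x \<otimes>\<^bsub>R\<^esub> y) = h x * h y"
    "h \<zero>\<^bsub>R\<^esub> = 0" "h \<one>\<^bsub>R\<^esub> = 1"
    and inj: "inj_on h (carrier R)"
    and neg: "\<And>x. x \<in> carrier R \<Longrightarrow> \<exists>y\<in>carrier R. h y = - h x"
    and inv: "\<And>x. x \<in> carrier R \<Longrightarrow> \<exists>y\<in>carrier R. h y = inverse (h x)"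
  shows "Ring.field R"
proof -
  have eqI: "x = y" if "h x = h y" "x \<in> carrier R" "y \<in> carrier R" for x y
    using inj that by (meson inj_onD)
  have "cring R"
  proof (rule cringI)
    show "abelian_group R"
    proof (rule abelian_groupI)
      fix x assume "x \<in> carrier R"
      then obtain y where "y \<in> carrier R" "h y = - h x" using neg by blast
      then show "\<exists>y\<in>carrier R. y \<oplus>\<^bsub>R\<^esub> x = \<zero>\<^bsub>R\<^esub>"
        using \<open>x \<in> carrier R\<close> by (intro bexI[of _ y] eqI) (auto simp: h closed)
    qed (auto intro!: eqI simp: h closed algebra_simps)
    show "Group.comm_monoid R"
      by (rule comm_monoidI) (auto intro!: eqI simp: h closed algebra_simps)
  qed (auto intro!: eqI simp: h closed algebra_simps)
  moreover have "Units R = carrier R - {\<zero>\<^bsub>R\<^esub>}"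
  proof safe
    show "x \<in> carrier R" if "x \<in> Units R" for x using that by (auto simp: Units_def)
    show False if u: "\<zero>\<^bsub>R\<^esub> \<in> Units R"
    proof -
      obtain y where "y \<in> carrier R" "y \<otimes>\<^bsub>R\<^esub> \<zero>\<^bsub>R\<^esub> = \<one>\<^bsub>R\<^esub>" using u by (auto simp: Units_def)
      then have "h y * 0 = 1" using h closed by metis
      then show False by simp
    qed
    fix x assume x: "x \<in> carrier R" "x \<notin> Units R"
    show "x = \<zero>\<^bsub>R\<^esub>"
    proof (rule ccontr)
      assume "x \<noteq> \<zero>\<^bsub>R\<^esub>"
      then have "h x \<noteq> 0" using eqI[of x "\<zero>\<^bsub>R\<^esub>"] h(3) x closed by auto
      moreover obtain y where "y \<in> carrier R" "h y = inverse (h x)" using inv x by blast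
      ultimately have "x \<in> Units R"
        unfolding Units_def using x by (intro CollectI conjI bexI[of _ y] eqI) (auto simp: h closed)
      then show False using x by simp
    qed
  qed
  ultimately show ?thesis by (rule cring.cring_fieldI)
qed

text \<open>
  A local parametrization in which x becomes a translation, so that d/dx becomes the ordinary
  derivative.
\<close>

definition local_coordinate :: "'a surface \<Rightarrow> ('a \<Rightarrow> complex) \<Rightarrow> (complex \<Rightarrow> 'a) \<Rightarrow> real \<Rightarrow> bool" where
  "local_coordinate V x \<tau> r \<longleftrightarrow> r > 0 \<and>
     continuous_map (top_of_set (ball 0 r)) (surf_top V) \<tau> \<and>
     (\<forall>(D, \<phi>) \<in> surf_charts V. (\<lambda>w. \<phi> (\<tau> w)) holomorphic_on {w \<in> ball 0 r. \<tau> w \<in> D}) \<and>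
     (\<exists>c. \<forall>w \<in> ball 0 r. x (\<tau> w) = c + w)"

lemma local_coordinateI:
  assumes "r > 0" "continuous_map (top_of_set (ball 0 r)) (surf_top V) \<tau>"
    "\<And>D \<phi>. (D, \<phi>) \<in> surf_charts V \<Longrightarrow> (\<lambda>w. \<phi> (\<tau> w)) holomorphic_on {w \<in> ball 0 r. \<tau> w \<in> D}"
    "\<And>w. w \<in> ball 0 r \<Longrightarrow> x (\<tau> w) = c + w"
  shows "local_coordinate V x \<tau> r"
  using assms by (auto simp: local_coordinate_def)

definition expand :: "(complex \<Rightarrow> 'a) \<Rightarrow> ('a \<Rightarrow> complex) \<Rightarrow> complex fls" where
  "expand \<tau> f = laurent_expansion (\<lambda>w. f (\<tau> w)) 0"

locale coord = surf V for V :: "'a surface" +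
  fixes x :: "'a \<Rightarrow> complex" and \<tau> :: "complex \<Rightarrow> 'a" and r :: real
  assumes conn: "connected_space (surf_top V)"
    and x: "pre_mero V x"
    and lc: "local_coordinate V x \<tau> r"
begin

lemma r: "r > 0" and cont: "continuous_map (top_of_set (ball 0 r)) (surf_top V) \<tau>"
  using lc by (auto simp: local_coordinate_def)

lemma hol: "(D, \<phi>) \<in> surf_charts V \<Longrightarrow> (\<lambda>w. \<phi> (\<tau> w)) holomorphic_on {w \<in> ball 0 r. \<tau> w \<in> D}"
  using lc by (auto simp: local_coordinate_def)

lemma in_points: "w \<in> ball 0 r \<Longrightarrow> \<tau> w \<in> points V"
  using continuous_map_funspace[OF cont] by auto

lemma open_vimage:
  assumes "openin (surf_top V) A" shows "open {w \<in> ball 0 r. \<tau> w \<in> A}"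
proof -
  have "openin (top_of_set (ball 0 r)) {w \<in> ball 0 r. \<tau> w \<in> A}"
    using cont assms unfolding continuous_map_def by auto
  then show ?thesis by (rule openin_open_trans) auto
qed

lemma inj: "inj_on \<tau> (ball 0 r)"
proof (rule inj_onI)
  obtain c where "\<forall>w \<in> ball 0 r. x (\<tau> w) = c + w" using lc unfolding local_coordinate_def by blast
  then show "w = w'" if "w \<in> ball 0 r" "w' \<in> ball 0 r" "\<tau> w = \<tau> w'" for w w'
    using that by (metis add_left_cancel)
qed

lemma eventually_along:
  assumes "eventually P (atin (surf_top V) (\<tau> 0))"
  shows "eventually (\<lambda>w. P (\<tau> w)) (at 0)"
proof -
  obtain A where A: "openin (surf_top V) A" "\<tau> 0 \<in> A" "\<forall>q\<in>A - {\<tau> 0}. P q"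
    using assms in_points[of 0] r by (auto simp: eventually_atin)
  have "eventually (\<lambda>w. w \<in> {w \<in> ball 0 r. \<tau> w \<in> A} - {0}) (at 0)"
    using open_vimage[OF A(1)] A(2) r by (intro eventually_at_in_open) auto
  then show ?thesis
  proof eventually_elim
    case (elim w)
    then have "\<tau> w \<noteq> \<tau> 0" using inj_onD[OF inj, of w 0] r by auto
    then show ?case using A(3) elim by auto
  qed
qed

lemma chart0: obtains D \<phi> where "(D, \<phi>) \<in> surf_charts V" "\<tau> 0 \<in> D"
  using chart_cover[OF in_points[of 0]] r by auto

lemma meromorphic_along:
  assumes "pre_mero V h" shows "(\<lambda>w. h (\<tau> w)) meromorphic_on {0}"
proof -
  obtain D \<phi> where c: "(D, \<phi>) \<in> surf_charts V" "\<tau> 0 \<in> D" by (rule chart0)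
  define B where "B = {w \<in> ball 0 r. \<tau> w \<in> D}"
  have B: "open B" "0 \<in> B" using open_vimage[OF chart_homeo(1)[OF c(1)]] c(2) r by (auto simp: B_def)
  have "(\<lambda>w. \<phi> (\<tau> w)) analytic_on {0}"
    using hol[OF c(1)] B by (auto simp: analytic_at B_def)
  moreover have "(\<lambda>z. h (inv_into D \<phi> z)) meromorphic_on \<phi> ` D" using assms c by (auto simp: pre_mero_def)
  ultimately have "(\<lambda>w. h (inv_into D \<phi> (\<phi> (\<tau> w)))) meromorphic_on {0}"
    using c(2) by (intro meromorphic_on_compose[where f = "\<lambda>w. \<phi> (\<tau> w)"]) auto
  moreover have "eventually (\<lambda>w. h (inv_into D \<phi> (\<phi> (\<tau> w))) = h (\<tau> w)) (at 0)"
    using eventually_at_in_open'[OF B] by eventually_elim (simp add: B_def chart_inv[OF c(1)])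
  ultimately show ?thesis by (subst (asm) meromorphic_on_cong) auto
qed

lemma has_expansion:
  assumes "pre_mero V h" shows "(\<lambda>w. h (\<tau> w)) has_laurent_expansion expand \<tau> h"
  using meromorphic_on_imp_has_laurent_expansion[OF meromorphic_along[OF assms], of 0]
  by (simp add: expand_def)

lemma expand_cong:
  "eventually (\<lambda>q. f q = g q) (atin (surf_top V) (\<tau> 0)) \<Longrightarrow> expand \<tau> f = expand \<tau> g"
  unfolding expand_def by (intro laurent_expansion_cong eventually_along refl)

lemma expand_normal: "pre_mero V h \<Longrightarrow> expand \<tau> (mero_normal V h) = expand \<tau> h"
  using in_points[of 0] r by (intro expand_cong mero_normal_eventually) auto

lemma expandI: "(\<lambda>w. h (\<tau> w)) has_laurent_expansion F \<Longrightarrow> expand \<tau> h = F"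
  unfolding expand_def by (rule laurent_expansion_0_eqI)

lemma expand_const: "expand \<tau> (mero_const V c) = fls_const c"
proof -
  have "expand \<tau> (mero_const V c) = expand \<tau> (\<lambda>_. c)"
    unfolding expand_def
  proof (rule laurent_expansion_cong[OF _ refl])
    have "eventually (\<lambda>w. w \<in> ball 0 r) (at 0)" using r by (intro eventually_at_in_open') auto
    then show "eventually (\<lambda>w. mero_const V c (\<tau> w) = c) (at 0)"
      by eventually_elim (use in_points in \<open>auto simp: mero_const_def\<close>)
  qed
  also have "\<dots> = fls_const c" by (rule expandI) auto
  finally show ?thesis .
qed

text \<open>
  By the identity principle a meromorphic function on a connected surface is determined by its
  expansion at a single point.
\<close>

lemma expand_eqD:
  assumes f: "f \<in> meromorphic_functions V" and g: "g \<in> meromorphic_functions V" and e: "expand \<tau> f = expand \<tau> g"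
  shows "f = g"
proof -
  have p0: "\<tau> 0 \<in> points V" using in_points[of 0] r by simp
  have "(\<lambda>w. f (\<tau> w) - g (\<tau> w)) has_laurent_expansion expand \<tau> f - expand \<tau> g"
    using f g by (intro laurent_expansion_intros has_expansion mero_pre)
  then have "eventually (\<lambda>w. f (\<tau> w) - g (\<tau> w) = 0) (at 0)"
    using has_laurent_expansion_eventually_zero_iff[of "\<lambda>w. f (\<tau> w) - g (\<tau> w)" 0 0] e by simp
  then have ev: "eventually (\<lambda>w. f (\<tau> w) = g (\<tau> w)) (at 0)" by simp
  have "frequently (\<lambda>q. f q = g q) (atin (surf_top V) (\<tau> 0))"
    unfolding frequently_def
  proof
    assume "eventually (\<lambda>q. f q \<noteq> g q) (atin (surf_top V) (\<tau> 0))"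
    from eventually_along[OF this] ev have "eventually (\<lambda>w. False) (at (0::complex))"
      by eventually_elim simp
    then show False by simp
  qed
  from identity_principle[OF conn f g p0 this] show ?thesis .
qed

lemma expand_ops:
  assumes f: "f \<in> meromorphic_functions V" and g: "g \<in> meromorphic_functions V"
  shows "expand \<tau> (mero_normal V (\<lambda>p. f p + g p)) = expand \<tau> f + expand \<tau> g"
    "expand \<tau> (mero_normal V (\<lambda>p. f p * g p)) = expand \<tau> f * expand \<tau> g"
    "expand \<tau> (mero_normal V (\<lambda>p. - f p)) = - expand \<tau> f"
    "expand \<tau> (mero_normal V (\<lambda>p. inverse (f p))) = inverse (expand \<tau> f)"
  using mero_pre[OF f] mero_pre[OF g]
  by (auto intro!: expandI laurent_expansion_intros has_expansion simp: expand_normal pre_mero_ops)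

lemma carrier_mero: "carrier (mero_field V) = meromorphic_functions V"
  and zero_mero: "\<zero>\<^bsub>mero_field V\<^esub> = mero_const V 0" and one_mero: "\<one>\<^bsub>mero_field V\<^esub> = mero_const V 1"
  and add_mero: "f \<oplus>\<^bsub>mero_field V\<^esub> g = mero_normal V (\<lambda>p. f p + g p)"
  and mult_mero: "f \<otimes>\<^bsub>mero_field V\<^esub> g = mero_normal V (\<lambda>p. f p * g p)"
  by (auto simp: mero_field_def)

lemma expand_hom:
  "f \<in> carrier (mero_field V) \<Longrightarrow> g \<in> carrier (mero_field V) \<Longrightarrow>
    expand \<tau> (f \<oplus>\<^bsub>mero_field V\<^esub> g) = expand \<tau> f + expand \<tau> g"
  "f \<in> carrier (mero_field V) \<Longrightarrow> g \<in> carrier (mero_field V) \<Longrightarrow>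
    expand \<tau> (f \<otimes>\<^bsub>mero_field V\<^esub> g) = expand \<tau> f * expand \<tau> g"
  "expand \<tau> \<zero>\<^bsub>mero_field V\<^esub> = 0" "expand \<tau> \<one>\<^bsub>mero_field V\<^esub> = 1"
  by (simp_all add: carrier_mero zero_mero one_mero add_mero mult_mero expand_ops expand_const)

lemma inj_expand: "inj_on (expand \<tau>) (carrier (mero_field V))"
  using expand_eqD by (auto simp: inj_on_def carrier_mero)

text \<open>
  The embedding by Laurent expansion needs a local coordinate for some x, which makes this a
  fact about surfaces that carry one.
\<close>

lemma field_mero: "Ring.field (mero_field V)"
proof (rule field_by_embedding[OF _ _ _ _ expand_hom inj_expand])
  fix f assume f: "f \<in> carrier (mero_field V)"
  then have f': "f \<in> meromorphic_functions V" by (simp add: carrier_mero)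
  show "\<exists>g\<in>carrier (mero_field V). expand \<tau> g = - expand \<tau> f"
    using expand_ops(3)[OF f' f'] mero_normal_mem[OF pre_mero_ops(3)[OF mero_pre[OF f'] mero_pre[OF f']]]
    by (auto simp: carrier_mero)
  show "\<exists>g\<in>carrier (mero_field V). expand \<tau> g = inverse (expand \<tau> f)"
    using expand_ops(4)[OF f' f'] mero_normal_mem[OF pre_mero_ops(4)[OF mero_pre[OF f'] mero_pre[OF f']]]
    by (auto simp: carrier_mero)
  fix g assume "g \<in> carrier (mero_field V)"
  then have g': "g \<in> meromorphic_functions V" by (simp add: carrier_mero)
  show "f \<oplus>\<^bsub>mero_field V\<^esub> g \<in> carrier (mero_field V)" "f \<otimes>\<^bsub>mero_field V\<^esub> g \<in> carrier (mero_field V)"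
    using mero_normal_mem pre_mero_ops(1,2)[OF mero_pre[OF f'] mero_pre[OF g']]
    by (auto simp: carrier_mero add_mero mult_mero)
qed (auto simp: carrier_mero zero_mero one_mero mero_const_mem)

text \<open>
  In a chart, the derivation is the quotient of the derivatives of f and x; along the
  parametrization \<tau> both acquire the derivative of the chart coordinate as a factor, and the
  derivative of x is 1.
\<close>

lemma expand_deriv:
  assumes f: "f \<in> meromorphic_functions V"
  shows "expand \<tau> (mero_deriv V x f) = fls_deriv (expand \<tau> f)"
proof -
  note pf = mero_pre[OF f] and px = x
  obtain D \<phi> where c: "(D, \<phi>) \<in> surf_charts V" "\<tau> 0 \<in> D" by (rule chart0)
  let ?f = "\<lambda>z. f (inv_into D \<phi> z)" and ?x = "\<lambda>z. x (inv_into D \<phi> z)"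
  define B where "B = {w \<in> ball 0 r. \<tau> w \<in> D}"
  have B: "open B" "0 \<in> B" using open_vimage[OF chart_homeo(1)[OF c(1)]] c(2) r by (auto simp: B_def)
  define T where "T = (\<lambda>w. \<phi> (\<tau> w))"
  obtain a where a: "\<And>w. w \<in> ball 0 r \<Longrightarrow> x (\<tau> w) = a + w" using lc unfolding local_coordinate_def by blast
  have ev: "eventually (\<lambda>w. (\<lambda>z. g (inv_into D \<phi> z)) analytic_on {w}) (at (\<phi> (\<tau> 0)))" if "pre_mero V g" for g
  proof -
    have "(\<lambda>z. g (inv_into D \<phi> z)) meromorphic_on \<phi> ` D" using that c by (auto simp: pre_mero_def)
    then show ?thesis using c(2) by (simp add: meromorphic_on_altdef isolated_singularity_at_altdef)
  qed
  have ana: "eventually (\<lambda>w. (\<lambda>z. g (inv_into D \<phi> z)) analytic_on {T w}) (at 0)" if "pre_mero V g" for g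
  proof -
    have "eventually (\<lambda>w. (\<lambda>z. g (inv_into D \<phi> z)) analytic_on {w} \<and> w \<in> \<phi> ` D) (at (\<phi> (\<tau> 0)))"
      using ev[OF that] eventually_at_in_open'[OF chart_homeo(3)[OF c(1)], of "\<phi> (\<tau> 0)"] c(2)
      by (intro eventually_conj) auto
    then have "eventually (\<lambda>w. (\<lambda>z. g (inv_into D \<phi> z)) analytic_on {\<phi> (inv_into D \<phi> w)}) (at (\<phi> (\<tau> 0)))"
      by eventually_elim (simp add: chart_inv[OF c(1)])
    then have "eventually (\<lambda>q. (\<lambda>z. g (inv_into D \<phi> z)) analytic_on {\<phi> q}) (atin (surf_top V) (\<tau> 0))"
      unfolding eventually_atin_chart[OF c] .
    from eventually_along[OF this] show ?thesis by (simp add: T_def)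
  qed
  have "eventually (\<lambda>w. chart_quotient x f (\<tau> w) = deriv (\<lambda>w. f (\<tau> w)) w) (at 0)"
    using ana[OF pf] ana[OF px] eventually_at_in_open'[OF B]
  proof eventually_elim
    case (elim w)
    have w: "w \<in> ball 0 r" "\<tau> w \<in> D" using elim(3) by (auto simp: B_def)
    have dT: "(T has_field_derivative deriv T w) (at w)"
      using holomorphic_derivI[OF hol[OF c(1)] B(1)[unfolded B_def]] elim(3) by (simp add: T_def B_def)
    have ch: "deriv (\<lambda>w. g (\<tau> w)) w = deriv (\<lambda>z. g (inv_into D \<phi> z)) (T w) * deriv T w"
      if "(\<lambda>z. g (inv_into D \<phi> z)) analytic_on {T w}" for g
    proof -
      have "((\<lambda>z. g (inv_into D \<phi> z)) has_field_derivative deriv (\<lambda>z. g (inv_into D \<phi> z)) (T w)) (at (T w))"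
        using that by (simp add: analytic_on_imp_differentiable_at DERIV_deriv_iff_field_differentiable)
      from DERIV_chain2[OF this dT]
      have "((\<lambda>w. g (\<tau> w)) has_field_derivative deriv (\<lambda>z. g (inv_into D \<phi> z)) (T w) * deriv T w) (at w)"
        by (rule has_field_derivative_transform_within_open[OF _ B(1) elim(3)])
          (auto simp: B_def T_def chart_inv[OF c(1)])
      then show ?thesis by (rule DERIV_imp_deriv)
    qed
    have "((\<lambda>w. x (\<tau> w)) has_field_derivative 1) (at w)"
      by (rule has_field_derivative_transform_within_open[OF _ open_ball w(1), of "\<lambda>w. a + w"])
        (auto simp: a intro!: derivative_eq_intros)
    then have one: "deriv ?x (T w) * deriv T w = 1" using ch[OF elim(2)] DERIV_imp_deriv by metis
    have "chart_quotient x f (inv_into D \<phi> (T w)) = deriv ?f (T w) / deriv ?x (T w)"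
      using elim(1,2) w(2) by (intro chart_quotient_eq[OF c(1)]) (auto simp: T_def)
    also have "\<dots> = deriv ?f (T w) * (deriv ?x (T w) * deriv T w) / deriv ?x (T w)" unfolding one by simp
    also have "\<dots> = deriv ?f (T w) * deriv T w"
    proof -
      have "deriv ?x (T w) \<noteq> 0" using one by (metis mult_zero_left zero_neq_one)
      then show ?thesis by simp
    qed
    finally show ?case using ch[OF elim(1)] w(2) by (simp add: T_def chart_inv[OF c(1)])
  qed
  then have "expand \<tau> (chart_quotient x f) = laurent_expansion (deriv (\<lambda>w. f (\<tau> w))) 0"
    unfolding expand_def by (rule laurent_expansion_cong[OF _ refl])
  also have "\<dots> = fls_deriv (expand \<tau> f)"
    by (intro laurent_expansion_0_eqI has_laurent_expansion_deriv has_expansion pf)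
  finally show ?thesis
    using expand_normal[OF pre_mero_chart_quotient[OF pf px]] by (simp add: mero_deriv_eq)
qed

lemma expand_funpow_deriv:
  assumes f: "f \<in> meromorphic_functions V"
  shows "(mero_deriv V x ^^ k) f \<in> meromorphic_functions V \<and>
    expand \<tau> ((mero_deriv V x ^^ k) f) = (fls_deriv ^^ k) (expand \<tau> f)"
proof (induction k)
  case (Suc k)
  then show ?case using mero_deriv_mem[OF conjunct1[OF Suc] x] expand_deriv[OF conjunct1[OF Suc]] by simp
qed (simp add: f)

lemma expand_finsum:
  assumes "finite I" "\<And>i. i \<in> I \<Longrightarrow> f i \<in> carrier (mero_field V)"
  shows "(\<Oplus>\<^bsub>mero_field V\<^esub> i \<in> I. f i) \<in> carrier (mero_field V) \<and>
    expand \<tau> (\<Oplus>\<^bsub>mero_field V\<^esub> i \<in> I. f i) = (\<Sum>i\<in>I. expand \<tau> (f i))"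
proof -
  interpret field "mero_field V" by (rule field_mero)
  show ?thesis
    using assms by (induction I rule: finite_induct) (auto simp: expand_hom Pi_def)
qed

text \<open>
  Expansion at one point decides whether a function solves the equation.
\<close>

lemma linear_ode_solution_iff:
  assumes a: "\<And>i. i \<in> {1..n} \<Longrightarrow> a i \<in> meromorphic_functions V" and y: "y \<in> meromorphic_functions V"
  shows "linear_ode_solution V x n a y \<longleftrightarrow>
    (fls_deriv ^^ n) (expand \<tau> y) + (\<Sum>i=1..n. expand \<tau> (a i) * (fls_deriv ^^ (n - i)) (expand \<tau> y)) = 0"
proof -
  interpret field "mero_field V" by (rule field_mero)
  let ?t = "\<lambda>i. a i \<otimes>\<^bsub>mero_field V\<^esub> (mero_deriv V x ^^ (n - i)) y"
  have d: "(mero_deriv V x ^^ k) y \<in> carrier (mero_field V)" for k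
    using expand_funpow_deriv[OF y] by (simp add: carrier_mero)
  have t: "?t i \<in> carrier (mero_field V)" if "i \<in> {1..n}" for i
    using a[OF that] d by (intro m_closed) (auto simp: carrier_mero)
  let ?s = "(mero_deriv V x ^^ n) y \<oplus>\<^bsub>mero_field V\<^esub> (\<Oplus>\<^bsub>mero_field V\<^esub> i \<in> {1..n}. ?t i)"
  have fs: "(\<Oplus>\<^bsub>mero_field V\<^esub> i \<in> {1..n}. ?t i) \<in> carrier (mero_field V)"
    "expand \<tau> (\<Oplus>\<^bsub>mero_field V\<^esub> i \<in> {1..n}. ?t i) = (\<Sum>i=1..n. expand \<tau> (?t i))"
    using expand_finsum[of "{1..n}" ?t] t by auto
  have "expand \<tau> ?s = (fls_deriv ^^ n) (expand \<tau> y) + (\<Sum>i=1..n. expand \<tau> (?t i))"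
    using expand_hom(1)[OF d fs(1)] fs(2) expand_funpow_deriv[OF y] by simp
  also have "(\<Sum>i=1..n. expand \<tau> (?t i)) = (\<Sum>i=1..n. expand \<tau> (a i) * (fls_deriv ^^ (n - i)) (expand \<tau> y))"
    using expand_hom(2)[OF _ d] a expand_funpow_deriv[OF y] by (intro sum.cong refl) (simp add: carrier_mero)
  finally have e: "expand \<tau> ?s = (fls_deriv ^^ n) (expand \<tau> y)
      + (\<Sum>i=1..n. expand \<tau> (a i) * (fls_deriv ^^ (n - i)) (expand \<tau> y))" .
  have s: "?s \<in> carrier (mero_field V)" using d fs(1) by simp
  have "?s = \<zero>\<^bsub>mero_field V\<^esub> \<longleftrightarrow> expand \<tau> ?s = 0"
    using expand_hom(3) inj_onD[OF inj_expand _ s zero_closed] by auto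
  then show ?thesis unfolding e using y by (simp add: linear_ode_solution_def)
qed

lemma subfld_expand:
  assumes K: "subfield K (mero_field V)" shows "subfld (expand \<tau> ` K)"
proof -
  interpret field "mero_field V" by (rule field_mero)
  note s = subringE[OF subfieldE(1)[OF K]]
  have KC: "f \<in> carrier (mero_field V)" if "f \<in> K" for f using s(1) that by auto
  show ?thesis
    unfolding subfld_def
  proof (intro conjI ballI)
    show "0 \<in> expand \<tau> ` K" "1 \<in> expand \<tau> ` K" using s(2,3) expand_hom(3,4) by (metis image_eqI)+
    fix F assume "F \<in> expand \<tau> ` K"
    then obtain f where f: "f \<in> K" "F = expand \<tau> f" by auto
    have "0 = expand \<tau> (f \<oplus>\<^bsub>mero_field V\<^esub> \<ominus>\<^bsub>mero_field V\<^esub> f)"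
      using KC[OF f(1)] expand_hom(3) by (simp add: r_neg)
    also have "\<dots> = F + expand \<tau> (\<ominus>\<^bsub>mero_field V\<^esub> f)" using expand_hom(1) KC f s(5) by simp
    finally have "- F = expand \<tau> (\<ominus>\<^bsub>mero_field V\<^esub> f)" by (metis add.inverse_unique)
    then show "- F \<in> expand \<tau> ` K" using s(5) f by auto
    show "inverse F \<in> expand \<tau> ` K"
    proof (cases "f = \<zero>\<^bsub>mero_field V\<^esub>")
      case True
      then show ?thesis using f expand_hom(3) by auto
    next
      case False
      then have i: "inv\<^bsub>mero_field V\<^esub> f \<in> K" "f \<otimes>\<^bsub>mero_field V\<^esub> inv\<^bsub>mero_field V\<^esub> f = \<one>\<^bsub>mero_field V\<^esub>"
        using subfield_m_inv[OF K, of f] f by auto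
      then have "F * expand \<tau> (inv\<^bsub>mero_field V\<^esub> f) = 1"
        using expand_hom(2)[of f "inv\<^bsub>mero_field V\<^esub> f"] expand_hom(4) KC f by simp
      then have "inverse F = expand \<tau> (inv\<^bsub>mero_field V\<^esub> f)" by (rule inverse_unique)
      then show ?thesis using i by auto
    qed
    fix G assume "G \<in> expand \<tau> ` K"
    then obtain g where g: "g \<in> K" "G = expand \<tau> g" by auto
    show "F + G \<in> expand \<tau> ` K" "F * G \<in> expand \<tau> ` K"
      using f g s(6,7) expand_hom(1,2)[of f g] KC by (metis image_eqI)+
  qed
qed

lemma subfield_vimage:
  assumes L: "subfld L"
  shows "subfield {f \<in> carrier (mero_field V). expand \<tau> f \<in> L} (mero_field V)"
proof -
  interpret field "mero_field V" by (rule field_mero)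
  have neg: "expand \<tau> (\<ominus>\<^bsub>mero_field V\<^esub> f) = - expand \<tau> f" if "f \<in> carrier (mero_field V)" for f
    using expand_hom(1)[of f "\<ominus>\<^bsub>mero_field V\<^esub> f"] that expand_hom(3) by (simp add: r_neg add.inverse_unique)
  have inv: "expand \<tau> (inv\<^bsub>mero_field V\<^esub> f) = inverse (expand \<tau> f)" "inv\<^bsub>mero_field V\<^esub> f \<in> carrier (mero_field V)"
    if "f \<in> carrier (mero_field V)" "f \<noteq> \<zero>\<^bsub>mero_field V\<^esub>" for f
  proof -
    have u: "f \<in> Units (mero_field V)" using that by (simp add: field_Units)
    then show "inv\<^bsub>mero_field V\<^esub> f \<in> carrier (mero_field V)" by (rule Units_inv_closed)
    then show "expand \<tau> (inv\<^bsub>mero_field V\<^esub> f) = inverse (expand \<tau> f)"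
      using expand_hom(2)[of f "inv\<^bsub>mero_field V\<^esub> f"] Units_r_inv[OF u] expand_hom(4) that(1)
      by (simp add: inverse_unique)
  qed
  show ?thesis
    by (rule subfieldI', rule subringI)
      (use subfldD[OF L] in \<open>auto simp: expand_hom neg inv\<close>)
qed

text \<open>
  This gives upper bounds for fields generated by functions: it suffices to bound expansions.
\<close>

lemma differential_subfield_vimage:
  assumes "subfld L" "\<And>f. f \<in> L \<Longrightarrow> fls_deriv f \<in> L"
  shows "differential_subfield V x {f \<in> carrier (mero_field V). expand \<tau> f \<in> L}"
  using subfield_vimage[OF assms(1)] assms(2) x
  by (auto simp: differential_subfield_def carrier_mero expand_deriv mero_deriv_mem)

lemma algebraic_over_imp_alg_over:
  assumes "algebraic_over V K f" "subfld L" "K \<subseteq> carrier (mero_field V)" "expand \<tau> ` K \<subseteq> L"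
  shows "alg_over L (expand \<tau> f)"
proof -
  interpret field "mero_field V" by (rule field_mero)
  let ?M = "{f \<in> carrier (mero_field V). expand \<tau> f \<in> L}"
  have f: "f \<in> carrier (mero_field V)" "(algebraic over K) f" using assms(1) by (auto simp: algebraic_over_def carrier_mero)
  have alg: "(algebraic over ?M) f" by (rule algebraic_mono[OF _ f(2)]) (use assms(3,4) in auto)
  have "alg_over (expand \<tau> ` ?M) (expand \<tau> f)"
    by (rule algebraic_imp_alg_over[OF expand_hom inj_expand f(1) subfieldE(1)[OF subfield_vimage[OF assms(2)]] alg])
  then obtain p where p: "p \<in> polys_over (expand \<tau> ` ?M)" "p \<noteq> 0" "poly p (expand \<tau> f) = 0"
    by (auto simp: alg_over_def)
  have "expand \<tau> ` ?M \<subseteq> L" by auto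
  then have "p \<in> polys_over L" using p(1) unfolding polys_over_def by blast
  then show ?thesis using p(2,3) by (auto simp: alg_over_def)
qed

lemma alg_over_imp_algebraic_over:
  assumes "f \<in> meromorphic_functions V" "K \<subseteq> meromorphic_functions V" "alg_over (expand \<tau> ` K) (expand \<tau> f)"
  shows "algebraic_over V K f"
proof -
  interpret field "mero_field V" by (rule field_mero)
  have "(algebraic over K) f"
    by (rule alg_over_imp_algebraic[OF expand_hom inj_expand])
      (use assms in \<open>auto simp: carrier_mero\<close>)
  then show ?thesis using assms(1) by (simp add: algebraic_over_def)
qed

lemma filterlim_along:
  assumes "filterlim f F (atin (surf_top V) (\<tau> 0))" shows "filterlim (\<lambda>w. f (\<tau> w)) F (at 0)"
  using assms eventually_along unfolding filterlim_iff by blast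

text \<open>
  The same parametrization serves for expansion at all points of its range.
\<close>

lemma local_coordinate_shift:
  assumes q: "q \<in> ball 0 r"
  shows "local_coordinate V x (\<lambda>w. \<tau> (q + w)) (r - norm q)"
proof -
  have sub: "q + w \<in> ball 0 r" if "w \<in> ball 0 (r - norm q)" for w
    using that norm_triangle_ineq[of q w] by simp
  obtain c where c: "\<And>w. w \<in> ball 0 r \<Longrightarrow> x (\<tau> w) = c + w" using lc unfolding local_coordinate_def by blast
  show ?thesis
  proof (rule local_coordinateI)
    show "r - norm q > 0" using q by simp
    have "continuous_map (top_of_set (ball 0 (r - norm q))) (top_of_set (ball 0 r)) (\<lambda>w. q + w)"
      using sub by (auto intro!: continuous_intros)
    from continuous_map_compose[OF this cont]
    show "continuous_map (top_of_set (ball 0 (r - norm q))) (surf_top V) (\<lambda>w. \<tau> (q + w))" by (simp add: o_def)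
    show "x (\<tau> (q + w)) = (c + q) + w" if "w \<in> ball 0 (r - norm q)" for w
      using c[OF sub[OF that]] by (simp add: add.assoc)
    fix D \<phi> assume c: "(D, \<phi>) \<in> surf_charts V"
    have "(\<lambda>w. \<phi> (\<tau> w)) \<circ> (\<lambda>w. q + w) holomorphic_on {w \<in> ball 0 (r - norm q). \<tau> (q + w) \<in> D}"
      by (rule holomorphic_on_compose_gen[OF _ hol[OF c]]) (use sub in \<open>auto intro!: holomorphic_intros\<close>)
    then show "(\<lambda>w. \<phi> (\<tau> (q + w))) holomorphic_on {w \<in> ball 0 (r - norm q). \<tau> (q + w) \<in> D}" by (simp add: o_def)
  qed
qed

end

section \<open>A common local coordinate\<close>

lemma deriv_zero_imp_constant_ball:
  assumes "f holomorphic_on ball z s" "\<And>u. u \<in> ball z s \<Longrightarrow> deriv f u = 0"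
  obtains c where "\<And>u. u \<in> ball z s \<Longrightarrow> f u = c"
proof -
  have "(f has_field_derivative 0) (at u within ball z s)" if "u \<in> ball z s" for u
    using holomorphic_derivI[OF assms(1) open_ball that] assms(2)[OF that] by simp
  then have "\<exists>c. \<forall>u\<in>ball z s. f u = c" by (intro has_field_derivative_zero_constant convex_ball)
  then show thesis using that by blast
qed

locale surf_map = V: surf V + U: surf U for V :: "'b surface" and U :: "'a surface" +
  fixes \<pi> :: "'b \<Rightarrow> 'a"
  assumes connV: "connected_space (surf_top V)"
    and ana: "analytic_map V U \<pi>" and nonconst: "\<nexists>c. \<forall>p \<in> points V. \<pi> p = c"
begin

lemma cont_map: "continuous_map (surf_top V) (surf_top U) \<pi>"
  using ana by (simp add: analytic_map_def)

lemma map_points: "p \<in> points V \<Longrightarrow> \<pi> p \<in> points U"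
  using continuous_map_funspace[OF cont_map] by auto

lemma open_vimage_map: "openin (surf_top U) A \<Longrightarrow> openin (surf_top V) {p \<in> points V. \<pi> p \<in> A}"
  using cont_map unfolding continuous_map_def by blast

lemma map_holomorphic:
  assumes "(D, \<phi>) \<in> surf_charts V" "(E, \<psi>) \<in> surf_charts U"
  shows "(\<lambda>z. \<psi> (\<pi> (inv_into D \<phi> z))) holomorphic_on \<phi> ` {p \<in> D. \<pi> p \<in> E}" "open (\<phi> ` {p \<in> D. \<pi> p \<in> E})"
proof -
  show "(\<lambda>z. \<psi> (\<pi> (inv_into D \<phi> z))) holomorphic_on \<phi> ` {p \<in> D. \<pi> p \<in> E}"
    using ana assms unfolding analytic_map_def by fast
  have "{p \<in> points V. \<pi> p \<in> E} \<inter> D = {p \<in> D. \<pi> p \<in> E}" using V.chart_homeo(2)[OF assms(1)] by auto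
  then show "open (\<phi> ` {p \<in> D. \<pi> p \<in> E})"
    using V.chart_open_image[OF assms(1) open_vimage_map[OF U.chart_homeo(1)[OF assms(2)]]] by simp
qed

text \<open>
  The points near which the map is constant with value c form an open set; it is also closed, since
  at a boundary point the map is analytic and equal to c on a nonempty open set nearby.
\<close>

lemma not_locally_constant:
  assumes p0: "p0 \<in> points V" and A: "openin (surf_top V) A" "p0 \<in> A" "\<And>q. q \<in> A \<Longrightarrow> \<pi> q = c"
  shows False
proof -
  define M where "M = {p \<in> points V. \<exists>A. openin (surf_top V) A \<and> p \<in> A \<and> (\<forall>q\<in>A. \<pi> q = c)}"
  have c: "c \<in> points U" using map_points[OF p0] A by auto
  have M: "openin (surf_top V) M"
  proof (subst openin_subopen, intro ballI)
    fix p assume "p \<in> M"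
    then obtain B where B: "openin (surf_top V) B" "p \<in> B" "\<forall>q\<in>B. \<pi> q = c" by (auto simp: M_def)
    then have "B \<subseteq> M" using openin_subset[OF B(1)] unfolding M_def by blast
    then show "\<exists>T. openin (surf_top V) T \<and> p \<in> T \<and> T \<subseteq> M" using B by blast
  qed
  have "openin (surf_top V) (points V - M)"
  proof (subst openin_subopen, intro ballI)
    fix p assume p: "p \<in> points V - M"
    show "\<exists>T. openin (surf_top V) T \<and> p \<in> T \<and> T \<subseteq> points V - M"
    proof (cases "\<pi> p = c")
      case False
      have "Hausdorff_space (surf_top U)" using U.surf by (simp add: riemann_surface_def)
      then obtain B C where BC: "openin (surf_top U) B" "\<pi> p \<in> B" "c \<in> C" "disjnt B C"
        using False c map_points[of p] p unfolding Hausdorff_space_def by (metis DiffD1)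
      have "{q \<in> points V. \<pi> q \<in> B} \<inter> M = {}" using BC by (auto simp: M_def disjnt_iff)
      then show ?thesis
        using open_vimage_map[OF BC(1)] BC(2) p by (intro exI[of _ "{q \<in> points V. \<pi> q \<in> B}"]) auto
    next
      case True
      obtain D \<phi> where cD: "(D, \<phi>) \<in> surf_charts V" "p \<in> D" using V.chart_cover p by blast
      obtain E \<psi> where cE: "(E, \<psi>) \<in> surf_charts U" "c \<in> E" using U.chart_cover c by blast
      define W where "W = \<phi> ` {p \<in> D. \<pi> p \<in> E}"
      note h = map_holomorphic[OF cD(1) cE(1), folded W_def]
      have "\<phi> p \<in> W" using True cD(2) cE(2) by (auto simp: W_def)
      then obtain s where s: "s > 0" "ball (\<phi> p) s \<subseteq> W" using h(2) open_contains_ball by blast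
      define T where "T = {q \<in> D. \<phi> q \<in> ball (\<phi> p) s}"
      have T: "openin (surf_top V) T" "p \<in> T"
        unfolding T_def using V.chart_open_preimage[OF cD(1) open_ball] s(1) cD(2) by auto
      have TE: "\<pi> q \<in> E" if "q \<in> T" for q
      proof -
        have "\<phi> q \<in> W" using that s(2) by (auto simp: T_def)
        then obtain q' where "q' \<in> D" "\<pi> q' \<in> E" "\<phi> q' = \<phi> q" by (auto simp: W_def)
        then show ?thesis using inj_onD[OF V.chart_inj[OF cD(1)], of q' q] that by (auto simp: T_def)
      qed
      have "T \<inter> M = {}"
      proof (rule ccontr)
        assume "T \<inter> M \<noteq> {}"
        then obtain q B where q: "q \<in> T" "openin (surf_top V) B" "q \<in> B" "\<forall>q\<in>B. \<pi> q = c" by (auto simp: M_def)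
        have o: "open (\<phi> ` (B \<inter> T \<inter> D))" using V.chart_open_image[OF cD(1) openin_Int[OF q(2) T(1)]] .
        have "\<psi> (\<pi> (inv_into D \<phi> z)) = \<psi> c" if z: "z \<in> ball (\<phi> p) s" for z
        proof (rule analytic_continuation_open[where s = "\<phi> ` (B \<inter> T \<inter> D)" and s' = "ball (\<phi> p) s"
              and f = "\<lambda>z. \<psi> (\<pi> (inv_into D \<phi> z))" and g = "\<lambda>z. \<psi> c"])
          show "\<phi> ` (B \<inter> T \<inter> D) \<noteq> {}" using q by (auto simp: T_def)
          show "\<phi> ` (B \<inter> T \<inter> D) \<subseteq> ball (\<phi> p) s" by (auto simp: T_def)
          show "(\<lambda>z. \<psi> (\<pi> (inv_into D \<phi> z))) holomorphic_on ball (\<phi> p) s" using h(1) s(2) holomorphic_on_subset by blast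
          fix u assume "u \<in> \<phi> ` (B \<inter> T \<inter> D)"
          then show "\<psi> (\<pi> (inv_into D \<phi> u)) = \<psi> c" using q(4) V.chart_inv(1)[OF cD(1)] by auto
        qed (use o z in auto)
        then have "\<psi> (\<pi> q) = \<psi> c" if "q \<in> T" for q
          using that V.chart_inv(1)[OF cD(1), of q] by (force simp: T_def)
        then have "\<pi> q = c" if "q \<in> T" for q
          using that TE[OF that] cE inj_onD[OF U.chart_inj[OF cE(1)]] by blast
        then have "p \<in> M" using T p by (auto simp: M_def)
        then show False using p by blast
      qed
      then show ?thesis using T openin_subset[OF T(1)] by (intro exI[of _ T]) auto
    qed
  qed
  moreover have "p0 \<in> M" using p0 A by (auto simp: M_def)
  moreover have "M \<subseteq> points V" by (auto simp: M_def)
  ultimately have "points V - M = {}"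
    using connV M unfolding connected_space_def by (metis Diff_disjoint Un_Diff_cancel empty_iff order_refl sup.absorb_iff2)
  then have "\<forall>p\<in>points V. \<pi> p = c" by (auto simp: M_def)
  then show False using nonconst by blast
qed

text \<open>
  The derivative of the map in charts does not vanish identically near p0.  Hence it is open
  on a small disc, whose image contains a point at which x is regular: otherwise x would be constant.
\<close>

lemma regular_point:
  assumes connU: "connected_space (surf_top U)" and x: "x \<in> meromorphic_functions U" "\<nexists>c. x = mero_const U c"
    and p0: "p0 \<in> points V"
  obtains D \<phi> E \<psi> z where "(D, \<phi>) \<in> surf_charts V" "(E, \<psi>) \<in> surf_charts U" "z \<in> \<phi> ` {p \<in> D. \<pi> p \<in> E}"
    "(\<lambda>u. x (inv_into E \<psi> u)) analytic_on {\<psi> (\<pi> (inv_into D \<phi> z))}"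
    "deriv (\<lambda>z. \<psi> (\<pi> (inv_into D \<phi> z))) z \<noteq> 0"
    "deriv (\<lambda>u. x (inv_into E \<psi> u)) (\<psi> (\<pi> (inv_into D \<phi> z))) \<noteq> 0"
proof -
  obtain D \<phi> where cD: "(D, \<phi>) \<in> surf_charts V" "p0 \<in> D" using V.chart_cover[OF p0] .
  obtain E \<psi> where cE: "(E, \<psi>) \<in> surf_charts U" "\<pi> p0 \<in> E" using U.chart_cover[OF map_points[OF p0]] .
  define f where "f = (\<lambda>z. \<psi> (\<pi> (inv_into D \<phi> z)))"
  define \<xi> where "\<xi> = (\<lambda>u. x (inv_into E \<psi> u))"
  define W where "W = \<phi> ` {p \<in> D. \<pi> p \<in> E}"
  have h: "f holomorphic_on W" "open W" using map_holomorphic[OF cD(1) cE(1)] by (simp_all add: W_def f_def)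
  have fE: "f z \<in> \<psi> ` E" if "z \<in> W" for z using that V.chart_inv(1)[OF cD(1)] by (auto simp: W_def f_def)
  have zW: "\<phi> p0 \<in> W" using cD cE by (auto simp: W_def)
  have "\<exists>z\<in>W. deriv f z \<noteq> 0"
  proof (rule ccontr)
    assume "\<not> ?thesis"
    then have d0: "deriv f z = 0" if "z \<in> W" for z using that by blast
    obtain s where s: "s > 0" "ball (\<phi> p0) s \<subseteq> W" using h(2) zW open_contains_ball by blast
    obtain c where c: "\<And>u. u \<in> ball (\<phi> p0) s \<Longrightarrow> f u = c"
      using deriv_zero_imp_constant_ball[of f "\<phi> p0" s] holomorphic_on_subset[OF h(1) s(2)] d0 s(2) by blast
    define T where "T = {q \<in> D. \<phi> q \<in> ball (\<phi> p0) s}"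
    have T: "openin (surf_top V) T" "p0 \<in> T"
      unfolding T_def using V.chart_open_preimage[OF cD(1) open_ball] s(1) cD(2) by auto
    have "\<pi> q = \<pi> p0" if "q \<in> T" for q
    proof -
      have "\<phi> q \<in> W" using that s(2) by (auto simp: T_def)
      then have "\<pi> q \<in> E" using inj_onD[OF V.chart_inj[OF cD(1)], of _ q] that by (auto simp: W_def T_def)
      moreover have "\<psi> (\<pi> q) = \<psi> (\<pi> p0)"
        using c[of "\<phi> q"] c[of "\<phi> p0"] that s(1) cD V.chart_inv(1)[OF cD(1)] by (auto simp: f_def T_def)
      ultimately show ?thesis using inj_onD[OF U.chart_inj[OF cE(1)]] cE(2) by blast
    qed
    from not_locally_constant[OF p0 T this] show False .
  qed
  then obtain z0 where z0: "z0 \<in> W" "deriv f z0 \<noteq> 0" by blast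
  have "continuous_on W (deriv f)" using h by (intro holomorphic_on_imp_continuous_on holomorphic_deriv)
  then have "open (W \<inter> deriv f -` (- {0}))" using h(2) continuous_open_preimage by blast
  then obtain s where s: "s > 0" "ball z0 s \<subseteq> W \<inter> deriv f -` (- {0})"
    by (rule openE[of _ z0]) (use z0 in auto)
  have fb: "f holomorphic_on ball z0 s" using h(1) s(2) holomorphic_on_subset by blast
  have "\<not> f constant_on ball z0 s"
  proof
    assume "f constant_on ball z0 s"
    then obtain c where c: "\<And>u. u \<in> ball z0 s \<Longrightarrow> f u = c" by (auto simp: constant_on_def)
    have "(f has_field_derivative 0) (at z0)"
      by (rule has_field_derivative_transform_within_open[OF DERIV_const[of c] open_ball[of z0 s]])
        (use s(1) c in auto)
    then have "deriv f z0 = 0" by (rule DERIV_imp_deriv)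
    with z0(2) show False by contradiction
  qed
  then have ofb: "open (f ` ball z0 s)"
    using open_mapping_thm[OF fb open_ball connected_ball open_ball order_refl] by blast
  have fbE: "f ` ball z0 s \<subseteq> \<psi> ` E" using fE s(2) by auto
  have Xm: "\<xi> meromorphic_on \<psi> ` E" using U.mero_pre[OF x(1)] cE(1) by (auto simp: pre_mero_def \<xi>_def)
  have "\<exists>u\<in>f ` ball z0 s. \<xi> analytic_on {u} \<and> deriv \<xi> u \<noteq> 0"
  proof (rule ccontr)
    assume "\<not> ?thesis"
    then have d0: "deriv \<xi> u = 0" if "u \<in> f ` ball z0 s" "\<xi> analytic_on {u}" for u using that by blast
    have "eventually (\<lambda>u. \<xi> analytic_on {u}) (at (f z0))"
    proof -
      have "f z0 \<in> \<psi> ` E" using fbE s(1) by auto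
      then have "isolated_singularity_at \<xi> (f z0)" using Xm unfolding meromorphic_on_altdef by blast
      then show ?thesis by (simp add: isolated_singularity_at_altdef)
    qed
    moreover have "eventually (\<lambda>u. u \<in> f ` ball z0 s) (at (f z0))"
      using ofb s(1) by (intro eventually_at_in_open') auto
    ultimately have "eventually (\<lambda>u. \<xi> analytic_on {u} \<and> u \<in> f ` ball z0 s) (at (f z0))" by (rule eventually_conj)
    from eventually_happens'[OF at_neq_bot this]
    obtain u0 where u0: "\<xi> analytic_on {u0}" "u0 \<in> f ` ball z0 s" by blast
    obtain e1 where e1: "e1 > 0" "\<xi> holomorphic_on ball u0 e1" using u0(1) by (auto simp: analytic_on_def)
    obtain e2 where e2: "e2 > 0" "ball u0 e2 \<subseteq> f ` ball z0 s" using ofb u0(2) open_contains_ball by blast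
    define e where "e = min e1 e2"
    have e: "e > 0" "\<xi> holomorphic_on ball u0 e" "ball u0 e \<subseteq> f ` ball z0 s"
      using e1 e2 holomorphic_on_subset[OF e1(2), of "ball u0 e"] by (auto simp: e_def)
    have "deriv \<xi> u = 0" if "u \<in> ball u0 e" for u
      using d0[of u] that e(3) holomorphic_on_imp_analytic_at[OF e(2) open_ball that] by blast
    then obtain c where c: "\<And>u. u \<in> ball u0 e \<Longrightarrow> \<xi> u = c"
      using deriv_zero_imp_constant_ball[OF e(2)] by blast
    have u0E: "u0 \<in> \<psi> ` E" using u0(2) fbE by blast
    define q0 where "q0 = inv_into E \<psi> u0"
    have q0: "q0 \<in> E" "\<psi> q0 = u0" using U.chart_inv[OF cE(1)] u0E by (auto simp: q0_def)
    then have q0U: "q0 \<in> points U" using U.chart_homeo(2)[OF cE(1)] by auto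
    have "eventually (\<lambda>u. u \<in> ball u0 e \<inter> \<psi> ` E) (at u0)"
      using e(1) u0E U.chart_homeo(3)[OF cE(1)] by (intro eventually_at_in_open') auto
    then have "eventually (\<lambda>u. x (inv_into E \<psi> u) = mero_const U c (inv_into E \<psi> u)) (at (\<psi> q0))"
      unfolding q0(2)
    proof eventually_elim
      case (elim u)
      then have "inv_into E \<psi> u \<in> points U" using U.chart_inv(2)[OF cE(1)] U.chart_homeo(2)[OF cE(1)] by blast
      then show ?case using c[of u] elim by (simp add: \<xi>_def mero_const_def)
    qed
    then have "eventually (\<lambda>q. x q = mero_const U c q) (atin (surf_top U) q0)"
      using U.eventually_atin_chart[OF cE(1) q0(1), of "\<lambda>q. x q = mero_const U c q"] by simp
    then have "frequently (\<lambda>q. x q = mero_const U c q) (atin (surf_top U) q0)"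
      using U.atin_neq_bot[OF q0U] by (rule eventually_frequently[rotated])
    then have "x = mero_const U c" using U.identity_principle[OF connU x(1) U.mero_const_mem q0U] by blast
    then show False using x(2) by blast
  qed
  then obtain z where z: "z \<in> ball z0 s" "\<xi> analytic_on {f z}" "deriv \<xi> (f z) \<noteq> 0" by blast
  then have "deriv f z \<noteq> 0" "z \<in> W" using s(2) by auto
  then show thesis
    using that[OF cD(1) cE(1)] z unfolding f_def \<xi>_def W_def by blast
qed

text \<open>
  At a regular point the composition of x with the map to U is locally injective, and its local inverse
  parametrizes a neighbourhood in V; composed with the map it parametrizes one in U.
\<close>

theorem exists_local_coordinate:
  assumes connU: "connected_space (surf_top U)" and x: "x \<in> meromorphic_functions U" "\<nexists>c. x = mero_const U c"
    and p0: "p0 \<in> points V"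
  obtains \<tau> r where "local_coordinate V (pull V \<pi> x) \<tau> r" "local_coordinate U x (\<lambda>w. \<pi> (\<tau> w)) r"
proof -
  obtain D \<phi> E \<psi> z1 where cD: "(D, \<phi>) \<in> surf_charts V" and cE: "(E, \<psi>) \<in> surf_charts U"
    and z1: "z1 \<in> \<phi> ` {p \<in> D. \<pi> p \<in> E}"
    and Xa: "(\<lambda>u. x (inv_into E \<psi> u)) analytic_on {\<psi> (\<pi> (inv_into D \<phi> z1))}"
    and d: "deriv (\<lambda>z. \<psi> (\<pi> (inv_into D \<phi> z))) z1 \<noteq> 0"
    "deriv (\<lambda>u. x (inv_into E \<psi> u)) (\<psi> (\<pi> (inv_into D \<phi> z1))) \<noteq> 0"
    using regular_point[OF connU x p0] .
  define f where "f = (\<lambda>z. \<psi> (\<pi> (inv_into D \<phi> z)))"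
  define \<xi> where "\<xi> = (\<lambda>u. x (inv_into E \<psi> u))"
  define W where "W = \<phi> ` {p \<in> D. \<pi> p \<in> E}"
  have h: "f holomorphic_on W" "open W" using map_holomorphic[OF cD cE] by (simp_all add: W_def f_def)
  have WD: "inv_into D \<phi> z \<in> D" "\<pi> (inv_into D \<phi> z) \<in> E" "\<phi> (inv_into D \<phi> z) = z" if "z \<in> W" for z
    using that V.chart_inv(1)[OF cD] by (auto simp: W_def)
  obtain B where B: "open B" "f z1 \<in> B" "\<xi> holomorphic_on B"
    using Xa by (auto simp: \<xi>_def f_def analytic_at)
  define W' where "W' = W \<inter> f -` B"
  have W': "open W'" "z1 \<in> W'" "W' \<subseteq> W"
    using continuous_open_preimage[OF holomorphic_on_imp_continuous_on[OF h(1)] h(2) B(1)] z1 B(2)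
    by (auto simp: W'_def W_def)
  define g where "g = (\<lambda>z. \<xi> (f z))"
  have gh: "g holomorphic_on W'"
    unfolding g_def using holomorphic_on_compose_gen[OF holomorphic_on_subset[OF h(1) W'(3)] B(3)]
    by (auto simp: o_def W'_def)
  have "(g has_field_derivative deriv \<xi> (f z1) * deriv f z1) (at z1)"
    unfolding g_def
    by (rule DERIV_chain2[where f = \<xi> and g = f, OF holomorphic_derivI[OF B(3,1,2)] holomorphic_derivI[OF h z1[folded W_def]]])
  then have "deriv g z1 \<noteq> 0" using d by (simp add: DERIV_imp_deriv f_def \<xi>_def)
  from has_complex_derivative_locally_injective[OF gh W'(2,1) this]
  obtain s where s: "s > 0" "ball z1 s \<subseteq> W'" "inj_on g (ball z1 s)" .
  have gb: "g holomorphic_on ball z1 s" using gh s(2) holomorphic_on_subset by blast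
  obtain k where k: "k holomorphic_on g ` ball z1 s" "\<And>z. z \<in> ball z1 s \<Longrightarrow> k (g z) = z"
    using holomorphic_has_inverse[OF gb open_ball s(3)] by metis
  have "open (g ` ball z1 s)" by (rule open_mapping_thm3[OF gb open_ball s(3)])
  then obtain r where r: "r > 0" "ball (g z1) r \<subseteq> g ` ball z1 s"
    by (rule openE[of _ "g z1"]) (use s(1) in auto)
  define \<kappa> where "\<kappa> w = k (g z1 + w)" for w
  have \<kappa>: "\<kappa> w \<in> ball z1 s" "g (\<kappa> w) = g z1 + w" if "w \<in> ball 0 r" for w
  proof -
    have "g z1 + w \<in> ball (g z1) r" using that by (simp add: dist_norm)
    then obtain z where "z \<in> ball z1 s" "g z = g z1 + w" using r(2) by (metis imageE subsetD)
    then show "\<kappa> w \<in> ball z1 s" "g (\<kappa> w) = g z1 + w" using k(2)[of z] by (auto simp: \<kappa>_def)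
  qed
  have \<kappa>W: "\<kappa> w \<in> W" if "w \<in> ball 0 r" for w using \<kappa>(1)[OF that] s(2) W'(3) by auto
  have "k \<circ> (\<lambda>w. g z1 + w) holomorphic_on ball 0 r"
    by (rule holomorphic_on_compose_gen[OF _ holomorphic_on_subset[OF k(1) r(2)]])
      (auto intro!: holomorphic_intros simp: dist_norm)
  then have \<kappa>h: "\<kappa> holomorphic_on ball 0 r" by (simp add: \<kappa>_def[abs_def] o_def)
  define \<tau> where "\<tau> w = inv_into D \<phi> (\<kappa> w)" for w
  have \<tau>D: "\<tau> w \<in> D" "\<pi> (\<tau> w) \<in> E" "\<phi> (\<tau> w) = \<kappa> w" if "w \<in> ball 0 r" for w
    using WD[OF \<kappa>W[OF that]] by (auto simp: \<tau>_def)
  have \<tau>V: "\<tau> w \<in> points V" if "w \<in> ball 0 r" for w using \<tau>D(1)[OF that] V.chart_homeo(2)[OF cD] by blast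
  have ct: "continuous_map (top_of_set (ball 0 r)) (surf_top V) \<tau>"
    unfolding continuous_map_def
  proof (intro conjI allI impI)
    show "\<tau> \<in> topspace (top_of_set (ball 0 r)) \<rightarrow> points V" using \<tau>V by auto
    fix A assume A: "openin (surf_top V) A"
    have "openin (top_of_set (ball 0 r)) (ball 0 r \<inter> \<kappa> -` (\<phi> ` (A \<inter> D)))"
      using V.chart_open_image[OF cD A] holomorphic_on_imp_continuous_on[OF \<kappa>h] continuous_openin_preimage_gen by blast
    also have "ball 0 r \<inter> \<kappa> -` (\<phi> ` (A \<inter> D)) = {w \<in> topspace (top_of_set (ball 0 r)). \<tau> w \<in> A}"
    proof (intro Set.set_eqI iffI)
      fix w assume "w \<in> ball 0 r \<inter> \<kappa> -` (\<phi> ` (A \<inter> D))"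
      then show "w \<in> {w \<in> topspace (top_of_set (ball 0 r)). \<tau> w \<in> A}"
        using V.chart_inv(1)[OF cD] by (auto simp: \<tau>_def)
    next
      fix w assume w: "w \<in> {w \<in> topspace (top_of_set (ball 0 r)). \<tau> w \<in> A}"
      then have "\<kappa> w \<in> \<phi> ` (A \<inter> D)" using \<tau>D[of w] by (intro image_eqI[of _ _ "\<tau> w"]) auto
      then show "w \<in> ball 0 r \<inter> \<kappa> -` (\<phi> ` (A \<inter> D))" using w by simp
    qed
    finally show "openin (top_of_set (ball 0 r)) {w \<in> topspace (top_of_set (ball 0 r)). \<tau> w \<in> A}" .
  qed
  have eqx: "x (\<pi> (\<tau> w)) = g z1 + w" if "w \<in> ball 0 r" for w
    using \<kappa>(2)[OF that] U.chart_inv(1)[OF cE \<tau>D(2)[OF that]] by (simp add: g_def \<xi>_def f_def \<tau>_def)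
  show thesis
  proof (rule that[of \<tau> r])
    show "local_coordinate V (pull V \<pi> x) \<tau> r"
    proof (rule local_coordinateI[OF r(1) ct])
      show "pull V \<pi> x (\<tau> w) = g z1 + w" if "w \<in> ball 0 r" for w
        using eqx[OF that] \<tau>V[OF that] by (simp add: pull_def)
      fix D2 \<phi>2 assume c2: "(D2, \<phi>2) \<in> surf_charts V"
      have "(\<lambda>z. \<phi>2 (inv_into D \<phi> z)) \<circ> \<kappa> holomorphic_on {w \<in> ball 0 r. \<tau> w \<in> D2}"
      proof (rule holomorphic_on_compose_gen[OF _ V.chart_transition[OF cD c2]])
        show "\<kappa> holomorphic_on {w \<in> ball 0 r. \<tau> w \<in> D2}" using \<kappa>h by (rule holomorphic_on_subset) auto
        show "\<kappa> ` {w \<in> ball 0 r. \<tau> w \<in> D2} \<subseteq> \<phi> ` (D \<inter> D2)"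
        proof safe
          fix w assume "w \<in> ball 0 r" "\<tau> w \<in> D2"
          then show "\<kappa> w \<in> \<phi> ` (D \<inter> D2)" using \<tau>D[of w] by (intro image_eqI[of _ _ "\<tau> w"]) auto
        qed
      qed
      then show "(\<lambda>w. \<phi>2 (\<tau> w)) holomorphic_on {w \<in> ball 0 r. \<tau> w \<in> D2}"
        by (simp add: o_def \<tau>_def)
    qed
    show "local_coordinate U x (\<lambda>w. \<pi> (\<tau> w)) r"
    proof (rule local_coordinateI[OF r(1)])
      show "x (\<pi> (\<tau> w)) = g z1 + w" if "w \<in> ball 0 r" for w by (rule eqx[OF that])
      show "continuous_map (top_of_set (ball 0 r)) (surf_top U) (\<lambda>w. \<pi> (\<tau> w))"
        using continuous_map_compose[OF ct cont_map] by (simp add: o_def)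
      fix E2 \<psi>2 assume c2: "(E2, \<psi>2) \<in> surf_charts U"
      have "(\<lambda>z. \<psi>2 (\<pi> (inv_into D \<phi> z))) \<circ> \<kappa> holomorphic_on {w \<in> ball 0 r. \<pi> (\<tau> w) \<in> E2}"
      proof (rule holomorphic_on_compose_gen[OF _ map_holomorphic(1)[OF cD c2]])
        show "\<kappa> holomorphic_on {w \<in> ball 0 r. \<pi> (\<tau> w) \<in> E2}" using \<kappa>h by (rule holomorphic_on_subset) auto
        show "\<kappa> ` {w \<in> ball 0 r. \<pi> (\<tau> w) \<in> E2} \<subseteq> \<phi> ` {p \<in> D. \<pi> p \<in> E2}"
        proof safe
          fix w assume "w \<in> ball 0 r" "\<pi> (\<tau> w) \<in> E2"
          then show "\<kappa> w \<in> \<phi> ` {p \<in> D. \<pi> p \<in> E2}" using \<tau>D[of w] by (intro image_eqI[of _ _ "\<tau> w"]) auto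
        qed
      qed
      then show "(\<lambda>w. \<psi>2 (\<pi> (\<tau> w))) holomorphic_on {w \<in> ball 0 r. \<pi> (\<tau> w) \<in> E2}"
        by (simp add: o_def \<tau>_def)
    qed
  qed
qed

end

section \<open>Simple roots as holomorphic functions\<close>

text \<open>
  A generator of the ideal spanned by P and its derivative divides P and, unlike P, does not vanish
  at c, so it is a constant.  The resulting identity survives every homomorphism and reduction, which
  makes it more useful than the statement that the roots are simple.
\<close>

lemma minimal_polynomial_separable:
  fixes c :: "'a::field_char_0"
  assumes F: "subfld F" and P: "P \<in> polys_over F" "P \<noteq> 0" "poly P c = 0"
    and min: "\<And>p. p \<in> polys_over F \<Longrightarrow> poly p c = 0 \<Longrightarrow> p \<noteq> 0 \<Longrightarrow> Polynomial.degree P \<le> Polynomial.degree p"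
  obtains A B where "A \<in> polys_over F" "B \<in> polys_over F" "A * P + B * pderiv P = 1"
proof -
  note cl = polys_over_closed[OF F]
  define G where "G = {A * P + B * pderiv P | A B. A \<in> polys_over F \<and> B \<in> polys_over F}"
  have PG: "P \<in> G"
    unfolding G_def using cl(1,2) by (intro CollectI exI[of _ 1] exI[of _ 0]) simp
  have P'G: "pderiv P \<in> G"
    unfolding G_def using cl(1,2) by (intro CollectI exI[of _ 0] exI[of _ 1]) simp
  have GF: "p \<in> polys_over F" if "p \<in> G" for p using that P(1) by (auto simp: G_def intro!: cl)
  have Gd: "p - q * g \<in> G" if pg: "p \<in> G" "g \<in> G" "q \<in> polys_over F" for p q g
  proof -
    obtain A B A' B' where ab: "A \<in> polys_over F" "B \<in> polys_over F" "p = A * P + B * pderiv P"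
      "A' \<in> polys_over F" "B' \<in> polys_over F" "g = A' * P + B' * pderiv P" using pg by (auto simp: G_def)
    have "p - q * g = (A - q * A') * P + (B - q * B') * pderiv P" using ab by (simp add: algebra_simps)
    moreover have "A - q * A' \<in> polys_over F" "B - q * B' \<in> polys_over F" using ab pg(3) by (auto intro!: cl)
    ultimately show ?thesis unfolding G_def by blast
  qed
  have "\<exists>g. (g \<in> G \<and> g \<noteq> 0) \<and> (\<forall>p. p \<in> G \<and> p \<noteq> 0 \<longrightarrow> Polynomial.degree g \<le> Polynomial.degree p)"
    using PG P by (intro ex_has_least_nat[of _ P]) auto
  then obtain g where g: "g \<in> G" "g \<noteq> 0" and gmin: "\<And>p. p \<in> G \<Longrightarrow> p \<noteq> 0 \<Longrightarrow> Polynomial.degree g \<le> Polynomial.degree p"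
    by blast
  have dvd: "\<exists>q\<in>polys_over F. p = q * g" if pG: "p \<in> G" for p
  proof -
    obtain q r where qr: "q \<in> polys_over F" "r \<in> polys_over F" "p = q * g + r"
      "r = 0 \<or> Polynomial.degree r < Polynomial.degree g"
      using polys_over_division[OF F GF[OF g(1)] g(2) GF[OF pG]] .
    have "r \<in> G" using Gd[OF pG g(1) qr(1)] qr(3) by simp
    then have "r = 0" using gmin[of r] qr(4) by fastforce
    then show ?thesis using qr by auto
  qed
  obtain q where q: "q \<in> polys_over F" "P = q * g" using dvd[OF PG] by blast
  have "poly (pderiv P) c \<noteq> 0"
    by (rule derivation_algebraic(1)[where D = "\<lambda>_. 0", OF F _ _ P min])
      (use subfldD[OF F] in \<open>auto simp: derivation_def\<close>)
  then have "poly g c \<noteq> 0" using dvd[OF P'G] by auto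
  then have "poly q c = 0" using P(3) q by simp
  then have "Polynomial.degree P \<le> Polynomial.degree q" using min[OF q(1)] q P(2) by auto
  then have "Polynomial.degree g = 0" using q g(2) P(2) by (auto simp: degree_mult_eq)
  then obtain a where a: "g = [:a:]" by (rule degree_eq_zeroE)
  have aF: "a \<in> F" "a \<noteq> 0" using GF[OF g(1)] g(2) a by (auto simp: polys_over_pCons)
  obtain A B where AB: "A \<in> polys_over F" "B \<in> polys_over F" "g = A * P + B * pderiv P" using g(1) by (auto simp: G_def)
  have ia: "[:inverse a:] \<in> polys_over F" using cl(3) subfldD(6)[OF F] aF by blast
  have "[:inverse a:] * A * P + [:inverse a:] * B * pderiv P = [:inverse a:] * g"
    by (simp add: AB(3) distrib_left)
  also have "\<dots> = 1" using aF a by (simp add: one_pCons)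
  finally show thesis using that[of "[:inverse a:] * A" "[:inverse a:] * B"] ia AB by (auto intro!: cl simp del: mult_pCons_left)
qed

text \<open>
  The simplified Newton iteration, with the derivative frozen at the starting point, is a
  contraction near the simple root X0 uniformly in z.  Its iterates are holomorphic in z, and so
  is their uniform limit.
\<close>

lemma implicit_holomorphic_root:
  fixes g :: "nat \<Rightarrow> complex \<Rightarrow> complex"
  assumes e: "e > 0" and hol: "\<And>i. i \<le> N \<Longrightarrow> g i holomorphic_on ball q e"
    and root: "(\<Sum>i\<le>N. g i q * X0 ^ i) = 0"
    and simple: "(\<Sum>i\<le>N. of_nat i * g i q * X0 ^ (i - 1)) \<noteq> 0"
  obtains \<epsilon> v where "0 < \<epsilon>" "\<epsilon> \<le> e" "v holomorphic_on ball q \<epsilon>" "\<And>z. z \<in> ball q \<epsilon> \<Longrightarrow> (\<Sum>i\<le>N. g i z * v z ^ i) = 0"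
proof -
  define G where "G z y = (\<Sum>i\<le>N. g i z * y ^ i)" for z y
  define H where "H z y = (\<Sum>i\<le>N. of_nat i * g i z * y ^ (i - 1))" for z y
  define a where "a = H q X0"
  have a: "a \<noteq> 0" using simple by (simp add: a_def H_def)
  \<comment> \<open>G is the polynomial and H its derivative, so \<Phi> is a Newton step with frozen slope a.\<close>
  define \<Phi> where "\<Phi> z y = y - G z y / a" for z y
  have gc: "continuous_on (ball q e) (g i)" if "i \<le> N" for i using hol[OF that] by (rule holomorphic_on_imp_continuous_on)
  have "continuous_on (ball q e \<times> UNIV) (\<lambda>p. 1 - H (fst p) (snd p) / a)"
    unfolding H_def
    by (intro continuous_intros continuous_on_compose2[OF gc, of _ "ball q e \<times> UNIV" fst]) (auto simp: a)
  moreover have "open (ball q e \<times> (UNIV :: complex set))" by (simp add: open_Times)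
  ultimately have "isCont (\<lambda>p. 1 - H (fst p) (snd p) / a) (q, X0)"
    using e by (auto simp: continuous_on_eq_continuous_at)
  moreover have "1 - H (fst (q, X0)) (snd (q, X0)) / a = 0" using a by (simp add: a_def)
  ultimately have "((\<lambda>p. 1 - H (fst p) (snd p) / a) \<longlongrightarrow> 0) (at (q, X0))" by (simp add: isCont_def)
  then obtain \<eta> where \<eta>: "\<eta> > 0" "\<And>p. dist p (q, X0) < \<eta> \<Longrightarrow> norm (1 - H (fst p) (snd p) / a) < 1/2"
  proof -
    assume l: "((\<lambda>p. 1 - H (fst p) (snd p) / a) \<longlongrightarrow> 0) (at (q, X0))"
    have "eventually (\<lambda>p. dist (1 - H (fst p) (snd p) / a) 0 < 1/2) (at (q, X0))"
      using l by (rule tendstoD) simp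
    then obtain d where d: "d > 0" "\<And>p. p \<noteq> (q, X0) \<Longrightarrow> dist p (q, X0) < d \<Longrightarrow> dist (1 - H (fst p) (snd p) / a) 0 < 1/2"
      unfolding eventually_at by blast
    have "norm (1 - H (fst p) (snd p) / a) < 1/2" if "dist p (q, X0) < d" for p
    proof (cases "p = (q, X0)")
      case True
      then show ?thesis using a by (simp add: a_def)
    next
      case False
      then show ?thesis using d(2)[OF False that] by simp
    qed
    with d(1) show thesis by (rule that)
  qed
  \<comment> \<open>Two distances of at most \<delta> add up to less than \<eta>.\<close>
  define \<delta> where "\<delta> = \<eta> / 3"
  have \<delta>: "\<delta> > 0" using \<eta> by (simp add: \<delta>_def)
  have "continuous_on (ball q e) (\<lambda>z. G z X0 / a)"
    unfolding G_def by (intro continuous_intros gc) (auto simp: a)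
  then have "isCont (\<lambda>z. G z X0 / a) q" using e by (auto simp: continuous_on_eq_continuous_at)
  then have "((\<lambda>z. G z X0 / a) \<longlongrightarrow> 0) (at q)" using root by (simp add: isCont_def G_def)
  then have "eventually (\<lambda>z. dist (G z X0 / a) 0 < \<delta> / 2) (at q)" using \<delta> by (intro tendstoD) auto
  then obtain d where d: "d > 0" "\<And>z. z \<noteq> q \<Longrightarrow> dist z q < d \<Longrightarrow> dist (G z X0 / a) 0 < \<delta> / 2"
    unfolding eventually_at by blast
  define \<epsilon> where "\<epsilon> = min e (min d \<delta>)"
  have \<epsilon>: "\<epsilon> > 0" "\<epsilon> \<le> e" using e d(1) \<delta> by (auto simp: \<epsilon>_def)
  have start: "norm (G z X0 / a) \<le> \<delta> / 2" if "z \<in> ball q \<epsilon>" for z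
    using d(2)[of z] that root \<delta> by (cases "z = q") (auto simp: \<epsilon>_def G_def dist_commute)
  have contr: "norm (\<Phi> z s - \<Phi> z t) \<le> 1/2 * norm (s - t)"
    if "z \<in> ball q \<epsilon>" "s \<in> cball X0 \<delta>" "t \<in> cball X0 \<delta>" for z s t
  proof (rule field_differentiable_bound[OF convex_cball _ _ that(2,3)])
    fix y assume y: "y \<in> cball X0 \<delta>"
    have "((\<lambda>y. G z y) has_field_derivative H z y) (at y within cball X0 \<delta>)"
      unfolding G_def H_def by (auto intro!: derivative_eq_intros sum.cong)
    then show "(\<Phi> z has_field_derivative 1 - H z y / a) (at y within cball X0 \<delta>)"
      unfolding \<Phi>_def using a by (auto intro!: derivative_eq_intros)
    have "dist (z, y) (q, X0) \<le> dist z q + dist y X0"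
      unfolding dist_Pair_Pair by (rule sqrt_sum_squares_le_sum) auto
    also have "\<dots> < \<eta>" using that(1) y \<delta> by (auto simp: \<epsilon>_def \<delta>_def dist_commute)
    finally show "norm (1 - H z y / a) \<le> 1/2" using \<eta>(2)[of "(z, y)"] by simp
  qed
  define v where "v n z = ((\<Phi> z) ^^ n) X0" for n z
  have vS: "v (Suc n) z = \<Phi> z (v n z)" for n z by (simp add: v_def)
  have bound: "norm (v n z - X0) \<le> \<delta> * (1 - (1/2)^n) \<and> norm (v (Suc n) z - v n z) \<le> \<delta> * (1/2)^(Suc n)"
    if "z \<in> ball q \<epsilon>" for n z
  proof (induction n)
    case 0
    then show ?case using start[OF that] by (simp add: v_def \<Phi>_def)
  next
    case (Suc n)
    have 1: "norm (v (Suc n) z - X0) \<le> \<delta> * (1 - (1/2)^(Suc n))"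
    proof -
      have "norm (v (Suc n) z - X0) \<le> norm (v (Suc n) z - v n z) + norm (v n z - X0)"
        using norm_triangle_ineq[of "v (Suc n) z - v n z" "v n z - X0"] by simp
      also have "\<dots> \<le> \<delta> * (1/2)^(Suc n) + \<delta> * (1 - (1/2)^n)" using Suc by (intro add_mono) auto
      also have "\<dots> = \<delta> * (1 - (1/2)^(Suc n))" by (simp add: algebra_simps)
      finally show ?thesis .
    qed
    have le: "\<delta> * (1 - (1/2)^k) \<le> \<delta>" for k using \<delta> by (simp add: algebra_simps)
    have "v n z \<in> cball X0 \<delta>" "v (Suc n) z \<in> cball X0 \<delta>"
      using Suc 1 le[of n] le[of "Suc n"] by (auto simp: dist_norm norm_minus_commute intro: order_trans)
    then have "norm (v (Suc (Suc n)) z - v (Suc n) z) \<le> 1/2 * norm (v (Suc n) z - v n z)"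
      unfolding vS[of "Suc n"] vS[of n] using contr[OF that] by (metis vS)
    also have "\<dots> \<le> 1/2 * (\<delta> * (1/2)^(Suc n))" using Suc by (intro mult_left_mono) auto
    finally show ?case using 1 by simp
  qed
  have vh: "v n holomorphic_on ball q \<epsilon>" for n
  proof (induction n)
    case (Suc n)
    have "g i holomorphic_on ball q \<epsilon>" if "i \<le> N" for i
      using hol[OF that] by (rule holomorphic_on_subset) (use \<epsilon> in auto)
    then have "(\<lambda>z. v n z - G z (v n z) / a) holomorphic_on ball q \<epsilon>"
      unfolding G_def using Suc a by (intro holomorphic_intros) auto
    then show ?case by (simp add: vS[abs_def] \<Phi>_def)
  qed (simp add: v_def)
  define u where "u z = suminf (\<lambda>n. v (Suc n) z - v n z)" for z
  have "uniform_limit (ball q \<epsilon>) (\<lambda>n z. \<Sum>i<n. v (Suc i) z - v i z) u sequentially"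
    unfolding u_def
  proof (rule Weierstrass_m_test)
    show "norm (v (Suc n) z - v n z) \<le> \<delta> * (1/2)^(Suc n)" if "z \<in> ball q \<epsilon>" for n z using bound[OF that] by blast
    show "summable (\<lambda>n. \<delta> * (1/2::real)^(Suc n))" by (intro summable_mult) (simp add: summable_geometric)
  qed
  moreover have "(\<Sum>i<n. v (Suc i) z - v i z) = v n z - X0" for n z
    using sum_lessThan_telescope[of "\<lambda>i. v i z" n] by (simp add: v_def)
  ultimately have ul: "uniform_limit (ball q \<epsilon>) (\<lambda>n z. v n z - X0) u sequentially" by simp
  have uh: "u holomorphic_on ball q \<epsilon>"
  proof (rule holomorphic_uniform_sequence[OF open_ball])
    show "(\<lambda>z. v n z - X0) holomorphic_on ball q \<epsilon>" for n by (intro holomorphic_intros vh)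
    fix z assume "z \<in> ball q \<epsilon>"
    then obtain d where "d > 0" "cball z d \<subseteq> ball q \<epsilon>" using open_contains_cball[of "ball q \<epsilon>"] open_ball by meson
    then show "\<exists>d>0. cball z d \<subseteq> ball q \<epsilon> \<and> uniform_limit (cball z d) (\<lambda>n z. v n z - X0) u sequentially"
      using uniform_limit_on_subset[OF ul] by blast
  qed
  show thesis
  proof (rule that[OF \<epsilon>, of "\<lambda>z. X0 + u z"])
    show "(\<lambda>z. X0 + u z) holomorphic_on ball q \<epsilon>" by (intro holomorphic_intros uh)
    fix z assume z: "z \<in> ball q \<epsilon>"
    have "(\<lambda>n. v n z - X0) \<longlonglongrightarrow> u z" using ul z by (rule tendsto_uniform_limitI)
    then have l: "(\<lambda>n. v n z) \<longlonglongrightarrow> X0 + u z" using tendsto_add[OF tendsto_const[of X0]] by fastforce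
    then have "(\<lambda>n. \<Phi> z (v n z)) \<longlonglongrightarrow> \<Phi> z (X0 + u z)"
      unfolding \<Phi>_def G_def using a by (intro tendsto_intros) auto
    moreover have "(\<lambda>n. \<Phi> z (v n z)) \<longlonglongrightarrow> X0 + u z"
      using LIMSEQ_Suc[OF l] by (simp add: vS)
    ultimately have "\<Phi> z (X0 + u z) = X0 + u z" by (rule LIMSEQ_unique)
    then show "(\<Sum>i\<le>N. g i z * (X0 + u z) ^ i) = 0" using a by (simp add: \<Phi>_def G_def)
  qed
qed

section \<open>Discs as surfaces\<close>

definition disc :: "complex \<Rightarrow> real \<Rightarrow> complex surface" where
  "disc q \<epsilon> = \<lparr>surf_top = top_of_set (ball q \<epsilon>), surf_charts = {(ball q \<epsilon>, id)}\<rparr>"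

lemma disc_simps [simp]: "surf_top (disc q \<epsilon>) = top_of_set (ball q \<epsilon>)" "surf_charts (disc q \<epsilon>) = {(ball q \<epsilon>, id)}"
  by (auto simp: disc_def)

lemma inv_into_id: "z \<in> A \<Longrightarrow> inv_into A id z = z"
  using inv_into_f_f[of id A z] by simp

lemma riemann_surface_disc: "riemann_surface (disc q \<epsilon>)"
proof -
  have "(\<lambda>z. id (inv_into (ball q \<epsilon>) id z)) holomorphic_on ball q \<epsilon>"
    using holomorphic_cong[of "ball q \<epsilon>" "ball q \<epsilon>" "\<lambda>z. id (inv_into (ball q \<epsilon>) id z)" "\<lambda>z. z"] by (simp add: inv_into_id)
  moreover have "Hausdorff_space (top_of_set (ball q \<epsilon>))" by (intro Hausdorff_space_subtopology Hausdorff_space_euclidean)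
  moreover have "homeomorphic_map (top_of_set (ball q \<epsilon>)) (top_of_set (ball q \<epsilon>)) id" by (simp add: homeomorphic_map_id)
  ultimately show ?thesis by (simp add: riemann_surface_def subtopology_subtopology)
qed

lemma connected_riemann_surface_disc: "\<epsilon> > 0 \<Longrightarrow> connected_riemann_surface (disc q \<epsilon>)"
  by (simp add: connected_riemann_surface_def riemann_surface_disc connected_space_subtopology)

lemma mero_disc:
  "f \<in> meromorphic_functions (disc q \<epsilon>) \<longleftrightarrow> f nicely_meromorphic_on ball q \<epsilon> \<and> (\<forall>p. p \<notin> ball q \<epsilon> \<longrightarrow> f p = 0)"
  using nicely_meromorphic_cong[OF _ open_ball, of f q \<epsilon> "\<lambda>z. f (inv_into (ball q \<epsilon>) id z)"]
    nicely_meromorphic_cong[OF _ open_ball, of "\<lambda>z. f (inv_into (ball q \<epsilon>) id z)" q \<epsilon> f]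
  by (auto simp: meromorphic_functions_def inv_into_id)

lemma holomorphic_imp_mero_disc:
  assumes "f holomorphic_on ball q \<epsilon>"
  shows "(\<lambda>z. if z \<in> ball q \<epsilon> then f z else 0) \<in> meromorphic_functions (disc q \<epsilon>)"
  unfolding mero_disc
  using nicely_meromorphic_cong[OF analytic_on_imp_nicely_meromorphic_on open_ball, of f q \<epsilon>
      "\<lambda>z. if z \<in> ball q \<epsilon> then f z else 0"] assms
  by (simp add: analytic_on_open)

lemma local_coordinate_disc:
  assumes "\<epsilon> > 0" "\<And>w. w \<in> ball 0 \<epsilon> \<Longrightarrow> x (q + w) = c + w"
  shows "local_coordinate (disc q \<epsilon>) x (\<lambda>w. q + w) \<epsilon>"
proof (rule local_coordinateI[OF assms(1)])
  show "x (q + w) = c + w" if "w \<in> ball 0 \<epsilon>" for w by (rule assms(2)[OF that])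
  show "continuous_map (top_of_set (ball 0 \<epsilon>)) (surf_top (disc q \<epsilon>)) (\<lambda>w. q + w)"
    by (auto intro!: continuous_intros simp: dist_norm)
qed (auto intro!: holomorphic_intros)

section \<open>From a solution by quadratures to an algebraic Riccati solution\<close>

text \<open>
  Each of the three kinds of generators produces a differential field without further adjunction of
  derivatives.
\<close>

lemma adjoin_closed_derivation:
  fixes t :: "'a::field_char_0"
  assumes F: "subfld F" and D: "derivation D" "\<And>x. x \<in> F \<Longrightarrow> D x \<in> F"
    and t: "alg_over F t \<or> D t \<in> F \<or> (\<exists>b\<in>F. D t = b * t)" and x: "x \<in> adjoin F t"
  shows "D x \<in> adjoin F t"
proof -
  note A = subfld_adjoin[OF F, of t]
  have "D t \<in> adjoin F t"
  proof (cases "alg_over F t")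
    case True
    obtain P where P: "P \<in> polys_over F" "P \<noteq> 0" "poly P t = 0"
      "\<And>p. p \<in> polys_over F \<Longrightarrow> poly p t = 0 \<Longrightarrow> p \<noteq> 0 \<Longrightarrow> Polynomial.degree P \<le> Polynomial.degree p"
      using alg_over_minimal_polynomial[OF True] by blast
    have d: "D t = - poly (map_poly D P) t / poly (pderiv P) t" "map_poly D P \<in> polys_over F"
      using derivation_algebraic(2,3)[where D = D and F = F and P = P and u = t] F D P by blast+
    show ?thesis
      unfolding d(1)
      using adjoinI[OF F polys_over_closed(7)[OF F d(2)] polys_over_closed(10)[OF F P(1)], of t] by simp
  next
    case False
    then show ?thesis using t A subfldD(4)[OF A(1)] by auto
  qed
  then show ?thesis
    using hom_commutes_adjoin[where g = "\<lambda>x. x" and D = D and D' = D, OF F _ D(1) D(1)] D(2) A(2) x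
    by (auto simp: hom_on_def)
qed

lemma (in coord) expand_analytic:
  assumes "(\<lambda>w. f (\<tau> w)) analytic_on {0}"
  shows "vge 0 (expand \<tau> f)" "red (expand \<tau> f) = f (\<tau> 0)"
proof -
  have "(\<lambda>w. f (\<tau> w)) has_fps_expansion fps_expansion (\<lambda>w. f (\<tau> w)) 0"
    using analytic_at_imp_has_fps_expansion_0[OF assms] .
  then have e: "expand \<tau> f = fps_to_fls (fps_expansion (\<lambda>w. f (\<tau> w)) 0)"
    by (intro expandI has_laurent_expansion_fps)
  show "vge 0 (expand \<tau> f)" by (simp add: e vge_def)
  show "red (expand \<tau> f) = f (\<tau> 0)" by (simp add: e fps_expansion_def)
qed

lemma red_poly_ring:
  fixes P Q :: "'a::field fls poly"
  assumes "integral_poly P" "integral_poly Q"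
  shows "red_poly (P + Q) = red_poly P + red_poly Q" "red_poly (P * Q) = red_poly P * red_poly Q"
    "red_poly (pderiv P) = pderiv (red_poly P)"
proof -
  have i: "vge 0 (Polynomial.coeff P n)" "vge 0 (Polynomial.coeff Q n)" for n using assms by (auto simp: integral_poly_def)
  show "red_poly (P + Q) = red_poly P + red_poly Q" by (intro poly_eqI) simp
  have "red (Polynomial.coeff P n * Polynomial.coeff Q k) = red (Polynomial.coeff P n) * red (Polynomial.coeff Q k)" for n k
    using vge_times_nth[OF i(1)[of n] i(2)[of k]] by simp
  then show "red_poly (P * Q) = red_poly P * red_poly Q"
    by (intro poly_eqI) (simp add: coeff_mult fls_sum_nth)
  show "red_poly (pderiv P) = pderiv (red_poly P)"
    by (intro poly_eqI) (simp add: coeff_pderiv fls_of_nat del: of_nat_Suc)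
qed

lemma integral_poly_pderiv: "integral_poly P \<Longrightarrow> integral_poly (pderiv P :: 'a::field fls poly)"
  by (auto simp: integral_poly_def coeff_pderiv fls_of_nat simp del: of_nat_Suc intro!: vge_0_mult)

lemma red_poly_1: "red_poly (1 :: 'a::field fls poly) = 1"
  by (intro poly_eqI) (simp add: coeff_1)

text \<open>
  The parametrization \<tau> of V is chosen such that its composition with \<pi> parametrizes U.
  Thus a function in K and its pullback have the same expansion.
\<close>

locale quadrature_problem = M: surf_map V U \<pi> for V :: "'b surface" and U :: "'a surface" and \<pi> :: "'b \<Rightarrow> 'a" +
  fixes x :: "'a \<Rightarrow> complex" and K :: "('a \<Rightarrow> complex) set" and \<tau> :: "complex \<Rightarrow> 'b" and r :: real
    and n :: nat and a :: "nat \<Rightarrow> 'a \<Rightarrow> complex"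
  assumes connU: "connected_space (surf_top U)" and x: "x \<in> meromorphic_functions U"
    and K: "differential_subfield U x K"
    and \<tau>V: "local_coordinate V (pull V \<pi> x) \<tau> r" and \<tau>U: "local_coordinate U x (\<lambda>w. \<pi> (\<tau> w)) r"
    and n: "n \<ge> 1" and a: "\<And>i. i \<in> {1..n} \<Longrightarrow> a i \<in> K"
begin

lemma pre_mero_pull:
  assumes "pre_mero U f" shows "pre_mero V (pull V \<pi> f)"
  unfolding pre_mero_def
proof safe
  fix D \<phi> assume c: "(D, \<phi>) \<in> surf_charts V"
  show "(\<lambda>z. pull V \<pi> f (inv_into D \<phi> z)) meromorphic_on \<phi> ` D"
  proof (rule iffD2[OF meromorphic_on_meromorphic_at], rule ballI)
    fix z assume z: "z \<in> \<phi> ` D"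
    define p where "p = inv_into D \<phi> z"
    have p: "p \<in> D" "\<phi> p = z" using M.V.chart_inv[OF c] z by (auto simp: p_def)
    have pV: "p \<in> points V" using M.V.chart_homeo(2)[OF c] p by auto
    obtain E \<psi> where e: "(E, \<psi>) \<in> surf_charts U" "\<pi> p \<in> E" using M.U.chart_cover[OF M.map_points[OF pV]] .
    define W where "W = \<phi> ` {p \<in> D. \<pi> p \<in> E}"
    note h = M.map_holomorphic[OF c e(1), folded W_def]
    have zW: "z \<in> W" using p e by (auto simp: W_def)
    have "(\<lambda>z. f (inv_into E \<psi> (\<psi> (\<pi> (inv_into D \<phi> z))))) meromorphic_on {z}"
    proof (rule meromorphic_on_compose[where A = "\<psi> ` E" and g = "\<lambda>z. f (inv_into E \<psi> z)"
          and f = "\<lambda>z. \<psi> (\<pi> (inv_into D \<phi> z))"])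
      show "(\<lambda>z. f (inv_into E \<psi> z)) meromorphic_on \<psi> ` E" using assms e by (auto simp: pre_mero_def)
      show "(\<lambda>z. \<psi> (\<pi> (inv_into D \<phi> z))) analytic_on {z}" using h zW by (auto simp: analytic_at)
      show "(\<lambda>z. \<psi> (\<pi> (inv_into D \<phi> z))) ` {z} \<subseteq> \<psi> ` E" using e by (auto simp: p_def)
    qed
    moreover have "eventually (\<lambda>z. f (inv_into E \<psi> (\<psi> (\<pi> (inv_into D \<phi> z)))) = pull V \<pi> f (inv_into D \<phi> z)) (at z)"
      using eventually_at_in_open'[OF h(2) zW]
    proof eventually_elim
      case (elim u)
      then have "inv_into D \<phi> u \<in> D" "\<pi> (inv_into D \<phi> u) \<in> E" using M.V.chart_inv[OF c] by (auto simp: W_def)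
      then show ?case using M.U.chart_inv(1)[OF e(1)] M.V.chart_homeo(2)[OF c] by (auto simp: pull_def)
    qed
    ultimately show "(\<lambda>z. pull V \<pi> f (inv_into D \<phi> z)) meromorphic_on {z}"
      by (subst (asm) meromorphic_on_cong) auto
  qed
qed

definition \<rho> :: "complex \<Rightarrow> 'a" where "\<rho> w = \<pi> (\<tau> w)"

sublocale CV: coord V "pull V \<pi> x" \<tau> r
  by unfold_locales (use M.connV pre_mero_pull[OF M.U.mero_pre[OF x]] \<tau>V in auto)

sublocale CU: coord U x \<rho> r
  by unfold_locales (use connU M.U.mero_pre[OF x] \<tau>U in \<open>auto simp: \<rho>_def[abs_def]\<close>)

lemma shifted: "q \<in> ball 0 r \<Longrightarrow> coord U x (\<lambda>w. \<rho> (q + w)) (r - norm q)"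
  by unfold_locales (use connU M.U.mero_pre[OF x] CU.local_coordinate_shift in auto)

lemma K_subfield: "subfield K (mero_field U)" and K_mero: "K \<subseteq> meromorphic_functions U"
  and K_deriv: "f \<in> K \<Longrightarrow> mero_deriv U x f \<in> K"
proof -
  show s: "subfield K (mero_field U)" "f \<in> K \<Longrightarrow> mero_deriv U x f \<in> K" using K by (auto simp: differential_subfield_def)
  interpret F: Ring.field "mero_field U" by (rule CU.field_mero)
  show "K \<subseteq> meromorphic_functions U"
    using subringE(1)[OF subfieldE(1)[OF s(1)]] by (simp add: CU.carrier_mero)
qed

definition L where "L = expand \<rho> ` K"

lemma L: "subfld L" "f \<in> L \<Longrightarrow> fls_deriv f \<in> L"
proof -
  show "subfld L" unfolding L_def by (rule CU.subfld_expand[OF K_subfield])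
  assume "f \<in> L"
  then obtain k where k: "k \<in> K" "f = expand \<rho> k" by (auto simp: L_def)
  then have "fls_deriv f = expand \<rho> (mero_deriv U x k)" using CU.expand_deriv K_mero by auto
  then show "fls_deriv f \<in> L" using K_deriv[OF k(1)] by (auto simp: L_def)
qed

lemma expand_pull: "expand \<tau> (pull V \<pi> f) = expand \<rho> f"
  unfolding expand_def
proof (rule laurent_expansion_cong[OF _ refl])
  have "eventually (\<lambda>w. w \<in> ball 0 r) (at 0)" using CV.r by (intro eventually_at_in_open') auto
  then show "eventually (\<lambda>w. pull V \<pi> f (\<tau> w) = f (\<rho> w)) (at 0)"
    by eventually_elim (use CV.in_points in \<open>auto simp: pull_def \<rho>_def\<close>)
qed

text \<open>
  The fields in the chain are bounded by the tower G of Laurent series fields generated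
  by the expansions of the successive generators, and u = y'/y lies in the top one.
\<close>

theorem quadratures_imp_algebraic_riccati:
  fixes y :: "'b \<Rightarrow> complex"
  assumes sol: "linear_ode_solution V (pull V \<pi> x) n (\<lambda>i. pull V \<pi> (a i)) y"
    and y0: "y \<noteq> \<zero>\<^bsub>mero_field V\<^esub>"
    and rep: "representable_by_generalized_quadratures V (pull V \<pi> x) (pull V \<pi> ` K) y"
  obtains \<sigma> D c where "\<sigma> \<in> ramifications" "D \<in> scaled_derivations" "\<And>x. \<sigma> (fls_deriv x) = D (\<sigma> x)"
    "alg_over (\<sigma> ` L) c" "riccati D n (\<lambda>i. \<sigma> (expand \<rho> (a i))) c = 0"
proof -
  let ?K = "pull V \<pi> ` K" and ?x = "pull V \<pi> x"
  interpret F: Ring.field "mero_field V" by (rule CV.field_mero)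
  obtain E m C where E: "differential_subfield V ?x E" "?K \<subseteq> E" "y \<in> E" and C: "C 0 = ?K" "E \<subseteq> C m"
    and step: "\<forall>i<m. \<exists>y. (exp_integral_over V ?x (C i) y \<or> integral_over V ?x (C i) y \<or> algebraic_over V (C i) y) \<and>
                   C (Suc i) = diff_field_gen V ?x (C i) y"
    using rep unfolding representable_by_generalized_quadratures_def generalized_quadratures_extension_def by blast
  obtain Y where Y: "\<And>i. i < m \<Longrightarrow> exp_integral_over V ?x (C i) (Y i) \<or> integral_over V ?x (C i) (Y i) \<or> algebraic_over V (C i) (Y i)"
    "\<And>i. i < m \<Longrightarrow> C (Suc i) = diff_field_gen V ?x (C i) (Y i)"
    using step by metis
  have "E \<subseteq> meromorphic_functions V"
    using E(1) subringE(1)[OF subfieldE(1)[of E "mero_field V"]] by (auto simp: differential_subfield_def CV.carrier_mero)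
  then have yV: "y \<in> meromorphic_functions V" and KV: "?K \<subseteq> meromorphic_functions V" using E by auto
  define G where "G = rec_nat L (\<lambda>i F. adjoin F (expand \<tau> (Y i)))"
  have G0: "G 0 = L" and GS: "G (Suc i) = adjoin (G i) (expand \<tau> (Y i))" for i by (simp_all add: G_def)
  have main: "subfld (G i) \<and> (\<forall>f\<in>G i. fls_deriv f \<in> G i) \<and> L \<subseteq> G i \<and>
     C i \<subseteq> {f \<in> carrier (mero_field V). expand \<tau> f \<in> G i} \<and>
     (i < m \<longrightarrow> (alg_over (G i) (expand \<tau> (Y i)) \<or> fls_deriv (expand \<tau> (Y i)) \<in> G i \<or>
        (\<exists>b\<in>G i. fls_deriv (expand \<tau> (Y i)) = b * expand \<tau> (Y i))))" (is "?Q i") if "i \<le> m" for i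
    using that
  proof (induction i)
    have st: "alg_over (G i) (expand \<tau> (Y i)) \<or> fls_deriv (expand \<tau> (Y i)) \<in> G i \<or>
        (\<exists>b\<in>G i. fls_deriv (expand \<tau> (Y i)) = b * expand \<tau> (Y i))"
      if im: "i < m" and Gi: "subfld (G i)" and Ci: "C i \<subseteq> {f \<in> carrier (mero_field V). expand \<tau> f \<in> G i}" for i
      using Y(1)[OF im]
    proof (elim disjE)
      assume "exp_integral_over V ?x (C i) (Y i)"
      then obtain b where b: "Y i \<in> meromorphic_functions V" "b \<in> C i" "mero_deriv V ?x (Y i) = b \<otimes>\<^bsub>mero_field V\<^esub> Y i"
        by (auto simp: exp_integral_over_def)
      then have "fls_deriv (expand \<tau> (Y i)) = expand \<tau> b * expand \<tau> (Y i)"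
        using CV.expand_deriv[OF b(1)] CV.expand_hom(2)[of b "Y i"] Ci by (auto simp: CV.carrier_mero)
      then show ?thesis using Ci b(2) by auto
    next
      assume "integral_over V ?x (C i) (Y i)"
      then have "Y i \<in> meromorphic_functions V" "mero_deriv V ?x (Y i) \<in> C i" by (auto simp: integral_over_def)
      then show ?thesis using CV.expand_deriv[of "Y i"] Ci by force
    next
      assume "algebraic_over V (C i) (Y i)"
      then show ?thesis
        using CV.algebraic_over_imp_alg_over[OF _ Gi, of "C i" "Y i"] Ci by auto
    qed
    {
      case 0
      have "C 0 \<subseteq> {f \<in> carrier (mero_field V). expand \<tau> f \<in> G 0}"
        using KV by (auto simp: C G0 CV.carrier_mero expand_pull L_def)
      then show ?case using L st[of 0] by (auto simp: G0)
    next
      case (Suc i)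
      then have Q: "?Q i" and im: "i < m" by auto
      then have Gi: "subfld (G i)" "\<And>f. f \<in> G i \<Longrightarrow> fls_deriv f \<in> G i" by auto
      have GSi: "subfld (G (Suc i))" "G i \<subseteq> G (Suc i)" "expand \<tau> (Y i) \<in> G (Suc i)"
        using subfld_adjoin[OF Gi(1)] by (auto simp: GS)
      have D: "fls_deriv f \<in> G (Suc i)" if "f \<in> G (Suc i)" for f
        using adjoin_closed_derivation[OF Gi(1) derivation_scaled[OF fls_deriv_scaled] Gi(2), of "expand \<tau> (Y i)" f] Q im that
        by (auto simp: GS)
      have "Y i \<in> meromorphic_functions V"
        using Y(1)[OF im] by (auto simp: exp_integral_over_def integral_over_def algebraic_over_def)
      then have "C (Suc i) \<subseteq> {f \<in> carrier (mero_field V). expand \<tau> f \<in> G (Suc i)}"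
        unfolding Y(2)[OF im] diff_field_gen_def
        using CV.differential_subfield_vimage[OF GSi(1) D] Q GSi(2,3)
        by (intro Inter_lower) (auto simp: CV.carrier_mero)
      then show ?case using GSi D Q st[of "Suc i"] by auto
    }
  qed
  define \<eta> where "\<eta> = expand \<tau> y"
  have \<eta>: "\<eta> \<noteq> 0"
    using y0 inj_onD[OF CV.inj_expand, of y "\<zero>\<^bsub>mero_field V\<^esub>"] CV.expand_hom(3) yV F.zero_closed
    by (auto simp: \<eta>_def CV.carrier_mero)
  have \<eta>G: "\<eta> \<in> G m" using main[of m] C E(3) by (auto simp: \<eta>_def)
  define u where "u = fls_deriv \<eta> / \<eta>"
  have uG: "u \<in> G m" unfolding u_def using main[of m] \<eta>G by (auto intro: subfldD(8))
  have "(fls_deriv ^^ n) \<eta> + (\<Sum>i=1..n. expand \<tau> (pull V \<pi> (a i)) * (fls_deriv ^^ (n - i)) \<eta>) = 0"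
    using sol CV.linear_ode_solution_iff[OF _ yV, of n "\<lambda>i. pull V \<pi> (a i)"] KV a unfolding \<eta>_def by blast
  then have "riccati fls_deriv n (\<lambda>i. expand \<tau> (pull V \<pi> (a i))) u * \<eta> = 0"
    using riccati_exponential[OF derivation_scaled[OF fls_deriv_scaled], of \<eta> u n] \<eta> by (simp add: u_def)
  then have ric: "riccati fls_deriv n (\<lambda>i. expand \<rho> (a i)) u = 0" using \<eta> by (simp add: expand_pull)
  have tower: "\<exists>t. G (Suc i) \<subseteq> adjoin (G i) t \<and>
      (alg_over (G i) t \<or> fls_deriv t \<in> G i \<or> (\<exists>b\<in>G i. fls_deriv t = b * t))" if "i < m" for i
    using main[of i] that by (intro exI[of _ "expand \<tau> (Y i)"]) (auto simp: GS)
  have aG: "expand \<rho> (a j) \<in> G i" if "i \<le> m" "j \<in> {1..n}" for i j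
    using main[OF that(1)] a[OF that(2)] by (auto simp: L_def)
  have G: "subfld (G i)" "\<And>f. f \<in> G i \<Longrightarrow> fls_deriv f \<in> G i" if "i \<le> m" for i
    using main[OF that] by auto
  show thesis
    by (rule riccati_tower[of m G n "\<lambda>i. expand \<rho> (a i)" u, OF G(1) G(2) tower n aG uG ric])
      (use that in \<open>auto simp: G0\<close>)
qed

end

section \<open>Holomorphic realization of an algebraic Riccati solution\<close>

lemma poly_pderiv_eq_sum_upto:
  fixes p :: "'a::idom poly"
  assumes "Polynomial.degree p \<le> N"
  shows "poly (pderiv p) x = (\<Sum>i\<le>N. of_nat i * Polynomial.coeff p i * x ^ (i - 1))"
proof -
  have "p = (\<Sum>i\<le>N. Polynomial.monom (Polynomial.coeff p i) i)"
    using assms by (rule poly_as_sum_of_monoms'[symmetric])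
  then have "pderiv p = (\<Sum>i\<le>N. pderiv (Polynomial.monom (Polynomial.coeff p i) i))" using higher_pderiv_sum[of "Suc 0" "\<lambda>i. Polynomial.monom (Polynomial.coeff p i) i" "{..N}"] by simp
  then show ?thesis by (simp add: pderiv_monom poly_sum poly_monom)
qed

context quadrature_problem
begin

text \<open>
  The solution c given by the descent is a Laurent series in a root of w, without any convergence.
  Only its minimal polynomial P is used: the coefficients of P come from functions in K, so P can be
  evaluated at points q near the origin.  An identity AP + BP' = 1 with coefficients in K shows
  that at almost all q the polynomial has simple roots only.  A simple root continues to a
  holomorphic function v near q, and sending c to the expansion of v extends the homomorphism
  that replaces expansions at the origin by expansions at q.
\<close>

theorem algebraic_riccati_solution_on_disc:
  assumes s: "\<sigma> \<in> ramifications" and D: "D \<in> scaled_derivations" and com: "\<And>x. \<sigma> (fls_deriv x) = D (\<sigma> x)"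
    and c: "alg_over (\<sigma> ` L) c" and sol: "riccati D n (\<lambda>i. \<sigma> (expand \<rho> (a i))) c = 0"
  obtains q \<epsilon> v where "\<epsilon> > 0" "ball q \<epsilon> \<subseteq> ball 0 r" "v holomorphic_on ball q \<epsilon>"
    "alg_over (expand (\<lambda>w. \<rho> (q + w)) ` K) (laurent_expansion v q)"
    "riccati fls_deriv n (\<lambda>i. expand (\<lambda>w. \<rho> (q + w)) (a i)) (laurent_expansion v q) = 0"
proof -
  interpret R: endo_monoid "ramifications :: (complex fls \<Rightarrow> complex fls) set"
    using root_closedD(1)[OF root_closed_ramifications] .
  note sh = R.homs[OF s]
  have sL: "subfld (\<sigma> ` L)" using subfld_image[OF hom_on_mono[OF R.hom[OF s]] L(1)] by simp
  obtain P where P: "P \<in> polys_over (\<sigma> ` L)" "P \<noteq> 0" "poly P c = 0"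
    and Pmin: "\<And>p. p \<in> polys_over (\<sigma> ` L) \<Longrightarrow> poly p c = 0 \<Longrightarrow> p \<noteq> 0 \<Longrightarrow> Polynomial.degree P \<le> Polynomial.degree p"
    using alg_over_minimal_polynomial[OF c] by blast
  obtain A B where AB: "A \<in> polys_over (\<sigma> ` L)" "B \<in> polys_over (\<sigma> ` L)" "A * P + B * pderiv P = 1"
    using minimal_polynomial_separable[OF sL P Pmin] .
  define N where "N = Polynomial.degree P"
  have N: "N > 0"
  proof (rule ccontr)
    assume "\<not> N > 0"
    then obtain b where "P = [:b:]" using degree_eq_zeroE[of P] by (auto simp: N_def)
    then show False using P by simp
  qed
  have "\<forall>F\<in>\<sigma> ` L. \<exists>k. k \<in> K \<and> \<sigma> (expand \<rho> k) = F" by (auto simp: L_def)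
  \<comment> \<open>The function in K of which F is the ramified expansion.\<close>
  then obtain \<kappa> where \<kappa>: "\<And>F. F \<in> \<sigma> ` L \<Longrightarrow> \<kappa> F \<in> K" "\<And>F. F \<in> \<sigma> ` L \<Longrightarrow> \<sigma> (expand \<rho> (\<kappa> F)) = F"
    by metis
  have \<kappa>u: "\<kappa> (\<sigma> (expand \<rho> k)) = k" if "k \<in> K" for k
  proof -
    have m: "\<sigma> (expand \<rho> k) \<in> \<sigma> ` L" using that by (auto simp: L_def)
    have "\<sigma> (expand \<rho> (\<kappa> (\<sigma> (expand \<rho> k))) - expand \<rho> k) = 0" using \<kappa>(2)[OF m] by (simp add: sh)
    then have "expand \<rho> (\<kappa> (\<sigma> (expand \<rho> k))) = expand \<rho> k" using sh(7) by auto
    then show ?thesis using CU.expand_eqD \<kappa>(1)[OF m] that K_mero by blast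
  qed
  define Fs where "Fs = insert 0 (set (coeffs P) \<union> set (coeffs A) \<union> set (coeffs B))"
  have FsL: "Fs \<subseteq> \<sigma> ` L" using P(1) AB subfldD(1)[OF sL] by (auto simp: Fs_def polys_over_def coeffs_def)
  have cFs: "Polynomial.coeff P i \<in> Fs" "Polynomial.coeff A i \<in> Fs" "Polynomial.coeff B i \<in> Fs" for i
  proof -
    have "Polynomial.coeff p i \<in> insert 0 (set (coeffs p))" for p :: "complex fls poly"
      using range_coeff[of p] by blast
    then show "Polynomial.coeff P i \<in> Fs" "Polynomial.coeff A i \<in> Fs" "Polynomial.coeff B i \<in> Fs"
      unfolding Fs_def by blast+
  qed
  have lcL: "Polynomial.lead_coeff P \<in> \<sigma> ` L" "Polynomial.lead_coeff P \<noteq> 0"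
    using P(1,2) by (simp_all add: polys_over_def)
  have ev: "eventually (\<lambda>w. w \<in> ball 0 r \<and> (\<forall>F\<in>Fs. (\<lambda>w. \<kappa> F (\<rho> w)) analytic_on {w}) \<and>
      \<kappa> (Polynomial.lead_coeff P) (\<rho> w) \<noteq> 0) (at 0)"
  proof (intro eventually_conj)
    show "eventually (\<lambda>w. w \<in> ball 0 r) (at 0)" using CU.r by (intro eventually_at_in_open') auto
    show "eventually (\<lambda>w. \<forall>F\<in>Fs. (\<lambda>w. \<kappa> F (\<rho> w)) analytic_on {w}) (at 0)"
    proof (rule eventually_ball_finite)
      show "finite Fs" by (simp add: Fs_def)
      show "\<forall>F\<in>Fs. eventually (\<lambda>w. (\<lambda>w. \<kappa> F (\<rho> w)) analytic_on {w}) (at 0)"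
      proof
        fix F assume "F \<in> Fs"
        then have "pre_mero U (\<kappa> F)" using FsL \<kappa>(1) K_mero M.U.mero_pre by blast
        from CU.meromorphic_along[OF this]
        show "eventually (\<lambda>w. (\<lambda>w. \<kappa> F (\<rho> w)) analytic_on {w}) (at 0)"
          by (simp add: meromorphic_on_altdef isolated_singularity_at_altdef)
      qed
    qed
    have "expand \<rho> (\<kappa> (Polynomial.lead_coeff P)) \<noteq> 0" using \<kappa>(2)[OF lcL(1)] lcL(2) sh(1) by metis
    moreover have "pre_mero U (\<kappa> (Polynomial.lead_coeff P))" using \<kappa>(1)[OF lcL(1)] K_mero M.U.mero_pre by blast
    ultimately show "eventually (\<lambda>w. \<kappa> (Polynomial.lead_coeff P) (\<rho> w) \<noteq> 0) (at 0)"
      using has_laurent_expansion_nonzero_imp_eventually_nonzero CU.has_expansion by blast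
  qed
  then obtain S where S: "open S" "0 \<in> S" "\<And>w. w \<in> S \<Longrightarrow> w \<noteq> 0 \<Longrightarrow> w \<in> ball 0 r \<and>
      (\<forall>F\<in>Fs. (\<lambda>w. \<kappa> F (\<rho> w)) analytic_on {w}) \<and> \<kappa> (Polynomial.lead_coeff P) (\<rho> w) \<noteq> 0"
    unfolding eventually_at_topological by blast
  obtain q where q: "q \<in> S - {0}" using eventually_happens'[OF at_neq_bot eventually_at_in_open[OF S(1,2)]] by blast
  have "open (S - {0})" using S(1) by (simp add: open_delete)
  then obtain e where e: "e > 0" "ball q e \<subseteq> S - {0}" using q by (rule openE)
  have qr: "q \<in> ball 0 r" and er: "ball q e \<subseteq> ball 0 r" using S(3) q e(2) by blast+
  interpret Cq: coord U x "\<lambda>w. \<rho> (q + w)" "r - norm q" by (rule shifted[OF qr])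
  define E where "E = expand (\<lambda>w. \<rho> (q + w))"
  have hol: "(\<lambda>w. \<kappa> F (\<rho> w)) holomorphic_on ball q e" if "F \<in> Fs" for F
    using S(3) e(2) that by (intro analytic_imp_holomorphic) (subst analytic_on_analytic_at, blast)
  have shift: "(\<lambda>w. f (q + w)) analytic_on {0}" if "f holomorphic_on ball q d" "d > 0" for f :: "complex \<Rightarrow> complex" and d
  proof -
    have "f \<circ> (\<lambda>w. q + w) holomorphic_on ball 0 d"
      by (rule holomorphic_on_compose_gen[OF _ that(1)]) (auto intro!: holomorphic_intros simp: dist_norm)
    then show ?thesis using that(2) by (auto simp: analytic_at o_def intro!: exI[of _ "ball 0 d"])
  qed
  have int: "vge 0 (E (\<kappa> F))" "red (E (\<kappa> F)) = \<kappa> F (\<rho> q)" if "F \<in> Fs" for F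
    using Cq.expand_analytic[OF shift[OF hol[OF that] e(1)]] by (simp_all add: E_def)
  \<comment> \<open>The homomorphism that replaces ramified expansions at the origin by expansions at q.\<close>
  define h where "h F = E (\<kappa> F)" for F
  have hk: "h (\<sigma> (expand \<rho> k)) = E k" if "k \<in> K" for k using \<kappa>u[OF that] by (simp add: h_def)
  interpret FU: Ring.field "mero_field U" by (rule CU.field_mero)
  note sr = subringE[OF subfieldE(1)[OF K_subfield]]
  have KC: "k \<in> carrier (mero_field U)" if "k \<in> K" for k using K_mero that by (auto simp: CU.carrier_mero)
  have h: "hom_on (\<sigma> ` L) h"
    unfolding hom_on_def
  proof (intro conjI ballI)
    show "h 0 = 0" using hk[OF sr(2)] CU.expand_hom(3) Cq.expand_hom(3) by (simp add: sh E_def)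
    show "h 1 = 1" using hk[OF sr(3)] CU.expand_hom(4) Cq.expand_hom(4) by (simp add: sh E_def)
    fix y z assume "y \<in> \<sigma> ` L" "z \<in> \<sigma> ` L"
    then obtain k l where k: "k \<in> K" "y = \<sigma> (expand \<rho> k)" and l: "l \<in> K" "z = \<sigma> (expand \<rho> l)" by (auto simp: L_def)
    have "y + z = \<sigma> (expand \<rho> (k \<oplus>\<^bsub>mero_field U\<^esub> l))" "y * z = \<sigma> (expand \<rho> (k \<otimes>\<^bsub>mero_field U\<^esub> l))"
      using k l CU.expand_hom(1,2) KC by (simp_all add: sh)
    then show "h (y + z) = h y + h z" "h (y * z) = h y * h z"
      using hk[OF sr(7)[OF k(1) l(1)]] hk[OF sr(6)[OF k(1) l(1)]] hk k l Cq.expand_hom(1,2) KC by (simp_all add: E_def)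
  qed
  have DL: "D y \<in> \<sigma> ` L \<and> h (D y) = fls_deriv (h y)" if yL: "y \<in> \<sigma> ` L" for y
  proof -
    obtain k where k: "k \<in> K" "y = \<sigma> (expand \<rho> k)" using yL by (auto simp: L_def)
    have "D y = \<sigma> (expand \<rho> (mero_deriv U x k))" using k com CU.expand_deriv K_mero by auto
    then show ?thesis using hk[OF K_deriv[OF k(1)]] hk[OF k(1)] K_deriv[OF k(1)] k Cq.expand_deriv K_mero
      by (auto simp: E_def L_def)
  qed
  note hm = map_poly_hom[OF h sL]
  have ip: "integral_poly (map_poly h p)" if "\<And>i. Polynomial.coeff p i \<in> Fs" for p
    using int(1) that hom_onD(1)[OF h sL] by (simp add: integral_poly_def coeff_map_poly h_def)
  have ints: "integral_poly (map_poly h P)" "integral_poly (map_poly h A)" "integral_poly (map_poly h B)"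
    using ip cFs by blast+
  \<comment> \<open>The polynomial over the complex numbers whose coefficients are the values at q.\<close>
  define Pq where "Pq = red_poly (map_poly h P)"
  have Pqc: "Polynomial.coeff Pq i = \<kappa> (Polynomial.coeff P i) (\<rho> q)" for i
    using int(2)[OF cFs(1)[of i]] hom_onD(1)[OF h sL] by (simp add: Pq_def coeff_map_poly h_def)
  have "map_poly h (A * P + B * pderiv P) = map_poly h A * map_poly h P + map_poly h B * pderiv (map_poly h P)"
    using AB(1,2) P(1) by (simp add: hm map_poly_pderiv[OF h sL] polys_over_closed[OF sL])
  moreover have "map_poly h 1 = 1"
    by (intro poly_eqI) (simp add: coeff_map_poly hom_onD(1,2)[OF h sL] coeff_1)
  ultimately have "1 = map_poly h A * map_poly h P + map_poly h B * pderiv (map_poly h P)"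
    unfolding AB(3) by simp
  then have "1 = red_poly (map_poly h A) * Pq + red_poly (map_poly h B) * pderiv Pq"
  proof -
    assume id: "1 = map_poly h A * map_poly h P + map_poly h B * pderiv (map_poly h P)"
    have i2: "integral_poly (p * q)" if "integral_poly p" "integral_poly q" for p q :: "complex fls poly"
      using that by (auto simp: integral_poly_def coeff_mult vge_def fls_sum_nth
          intro!: sum.neutral vge_0_mult[unfolded vge_def, rule_format])
    have "red_poly 1 = red_poly (map_poly h A * map_poly h P) + red_poly (map_poly h B * pderiv (map_poly h P))"
      unfolding id by (intro red_poly_ring(1) i2 ints integral_poly_pderiv)
    then show ?thesis
      using red_poly_ring(2)[OF ints(2,1)] red_poly_ring(2)[OF ints(3) integral_poly_pderiv[OF ints(1)]]
        red_poly_ring(3)[OF ints(1,1)] by (simp add: red_poly_1 Pq_def)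
  qed
  then have bez: "1 = poly (red_poly (map_poly h A)) t * poly Pq t + poly (red_poly (map_poly h B)) t * poly (pderiv Pq) t" for t
    by (metis poly_1 poly_add poly_mult)
  have dPq: "Polynomial.degree Pq \<le> N" using hom_onD(1)[OF h sL]
    by (intro degree_le) (auto simp: Pq_def coeff_map_poly N_def coeff_eq_0)
  have "Polynomial.coeff Pq N \<noteq> 0" using S(3)[of q] q by (simp add: Pqc N_def)
  then have "Polynomial.degree Pq > 0" using N le_degree[of Pq N] by simp
  then obtain X0 where X0: "poly Pq X0 = 0" using alg_closed_imp_poly_has_root by blast
  then have X0': "poly (pderiv Pq) X0 \<noteq> 0" using bez[of X0] by auto
  define g where "g i z = \<kappa> (Polynomial.coeff P i) (\<rho> z)" for i z
  have gh: "g i holomorphic_on ball q e" for i unfolding g_def using hol[OF cFs(1)[of i]] .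
  have r0: "(\<Sum>i\<le>N. g i q * X0 ^ i) = 0" using X0 poly_eq_sum_upto[OF dPq, of X0] by (simp add: Pqc g_def)
  have r1: "(\<Sum>i\<le>N. of_nat i * g i q * X0 ^ (i - 1)) \<noteq> 0"
    using X0' poly_pderiv_eq_sum_upto[OF dPq, of X0] by (simp add: Pqc g_def)
  obtain \<epsilon> v where v: "0 < \<epsilon>" "\<epsilon> \<le> e" "v holomorphic_on ball q \<epsilon>"
    "\<And>z. z \<in> ball q \<epsilon> \<Longrightarrow> (\<Sum>i\<le>N. g i z * v z ^ i) = 0"
    using implicit_holomorphic_root[where g = g and N = N and q = q and e = e and ?X0.0 = X0, OF e(1) gh r0 r1] by blast
  define V where "V = laurent_expansion v q"
  have vl: "(\<lambda>w. v (q + w)) has_laurent_expansion V"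
  proof -
    have "v meromorphic_on {q}" using v(1,3)
      by (intro analytic_on_imp_meromorphic_on) (auto simp: analytic_at intro!: exI[of _ "ball q \<epsilon>"])
    then show ?thesis unfolding V_def by (rule meromorphic_on_imp_has_laurent_expansion) simp
  qed
  have El: "(\<lambda>w. k (\<rho> (q + w))) has_laurent_expansion E k" if "k \<in> K" for k
    using Cq.has_expansion[of k] M.U.mero_pre K_mero that by (auto simp: E_def)
  have \<kappa>K: "\<kappa> (Polynomial.coeff P i) \<in> K" for i using \<kappa>(1) cFs(1) FsL by blast
  have "(\<lambda>w. \<Sum>i\<le>N. g i (q + w) * v (q + w) ^ i) has_laurent_expansion (\<Sum>i\<le>N. E (\<kappa> (Polynomial.coeff P i)) * V ^ i)"
    unfolding g_def by (intro laurent_expansion_intros El vl \<kappa>K)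
  moreover have "(\<Sum>i\<le>N. E (\<kappa> (Polynomial.coeff P i)) * V ^ i) = poly (map_poly h P) V"
    using poly_eq_sum_upto[of "map_poly h P" N V] hm(3)[OF P(1) P(1)] hom_onD(1)[OF h sL]
    by (simp add: N_def coeff_map_poly h_def)
  moreover have "eventually (\<lambda>w. (\<Sum>i\<le>N. g i (q + w) * v (q + w) ^ i) = 0) (at 0)"
  proof -
    have "eventually (\<lambda>w. w \<in> ball 0 \<epsilon>) (at 0)" using v(1) by (intro eventually_at_in_open') auto
    then show ?thesis by eventually_elim (use v(4) in \<open>auto simp: dist_norm\<close>)
  qed
  ultimately have root: "poly (map_poly h P) V = 0"
    using has_laurent_expansion_eventually_zero_iff[of "\<lambda>w. \<Sum>i\<le>N. g i (q + w) * v (q + w) ^ i" 0] by simp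
  have D': "derivation D" "derivation (fls_deriv :: complex fls \<Rightarrow> _)"
    using derivation_scaled D fls_deriv_scaled by blast+
  obtain G where G: "hom_on (adjoin (\<sigma> ` L) c) G" "\<And>y. y \<in> \<sigma> ` L \<Longrightarrow> G y = h y" "G c = V"
    "\<And>y. y \<in> adjoin (\<sigma> ` L) c \<Longrightarrow> D y \<in> adjoin (\<sigma> ` L) c \<and> G (D y) = fls_deriv (G y)"
    using extend_differential_hom_algebraic[where F = "\<sigma> ` L" and h = h and D = D and D' = fls_deriv and P = P and u = c and w = V,
        OF sL h D'] DL P Pmin root by blast
  note AA = subfld_adjoin[OF sL, of c]
  have aL: "\<sigma> (expand \<rho> (a i)) \<in> adjoin (\<sigma> ` L) c" "G (\<sigma> (expand \<rho> (a i))) = E (a i)" if "i \<in> {1..n}" for i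
    using a[OF that] AA(2) G(2) hk by (auto simp: L_def)
  have "G 0 = riccati fls_deriv n (\<lambda>i. G (\<sigma> (expand \<rho> (a i)))) (G c)"
    using riccati_hom[where D = D and D' = fls_deriv and n = n and a = "\<lambda>i. \<sigma> (expand \<rho> (a i))", OF G(1) AA(1,3) aL(1) G(4)] sol
    by simp
  also have "\<dots> = riccati fls_deriv n (\<lambda>i. E (a i)) V" using aL(2) G(3) by (simp add: riccati_def)
  finally have ric: "riccati fls_deriv n (\<lambda>i. E (a i)) V = 0" using hom_onD(1)[OF G(1) AA(1)] by simp
  have "map_poly h P \<in> polys_over (E ` K)"
    using \<kappa>K hom_onD(1)[OF h sL] by (auto simp: polys_over_def coeff_map_poly h_def)
  then have "alg_over (E ` K) V" using root hm(4)[OF P(1) P(1)] P(2) unfolding alg_over_def by blast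
  moreover have "ball q \<epsilon> \<subseteq> ball 0 r" using er v(2) by force
  ultimately show thesis using that[OF v(1) _ v(3)] ric by (simp add: E_def V_def)
qed

end

section \<open>The exponential solution on a disc\<close>

lemma (in coord) nicely_meromorphic_along:
  assumes f: "f \<in> meromorphic_functions V"
  shows "(\<lambda>w. f (\<tau> w)) nicely_meromorphic_on {0}"
proof -
  obtain D \<phi> where c: "(D, \<phi>) \<in> surf_charts V" "\<tau> 0 \<in> D" by (rule chart0)
  let ?F = "\<lambda>z. f (inv_into D \<phi> z)"
  have lim: "filterlim (\<lambda>w. f (\<tau> w)) G (at 0)" if "filterlim ?F G (at (\<phi> (\<tau> 0)))" for G
    using that eventually_atin_chart[OF c] by (intro filterlim_along) (simp add: filterlim_iff)
  have "?F nicely_meromorphic_on \<phi> ` D" using f c by (auto simp: meromorphic_functions_def)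
  then have "is_pole ?F (\<phi> (\<tau> 0)) \<and> f (\<tau> 0) = 0 \<or> (?F \<longlongrightarrow> f (\<tau> 0)) (at (\<phi> (\<tau> 0)))"
    using c by (auto simp: nicely_meromorphic_on_def chart_inv[OF c(1)])
  then show ?thesis
    using meromorphic_along[OF mero_pre[OF f]] lim unfolding nicely_meromorphic_on_def is_pole_def by blast
qed

lemma holomorphic_has_expansion_disc:
  assumes "h holomorphic_on ball q \<epsilon>" "\<epsilon> > 0"
  shows "(\<lambda>w. h (q + w)) has_laurent_expansion expand (\<lambda>w. q + w) (\<lambda>z. if z \<in> ball q \<epsilon> then h z else 0)"
proof -
  have "h meromorphic_on {q}"
    using assms by (intro analytic_on_imp_meromorphic_on) (auto simp: analytic_at intro!: exI[of _ "ball q \<epsilon>"])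
  then have e: "(\<lambda>w. h (q + w)) has_laurent_expansion laurent_expansion h q"
    by (rule meromorphic_on_imp_has_laurent_expansion) simp
  have "eventually (\<lambda>w. w \<in> ball 0 \<epsilon>) (at 0)" using assms(2) by (intro eventually_at_in_open') auto
  then have "eventually (\<lambda>w. h (q + w) = (if q + w \<in> ball q \<epsilon> then h (q + w) else 0)) (at 0)"
    by eventually_elim (auto simp: dist_norm)
  from e[unfolded has_laurent_expansion_cong[OF this refl]] show ?thesis
    using e laurent_expansion_0_eqI unfolding expand_def by metis
qed

context quadrature_problem
begin

lemma pull_disc_mero:
  assumes k: "k \<in> meromorphic_functions U" and sub: "ball q \<epsilon> \<subseteq> ball 0 r"
  shows "pull (disc q \<epsilon>) \<rho> k \<in> meromorphic_functions (disc q \<epsilon>)"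
proof -
  have "(\<lambda>w. k (\<rho> w)) nicely_meromorphic_on {z}" if z: "z \<in> ball q \<epsilon>" for z
  proof -
    interpret Cz: coord U x "\<lambda>w. \<rho> (z + w)" "r - norm z" using shifted z sub by blast
    have n: "(\<lambda>w. k (\<rho> (z + w))) nicely_meromorphic_on {0}" by (rule Cz.nicely_meromorphic_along[OF k])
    then have "(\<lambda>u. k (\<rho> (z + (u - z)))) meromorphic_on {z}"
      by (intro meromorphic_on_compose[where f = "\<lambda>u. u - z" and g = "\<lambda>w. k (\<rho> (z + w))" and A = "{0}"])
        (auto simp: nicely_meromorphic_on_def intro!: analytic_intros)
    moreover have "is_pole (\<lambda>w. k (\<rho> w)) z \<longleftrightarrow> is_pole (\<lambda>w. k (\<rho> (z + w))) 0" by (rule is_pole_shift_0)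
    moreover have "((\<lambda>w. k (\<rho> w)) \<longlongrightarrow> l) (at z) \<longleftrightarrow> ((\<lambda>w. k (\<rho> (z + w))) \<longlongrightarrow> l) (at 0)" for l
      unfolding at_to_0[of z] filterlim_filtermap by (simp add: add.commute)
    ultimately show ?thesis using n by (simp add: nicely_meromorphic_on_def)
  qed
  then have "(\<lambda>w. k (\<rho> w)) nicely_meromorphic_on ball q \<epsilon>"
    unfolding nicely_meromorphic_on_def by (subst meromorphic_on_meromorphic_at) blast
  then have "pull (disc q \<epsilon>) \<rho> k nicely_meromorphic_on ball q \<epsilon>"
    by (rule nicely_meromorphic_cong) (auto simp: pull_def)
  then show ?thesis by (auto simp: mero_disc pull_def)
qed

text \<open>
  The map is a restriction of the parametrization \<rho>, which is injective.
\<close>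

lemma surface_over_disc:
  assumes \<epsilon>: "\<epsilon> > 0" and sub: "ball q \<epsilon> \<subseteq> ball 0 r"
  shows "surface_over (disc q \<epsilon>) \<rho> U"
  unfolding surface_over_def
proof (intro conjI)
  show "connected_riemann_surface (disc q \<epsilon>)" by (rule connected_riemann_surface_disc[OF \<epsilon>])
  show "analytic_map (disc q \<epsilon>) U \<rho>"
    unfolding analytic_map_def
  proof (intro conjI)
    have "continuous_map (subtopology (top_of_set (ball 0 r)) (ball q \<epsilon>)) (surf_top U) \<rho>"
      by (rule continuous_map_from_subtopology[OF CU.cont])
    then show "continuous_map (surf_top (disc q \<epsilon>)) (surf_top U) \<rho>"
      using sub by (simp add: subtopology_subtopology Int_absorb1)
    have "(\<lambda>z. \<psi> (\<rho> (inv_into (ball q \<epsilon>) id z))) holomorphic_on {p \<in> ball q \<epsilon>. \<rho> p \<in> E}"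
      if c: "(E, \<psi>) \<in> surf_charts U" for E \<psi>
    proof -
      have "(\<lambda>z. \<psi> (\<rho> z)) holomorphic_on {p \<in> ball q \<epsilon>. \<rho> p \<in> E}"
        using CU.hol[OF c] by (rule holomorphic_on_subset) (use sub in auto)
      then show ?thesis by (rule holomorphic_transform) (simp add: inv_into_id)
    qed
    then show "\<forall>(D, \<phi>)\<in>surf_charts (disc q \<epsilon>). \<forall>(E, \<psi>)\<in>surf_charts U.
        (\<lambda>z. \<psi> (\<rho> (inv_into D \<phi> z))) holomorphic_on \<phi> ` {p \<in> D. \<rho> p \<in> E}"
      by auto
  qed
  show "\<nexists>c. \<forall>p\<in>points (disc q \<epsilon>). \<rho> p = c"
  proof
    assume "\<exists>c. \<forall>p\<in>points (disc q \<epsilon>). \<rho> p = c"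
    then obtain c where "\<forall>p\<in>ball q \<epsilon>. \<rho> p = c" by auto
    moreover have "q \<in> ball q \<epsilon>" "q + of_real (\<epsilon>/2) \<in> ball q \<epsilon>" "q \<noteq> q + of_real (\<epsilon>/2)"
      using \<epsilon> by (auto simp: dist_norm)
    ultimately show False using inj_onD[OF CU.inj] sub by (metis subsetD)
  qed
qed

text \<open>
  The solution is the exponential of a primitive of v.  On the disc with its standard coordinate,
  all conditions on it can be read off from Laurent expansions at the centre.
\<close>

theorem exponential_solution_on_disc:
  assumes \<epsilon>: "\<epsilon> > 0" and sub: "ball q \<epsilon> \<subseteq> ball 0 r" and v: "v holomorphic_on ball q \<epsilon>"
    and alg: "alg_over (expand (\<lambda>w. \<rho> (q + w)) ` K) (laurent_expansion v q)"
    and ric: "riccati fls_deriv n (\<lambda>i. expand (\<lambda>w. \<rho> (q + w)) (a i)) (laurent_expansion v q) = 0"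
  obtains y where "linear_ode_solution (disc q \<epsilon>) (pull (disc q \<epsilon>) \<rho> x) n (\<lambda>i. pull (disc q \<epsilon>) \<rho> (a i)) y"
    "exp_of_algebraic_integral (disc q \<epsilon>) (pull (disc q \<epsilon>) \<rho> x) (pull (disc q \<epsilon>) \<rho> ` K) y"
proof -
  let ?W = "disc q \<epsilon>" and ?\<tau> = "\<lambda>w::complex. q + w"
  let ?x = "pull ?W \<rho> x"
  interpret W: surf ?W by unfold_locales (rule riemann_surface_disc)
  obtain c where c: "\<And>w. w \<in> ball 0 r \<Longrightarrow> x (\<rho> w) = c + w" using CU.lc unfolding local_coordinate_def by blast
  have xW: "?x \<in> meromorphic_functions ?W" by (rule pull_disc_mero[OF x sub])
  have "local_coordinate ?W ?x ?\<tau> \<epsilon>"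
  proof (rule local_coordinate_disc[OF \<epsilon>])
    fix w :: complex assume "w \<in> ball 0 \<epsilon>"
    then have "q + w \<in> ball q \<epsilon>" by (simp add: dist_norm)
    then show "?x (q + w) = (c + q) + w" using c sub by (auto simp: pull_def)
  qed
  then interpret CW: coord ?W ?x ?\<tau> \<epsilon>
    using connected_riemann_surface_disc[OF \<epsilon>] W.mero_pre[OF xW]
    by unfold_locales (auto simp: connected_riemann_surface_def)
  \<comment> \<open>Meromorphic functions are represented by functions that vanish outside the surface.\<close>
  define ext where "ext h z = (if z \<in> ball q \<epsilon> then h z else 0)" for h :: "complex \<Rightarrow> complex" and z
  have ext: "ext h \<in> meromorphic_functions ?W" "(\<lambda>w. h (q + w)) has_laurent_expansion expand ?\<tau> (ext h)"
    if "h holomorphic_on ball q \<epsilon>" for h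
    using holomorphic_imp_mero_disc[OF that] holomorphic_has_expansion_disc[OF that \<epsilon>] by (simp_all add: ext_def[abs_def])
  have ev: "eventually (\<lambda>w. q + w \<in> ball q \<epsilon>) (at 0)"
  proof -
    have "eventually (\<lambda>w. w \<in> ball 0 \<epsilon>) (at 0)" using \<epsilon> by (intro eventually_at_in_open') auto
    then show ?thesis by eventually_elim (simp add: dist_norm)
  qed
  have der: "fls_deriv (expand ?\<tau> (ext h)) = expand ?\<tau> (ext h')"
    if h: "h holomorphic_on ball q \<epsilon>" and h': "h' holomorphic_on ball q \<epsilon>"
      and d: "\<And>z. z \<in> ball q \<epsilon> \<Longrightarrow> (h has_field_derivative h' z) (at z)" for h h'
  proof -
    have "(\<lambda>w. h' (q + w)) has_laurent_expansion fls_deriv (expand ?\<tau> (ext h))"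
    proof (rule has_laurent_expansion_deriv'[OF ext(2)[OF h], of "ball 0 \<epsilon>"])
      fix w :: complex assume "w \<in> ball 0 \<epsilon> - {0}"
      then have "q + w \<in> ball q \<epsilon>" by (simp add: dist_norm)
      from d[OF this] show "((\<lambda>w. h (q + w)) has_field_derivative h' (q + w)) (at w)"
        using DERIV_shift[of h "h' (q + w)" w q] by (simp add: add.commute)
    qed (use \<epsilon> in auto)
    then show ?thesis using ext(2)[OF h'] laurent_expansion_0_eqI by metis
  qed
  obtain Z where Z': "\<And>z. z \<in> ball q \<epsilon> \<Longrightarrow> (Z has_field_derivative v z) (at z within ball q \<epsilon>)"
    using holomorphic_convex_primitive'[OF convex_ball open_ball v] by blast
  have Z: "(Z has_field_derivative v z) (at z)" if "z \<in> ball q \<epsilon>" for z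
    using Z'[OF that] unfolding at_within_open[OF that open_ball] .
  have Zh: "Z holomorphic_on ball q \<epsilon>" unfolding holomorphic_on_def field_differentiable_def using Z' by blast
  have eZh: "(\<lambda>z. exp (Z z)) holomorphic_on ball q \<epsilon>" by (intro holomorphic_intros Zh)
  define y where "y = ext (\<lambda>z. exp (Z z))"
  have ym: "y \<in> meromorphic_functions ?W" unfolding y_def by (rule ext(1)[OF eZh])
  have ve: "expand ?\<tau> (ext v) = laurent_expansion v q"
  proof -
    have "v meromorphic_on {q}"
      using v \<epsilon> by (intro analytic_on_imp_meromorphic_on) (auto simp: analytic_at intro!: exI[of _ "ball q \<epsilon>"])
    then have "(\<lambda>w. v (q + w)) has_laurent_expansion laurent_expansion v q"
      by (rule meromorphic_on_imp_has_laurent_expansion) simp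
    then show ?thesis using ext(2)[OF v] laurent_expansion_0_eqI by metis
  qed
  have "fls_deriv (expand ?\<tau> y) = expand ?\<tau> (ext (\<lambda>z. v z * exp (Z z)))"
    unfolding y_def by (intro der eZh holomorphic_intros v Zh) (auto intro!: derivative_eq_intros Z)
  also have "\<dots> = laurent_expansion v q * expand ?\<tau> y"
  proof -
    have "(\<lambda>z. v z * exp (Z z)) holomorphic_on ball q \<epsilon>" by (intro holomorphic_intros v Zh)
    from ext(2)[OF this] has_laurent_expansion_mult[OF ext(2)[OF v] ext(2)[OF eZh]]
    show ?thesis using laurent_expansion_0_eqI unfolding y_def ve by metis
  qed
  finally have dy: "fls_deriv (expand ?\<tau> y) = laurent_expansion v q * expand ?\<tau> y" .
  have ep: "expand ?\<tau> (pull ?W \<rho> k) = expand (\<lambda>w. \<rho> (q + w)) k" for k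
    unfolding expand_def
    by (rule laurent_expansion_cong[OF _ refl], use ev in eventually_elim) (simp add: pull_def)
  have "(fls_deriv ^^ n) (expand ?\<tau> y) + (\<Sum>i=1..n. expand ?\<tau> (pull ?W \<rho> (a i)) * (fls_deriv ^^ (n - i)) (expand ?\<tau> y)) = 0"
    using riccati_exponential[OF derivation_scaled[OF fls_deriv_scaled] dy, of n] ric by (simp add: ep)
  then have "linear_ode_solution ?W ?x n (\<lambda>i. pull ?W \<rho> (a i)) y"
    using a K_mero by (subst CW.linear_ode_solution_iff[OF pull_disc_mero[OF _ sub] ym]) auto
  moreover have "exp_of_algebraic_integral ?W ?x (pull ?W \<rho> ` K) y"
    unfolding exp_of_algebraic_integral_def
  proof (intro conjI bexI[of _ "ext Z"] ballI)
    show "y p = exp (ext Z p)" if "p \<in> points ?W" for p using that by (simp add: y_def ext_def)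
    show "algebraic_over ?W (pull ?W \<rho> ` K) (mero_deriv ?W ?x (ext Z))"
    proof (rule CW.alg_over_imp_algebraic_over)
      show "mero_deriv ?W ?x (ext Z) \<in> meromorphic_functions ?W" by (rule W.mero_deriv_mem[OF ext(1)[OF Zh] W.mero_pre[OF xW]])
      show "pull ?W \<rho> ` K \<subseteq> meromorphic_functions ?W" using pull_disc_mero[OF _ sub] K_mero by auto
      have "expand ?\<tau> (mero_deriv ?W ?x (ext Z)) = laurent_expansion v q"
        using CW.expand_deriv[OF ext(1)[OF Zh]] der[OF Zh v Z] ve by simp
      moreover have "expand ?\<tau> ` pull ?W \<rho> ` K = expand (\<lambda>w. \<rho> (q + w)) ` K" by (simp add: image_image ep)
      ultimately show "alg_over (expand ?\<tau> ` pull ?W \<rho> ` K) (expand ?\<tau> (mero_deriv ?W ?x (ext Z)))" using alg by simp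
    qed
  qed (use ym ext(1)[OF Zh] in auto)
  ultimately show thesis by (rule that)
qed

end

theorem theorem2p11:
  fixes U :: "'a surface" and x :: "'a \<Rightarrow> complex" and K :: "('a \<Rightarrow> complex) set"
    and n :: nat and a :: "nat \<Rightarrow> 'a \<Rightarrow> complex"
    and V :: "'b surface" and \<pi> :: "'b \<Rightarrow> 'a" and y :: "'b \<Rightarrow> complex"
  assumes "functional_differential_field U x K"
    and "n \<ge> 1"
    and "\<And>i. i \<in> {1..n} \<Longrightarrow> a i \<in> K"
    and "surface_over V \<pi> U"
    and "linear_ode_solution V (pull V \<pi> x) n (\<lambda>i. pull V \<pi> (a i)) y"
    and "y \<noteq> \<zero>\<^bsub>mero_field V\<^esub>"
    and "representable_by_generalized_quadratures V (pull V \<pi> x) (pull V \<pi> ` K) y"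
  shows "\<exists>(W :: complex surface) (\<rho> :: complex \<Rightarrow> 'a) y\<^sub>1.
           surface_over W \<rho> U \<and>
           linear_ode_solution W (pull W \<rho> x) n (\<lambda>i. pull W \<rho> (a i)) y\<^sub>1 \<and>
           exp_of_algebraic_integral W (pull W \<rho> x) (pull W \<rho> ` K) y\<^sub>1"
proof -
  have U: "riemann_surface U" "connected_space (surf_top U)" "x \<in> meromorphic_functions U" "\<nexists>c. x = mero_const U c"
    "differential_subfield U x K"
    using assms(1) by (auto simp: functional_differential_field_def connected_riemann_surface_def)
  have V: "riemann_surface V" "connected_space (surf_top V)" "points V \<noteq> {}" "analytic_map V U \<pi>"
    "\<nexists>c. \<forall>p \<in> points V. \<pi> p = c"
    using assms(4) by (auto simp: surface_over_def connected_riemann_surface_def)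
  interpret M: surf_map V U \<pi> by unfold_locales (fact U V)+
  obtain p0 where "p0 \<in> points V" using V(3) by blast
  then obtain \<tau> r where t: "local_coordinate V (pull V \<pi> x) \<tau> r" "local_coordinate U x (\<lambda>w. \<pi> (\<tau> w)) r"
    using M.exists_local_coordinate[OF U(2-4)] by metis
  interpret quadrature_problem V U \<pi> x K \<tau> r n a
    by unfold_locales (use U t assms(2,3) in auto)
  obtain \<sigma> D c where s: "\<sigma> \<in> ramifications" "D \<in> scaled_derivations" "\<And>x. \<sigma> (fls_deriv x) = D (\<sigma> x)"
    "alg_over (\<sigma> ` L) c" "riccati D n (\<lambda>i. \<sigma> (expand \<rho> (a i))) c = 0"
    using quadratures_imp_algebraic_riccati[OF assms(5-7)] by metis
  obtain q \<epsilon> v where q: "\<epsilon> > 0" "ball q \<epsilon> \<subseteq> ball 0 r" "v holomorphic_on ball q \<epsilon>"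
    "alg_over (expand (\<lambda>w. \<rho> (q + w)) ` K) (laurent_expansion v q)"
    "riccati fls_deriv n (\<lambda>i. expand (\<lambda>w. \<rho> (q + w)) (a i)) (laurent_expansion v q) = 0"
    using algebraic_riccati_solution_on_disc[OF s] .
  obtain y1 where "linear_ode_solution (disc q \<epsilon>) (pull (disc q \<epsilon>) \<rho> x) n (\<lambda>i. pull (disc q \<epsilon>) \<rho> (a i)) y1"
    "exp_of_algebraic_integral (disc q \<epsilon>) (pull (disc q \<epsilon>) \<rho> x) (pull (disc q \<epsilon>) \<rho> ` K) y1"
    using exponential_solution_on_disc[OF q] .
  then show ?thesis using surface_over_disc[OF q(1,2)] by blast
qed

end
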